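(* Let $\mathfrak{g}$ be a nilpotent super Lie algebra over $k$ and $\lambda\in\mathrm{Hom}(\mathfrak{g},k)$. Let $\mathfrak{h}$ and $\mathfrak{h}'$ be two polarizations of $\mathfrak{g}$ at $\lambda$, let $i,j\in\mathbb{Z}/2\mathbb{Z}$, and let $\rho_{\mathfrak{h},i}$ and $\rho_{\mathfrak{h}',j}$ be the structure morphisms of the $\mathcal{U}(\mathfrak{g})$-modules $\mathrm{ind}(F_{\lambda,\mathfrak{h},i},\mathfrak{g})$ and $\mathrm{ind}(F_{\lambda,\mathfrak{h}',j},\mathfrak{g})$, respectively. Then $\ker(\rho_{\mathfrak{h},i})=\ker(\rho_{\mathfrak{h}',j})$.
   Context: $k$ is an algebraically closed field of characteristic $0$. A super vector space is a $\mathbb{Z}/2\mathbb{Z}$-graded $k$-vector space; morphisms preserve the grading; subspaces are graded. A super Lie algebra $\mathfrak{g}=\mathfrak{g}_0\oplus\mathfrak{g}_1$ (always finite dimensional) is a super vector space with a degree-preserving bracket satisfying $[x,y]=-(-1)^{|x||y|}[y,x]$ and $[x,[y,z]]=[[x,y],z]+(-1)^{|x||y|}[y,[x,z]]$ for homogeneous $x,y,z$. It is nilpotent if its lower central series $\mathcal{C}^1(\mathfrak{g})=\mathfrak{g}$, $\mathcal{C}^{i}(\mathfrak{g})=[\mathfrak{g},\mathcal{C}^{i-1}(\mathfrak{g})]$ reaches $0$. $\mathcal{U}(\mathfrak{g})$ is the universal enveloping algebra, a super algebra. The structure morphism of a module $V$ is the corresponding morphism of super algebras from $\mathcal{U}(\mathfrak{g})$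 to the super algebra of all $k$-linear endomorphisms of $V$. $\mathrm{Hom}(\mathfrak{g},k)$ is the space of linear functionals $\lambda:\mathfrak{g}\to k$ with $\lambda(\mathfrak{g}_1)=0$. Such $\lambda$ defines the even superantisymmetric bilinear form $\langle x,y\rangle_\lambda=\lambda([x,y])$ on $\mathfrak{g}$, with kernel $\mathfrak{g}^\lambda=\{x\in\mathfrak{g}: \lambda([x,\mathfrak{g}])=0\}$. A (graded) subalgebra $\mathfrak{h}\subseteq\mathfrak{g}$ is subordinate to $\lambda$ if $\lambda([\mathfrak{h},\mathfrak{h}])=0$ and $\mathfrak{h}\supseteq\mathfrak{g}^\lambda$. A polarization of $\mathfrak{g}$ at $\lambda$ is a subalgebra $\mathfrak{h}$ subordinate to $\lambda$ which is a maximal totally isotropic (graded) subspace of $\mathfrak{g}$ with respect to $\langle\ ,\ \rangle_\lambda$ (maximal with respect to inclusion among graded subspaces on which the form vanishes). For such $\mathfrak{h}$ and $i\in\mathbb{Z}/2\mathbb{Z}$, $F_{\lambda,\mathfrak{h},i}=k\,v$ is the one-dimensional $\mathfrak{h}$-representation with $|v|=i$ and $x\cdot v=\lambda(x)v$ for $x\in\mathfrak{h}$. For an $\mathfrak{h}$-representation $W$, $\mathrm{ind}(W,\mathfrak{g})=\mathcal{U}(\mathfrak{g})\otimes_{\mathcal{U}(\mathfrak{h})}W$. *)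

theory Defs
  imports
    "HOL-Computational_Algebra.Polynomial"
    "HOL-Library.Poly_Mapping"
    "HOL-Library.Set_Algebras"
    "HOL-Library.FuncSet"
    "HOL-Library.Z2"
    "HOL-Algebra.QuotRing"
    "HOL-Algebra.Module"
begin

section \<open>Super vector spaces and super Lie algebras\<close>

text \<open>
  The type \<^typ>\<open>bit\<close> is the field with two elements and serves as \<open>Z/2Z\<close>.
  A super vector space is given by its two homogeneous parts, which are subspaces of an
  ambient vector space over \<open>'k\<close>; its underlying space is their sum.
\<close>

definition underlying :: "(bit \<Rightarrow> 'v::plus set) \<Rightarrow> 'v set" where
  "underlying V = {x + y | x y. x \<in> V 0 \<and> y \<in> V 1}"

text \<open>The sign \<open>(-1)\<close> to the power \<open>d e\<close>.\<close>

definition koszul :: "bit \<Rightarrow> bit \<Rightarrow> 'k::ring_1" where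
  "koszul d e = (if d = 1 \<and> e = 1 then - 1 else 1)"

record ('k, 'g) super_lie =
  lscale :: "'k \<Rightarrow> 'g \<Rightarrow> 'g"
  lpart :: "bit \<Rightarrow> 'g set"
  lbracket :: "'g \<Rightarrow> 'g \<Rightarrow> 'g"

abbreviation lspace :: "('k, 'g::plus) super_lie \<Rightarrow> 'g set" where
  "lspace L \<equiv> underlying (lpart L)"

text \<open>Nothing is assumed about the values of the bracket outside the underlying space.\<close>

locale super_lie_algebra =
  fixes L :: "('k::field, 'g::ab_group_add) super_lie"
  assumes vector_space: "vector_space (lscale L)"
    and part_subspace: "module.subspace (lscale L) (lpart L d)"
    and parts_disjoint: "lpart L 0 \<inter> lpart L 1 = {0}"
    and finite_dimensional: "\<exists>B. finite B \<and> lspace L = module.span (lscale L) B"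
    and bracket_add_left:
      "\<lbrakk>x \<in> lspace L; y \<in> lspace L; z \<in> lspace L\<rbrakk>
        \<Longrightarrow> lbracket L (x + y) z = lbracket L x z + lbracket L y z"
    and bracket_add_right:
      "\<lbrakk>x \<in> lspace L; y \<in> lspace L; z \<in> lspace L\<rbrakk>
        \<Longrightarrow> lbracket L x (y + z) = lbracket L x y + lbracket L x z"
    and bracket_scale_left:
      "\<lbrakk>x \<in> lspace L; y \<in> lspace L\<rbrakk>
        \<Longrightarrow> lbracket L (lscale L c x) y = lscale L c (lbracket L x y)"
    and bracket_scale_right:
      "\<lbrakk>x \<in> lspace L; y \<in> lspace L\<rbrakk>
        \<Longrightarrow> lbracket L x (lscale L c y) = lscale L c (lbracket L x y)"
    and bracket_degree:
      "\<lbrakk>x \<in> lpart L d; y \<in> lpart L e\<rbrakk> \<Longrightarrow> lbracket L x y \<in> lpart L (d + e)"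
    and bracket_antisym:
      "\<lbrakk>x \<in> lpart L d; y \<in> lpart L e\<rbrakk>
        \<Longrightarrow> lbracket L x y = - lscale L (koszul d e) (lbracket L y x)"
    and bracket_jacobi:
      "\<lbrakk>x \<in> lpart L d; y \<in> lpart L e; z \<in> lpart L f\<rbrakk>
        \<Longrightarrow> lbracket L x (lbracket L y z) =
              lbracket L (lbracket L x y) z
              + lscale L (koszul d e) (lbracket L y (lbracket L x z))"

definition bracket_space :: "('k::field, 'g::ab_group_add) super_lie \<Rightarrow> 'g set \<Rightarrow> 'g set \<Rightarrow> 'g set" where
  "bracket_space L A B = module.span (lscale L) {lbracket L x y | x y. x \<in> A \<and> y \<in> B}"

text \<open>The index is shifted by one: \<open>lower_central L n\<close> is the term number \<open>n + 1\<close> of the series.\<close>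

primrec lower_central :: "('k::field, 'g::ab_group_add) super_lie \<Rightarrow> nat \<Rightarrow> 'g set" where
  "lower_central L 0 = lspace L"
| "lower_central L (Suc n) = bracket_space L (lspace L) (lower_central L n)"

definition nilpotent_super_lie :: "('k::field, 'g::ab_group_add) super_lie \<Rightarrow> bool" where
  "nilpotent_super_lie L \<longleftrightarrow> (\<exists>n. lower_central L n = {0})"

definition graded_subspace :: "('k::field, 'g::ab_group_add) super_lie \<Rightarrow> 'g set \<Rightarrow> bool" where
  "graded_subspace L S \<longleftrightarrow>
     module.subspace (lscale L) S \<and> S = underlying (\<lambda>d. S \<inter> lpart L d)"

definition lie_subalgebra :: "('k::field, 'g::ab_group_add) super_lie \<Rightarrow> 'g set \<Rightarrow> bool" where
  "lie_subalgebra L h \<longleftrightarrow>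
     graded_subspace L h \<and> (\<forall>x\<in>h. \<forall>y\<in>h. lbracket L x y \<in> h)"

text \<open>A graded subalgebra, regarded as a super Lie algebra in its own right.\<close>

definition restrict_lie :: "('k, 'g) super_lie \<Rightarrow> 'g set \<Rightarrow> ('k, 'g) super_lie" where
  "restrict_lie L h = L\<lparr>lpart := (\<lambda>d. h \<inter> lpart L d)\<rparr>"

section \<open>Polarizations\<close>

definition even_functional :: "('k::field, 'g::ab_group_add) super_lie \<Rightarrow> ('g \<Rightarrow> 'k) \<Rightarrow> bool" where
  "even_functional L lam \<longleftrightarrow>
     (\<forall>x\<in>lspace L. \<forall>y\<in>lspace L. lam (x + y) = lam x + lam y) \<and>
     (\<forall>c. \<forall>x\<in>lspace L. lam (lscale L c x) = c * lam x) \<and>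
     (\<forall>x\<in>lpart L 1. lam x = 0)"

definition lie_form :: "('k, 'g) super_lie \<Rightarrow> ('g \<Rightarrow> 'k) \<Rightarrow> 'g \<Rightarrow> 'g \<Rightarrow> 'k" where
  "lie_form L lam x y = lam (lbracket L x y)"

definition form_kernel :: "('k::field, 'g::ab_group_add) super_lie \<Rightarrow> ('g \<Rightarrow> 'k) \<Rightarrow> 'g set" where
  "form_kernel L lam = {x \<in> lspace L. \<forall>y\<in>lspace L. lie_form L lam x y = 0}"

definition subordinate :: "('k::field, 'g::ab_group_add) super_lie \<Rightarrow> ('g \<Rightarrow> 'k) \<Rightarrow> 'g set \<Rightarrow> bool" where
  "subordinate L lam h \<longleftrightarrow>
     lie_subalgebra L h \<and> (\<forall>z\<in>bracket_space L h h. lam z = 0) \<and> form_kernel L lam \<subseteq> h"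

definition totally_isotropic :: "('k::field, 'g::ab_group_add) super_lie \<Rightarrow> ('g \<Rightarrow> 'k) \<Rightarrow> 'g set \<Rightarrow> bool" where
  "totally_isotropic L lam S \<longleftrightarrow>
     graded_subspace L S \<and> (\<forall>x\<in>S. \<forall>y\<in>S. lie_form L lam x y = 0)"

definition polarization :: "('k::field, 'g::ab_group_add) super_lie \<Rightarrow> ('g \<Rightarrow> 'k) \<Rightarrow> 'g set \<Rightarrow> bool" where
  "polarization L lam h \<longleftrightarrow>
     subordinate L lam h \<and> totally_isotropic L lam h \<and>
     (\<forall>S. totally_isotropic L lam S \<and> h \<subseteq> S \<longrightarrow> S = h)"

section \<open>The universal enveloping algebra\<close>

text \<open>
  Finitely supported functions on words form the free associative algebra: \<^class>\<open>monoid_add\<close> on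
  words is concatenation, so the product of \<open>\<Rightarrow>\<^sub>0\<close> is the convolution product.
\<close>

datatype 'a fword = FWord (letters: "'a list")

instantiation fword :: (type) monoid_add
begin

definition "0 = FWord []"

definition "v + w = FWord (letters v @ letters w)"

instance
  by standard (simp_all add: zero_fword_def plus_fword_def)

end

abbreviation fgen :: "'a \<Rightarrow> 'a fword \<Rightarrow>\<^sub>0 'k::ring_1" where
  "fgen x \<equiv> Poly_Mapping.single (FWord [x]) 1"

abbreviation fconst :: "'k \<Rightarrow> 'a fword \<Rightarrow>\<^sub>0 'k::ring_1" where
  "fconst c \<equiv> Poly_Mapping.single 0 c"

definition free_algebra :: "'a set \<Rightarrow> ('a fword \<Rightarrow>\<^sub>0 'k::ring_1) ring" where
  "free_algebra S =
     \<lparr>carrier = {p. \<forall>w\<in>Poly_Mapping.keys p. set (letters w) \<subseteq> S},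
      mult = (*), one = 1, zero = 0, add = (+)\<rparr>"

text \<open>
  The first two families of relations turn the free algebra on the underlying set into the tensor
  algebra, the third one is the super commutation rule.
\<close>

definition env_relations :: "('k::field, 'g::ab_group_add) super_lie \<Rightarrow> ('g fword \<Rightarrow>\<^sub>0 'k) set" where
  "env_relations L =
     {fgen (x + y) - fgen x - fgen y | x y. x \<in> lspace L \<and> y \<in> lspace L} \<union>
     {fgen (lscale L c x) - fconst c * fgen x | c x. x \<in> lspace L} \<union>
     {fgen x * fgen y - fconst (koszul d e) * (fgen y * fgen x) - fgen (lbracket L x y)
        | x y d e. x \<in> lpart L d \<and> y \<in> lpart L e}"

definition env_ideal :: "('k::field, 'g::ab_group_add) super_lie \<Rightarrow> ('g fword \<Rightarrow>\<^sub>0 'k) set" where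
  "env_ideal L = genideal (free_algebra (lspace L)) (env_relations L)"

definition env_coset :: "('k::field, 'g::ab_group_add) super_lie \<Rightarrow> ('g fword \<Rightarrow>\<^sub>0 'k) \<Rightarrow> ('g fword \<Rightarrow>\<^sub>0 'k) set" where
  "env_coset L p = env_ideal L +>\<^bsub>free_algebra (lspace L)\<^esub> p"

record ('k, 'a) super_algebra = "('k, 'a) module" +
  homog :: "bit \<Rightarrow> 'a set"

definition word_degree :: "('k, 'g) super_lie \<Rightarrow> 'g fword \<Rightarrow> bit \<Rightarrow> bool" where
  "word_degree L w d \<longleftrightarrow>
     (\<exists>ds. list_all2 (\<lambda>x e. x \<in> lpart L e) (letters w) ds \<and> sum_list ds = d)"

definition env_algebra ::
    "('k::field, 'g::ab_group_add) super_lie \<Rightarrow> ('k, ('g fword \<Rightarrow>\<^sub>0 'k) set) super_algebra" where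
  "env_algebra L =
     (let Q = free_algebra (lspace L) Quot env_ideal L
      in \<lparr>carrier = carrier Q, mult = mult Q, one = one Q, zero = zero Q, add = add Q,
          smult = (\<lambda>c u. env_coset L (fconst c) \<otimes>\<^bsub>Q\<^esub> u),
          homog = (\<lambda>d. env_coset L ` {p. \<forall>w\<in>Poly_Mapping.keys p. word_degree L w d})\<rparr>)"

text \<open>
  The algebra morphism from the enveloping algebra of a subalgebra to that of \<open>L\<close>
  that is induced by the inclusion.
\<close>

definition env_incl ::
    "('k::field, 'g::ab_group_add) super_lie \<Rightarrow> ('g fword \<Rightarrow>\<^sub>0 'k) set \<Rightarrow> ('g fword \<Rightarrow>\<^sub>0 'k) set" where
  "env_incl L a = (\<Union>p\<in>a. env_coset L p)"

section \<open>Induced modules\<close>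

record ('k, 'g, 'w) super_rep =
  rscale :: "'k \<Rightarrow> 'w \<Rightarrow> 'w"
  rpart :: "bit \<Rightarrow> 'w set"
  ract :: "'g \<Rightarrow> 'w \<Rightarrow> 'w"

text \<open>
  The action of the enveloping algebra on a representation. All representatives \<open>p\<close> of a class
  \<open>a\<close> act in the same way on the space of the representation.
\<close>

definition env_act ::
    "('k::field, 'g, 'w::comm_monoid_add) super_rep \<Rightarrow> ('g fword \<Rightarrow>\<^sub>0 'k) set \<Rightarrow> 'w \<Rightarrow> 'w" where
  "env_act W a w =
     the_elem ((\<lambda>p. \<Sum>v\<in>Poly_Mapping.keys p.
        rscale W (Poly_Mapping.lookup p v) (foldr (ract W) (letters v) w)) ` a)"

text \<open>The representation on \<open>k v\<close> with \<open>v\<close> of degree \<open>i\<close>; the space is \<open>k\<close> itself and \<open>v = 1\<close>.\<close>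

definition char_rep :: "('g \<Rightarrow> 'k::field) \<Rightarrow> bit \<Rightarrow> ('k, 'g, 'k) super_rep" where
  "char_rep lam i =
     \<lparr>rscale = (*), rpart = (\<lambda>d. if d = i then UNIV else {0}), ract = (\<lambda>x w. lam x * w)\<rparr>"

definition pm_scale :: "'k \<Rightarrow> ('x \<Rightarrow>\<^sub>0 'k) \<Rightarrow> ('x \<Rightarrow>\<^sub>0 'k::field)" where
  "pm_scale c = Poly_Mapping.map ((*) c)"

text \<open>
  The tensor product over the enveloping algebra of \<open>h\<close> is the free vector space on pairs
  \<open>(u, w)\<close> modulo the span of the following relations. The last family lets the enveloping
  algebra of \<open>h\<close> act on that of \<open>L\<close> by right multiplication.
\<close>

abbreviation tgen :: "'u \<Rightarrow> 'w \<Rightarrow> 'u \<times> 'w \<Rightarrow>\<^sub>0 'k::field" where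
  "tgen u w \<equiv> Poly_Mapping.single (u, w) 1"

definition tensor_relations ::
    "('k::field, 'g::ab_group_add) super_lie \<Rightarrow> 'g set \<Rightarrow> ('k, 'g, 'w::comm_monoid_add) super_rep
      \<Rightarrow> (('g fword \<Rightarrow>\<^sub>0 'k) set \<times> 'w \<Rightarrow>\<^sub>0 'k) set" where
  "tensor_relations L h W =
     (let U = env_algebra L; H = env_algebra (restrict_lie L h) in
      {tgen (u \<oplus>\<^bsub>U\<^esub> u') w - tgen u w - tgen u' w
         | u u' w. u \<in> carrier U \<and> u' \<in> carrier U \<and> w \<in> underlying (rpart W)} \<union>
      {tgen u (w + w') - tgen u w - tgen u w'
         | u w w'. u \<in> carrier U \<and> w \<in> underlying (rpart W) \<and> w' \<in> underlying (rpart W)} \<union>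
      {tgen (c \<odot>\<^bsub>U\<^esub> u) w - pm_scale c (tgen u w)
         | c u w. u \<in> carrier U \<and> w \<in> underlying (rpart W)} \<union>
      {tgen u (rscale W c w) - pm_scale c (tgen u w)
         | c u w. u \<in> carrier U \<and> w \<in> underlying (rpart W)} \<union>
      {tgen (u \<otimes>\<^bsub>U\<^esub> env_incl L a) w - tgen u (env_act W a w)
         | u a w. u \<in> carrier U \<and> a \<in> carrier H \<and> w \<in> underlying (rpart W)})"

definition tensor_null ::
    "('k::field, 'g::ab_group_add) super_lie \<Rightarrow> 'g set \<Rightarrow> ('k, 'g, 'w::comm_monoid_add) super_rep
      \<Rightarrow> (('g fword \<Rightarrow>\<^sub>0 'k) set \<times> 'w \<Rightarrow>\<^sub>0 'k) set" where
  "tensor_null L h W = module.span pm_scale (tensor_relations L h W)"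

text \<open>
  A super module over an algebra with elements of type \<open>'u\<close>. The carrier consists of
  cosets, so addition and scalar multiplication cannot come from type classes.
\<close>

record ('k, 'u, 'm) super_module = "'m partial_object" +
  mzero :: 'm
  madd :: "'m \<Rightarrow> 'm \<Rightarrow> 'm"
  mscale :: "'k \<Rightarrow> 'm \<Rightarrow> 'm"
  mpart :: "bit \<Rightarrow> 'm set"
  mact :: "'u \<Rightarrow> 'm \<Rightarrow> 'm"

definition left_mult ::
    "('u, 'z) monoid_scheme \<Rightarrow> 'u \<Rightarrow> ('u \<times> 'w \<Rightarrow>\<^sub>0 'k) \<Rightarrow> ('u \<times> 'w \<Rightarrow>\<^sub>0 'k::field)" where
  "left_mult U u p =
     (\<Sum>(u', w)\<in>Poly_Mapping.keys p.
        Poly_Mapping.single (u \<otimes>\<^bsub>U\<^esub> u', w) (Poly_Mapping.lookup p (u', w)))"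

definition ind ::
    "('k::field, 'g::ab_group_add) super_lie \<Rightarrow> 'g set \<Rightarrow> ('k, 'g, 'w::comm_monoid_add) super_rep
      \<Rightarrow> ('k, ('g fword \<Rightarrow>\<^sub>0 'k) set, (('g fword \<Rightarrow>\<^sub>0 'k) set \<times> 'w \<Rightarrow>\<^sub>0 'k) set) super_module" where
  "ind L h W =
     (let U = env_algebra L; N = tensor_null L h W in
      \<lparr>carrier = (\<lambda>p. p +o N) ` {p. Poly_Mapping.keys p \<subseteq> carrier U \<times> underlying (rpart W)},
       mzero = N,
       madd = (\<lambda>C D. C + D),
       mscale = (\<lambda>c C. \<Union>p\<in>C. pm_scale c p +o N),
       mpart = (\<lambda>d. (\<lambda>p. p +o N) `
          module.span pm_scale {tgen u w | u w a b. u \<in> homog U a \<and> w \<in> rpart W b \<and> a + b = d}),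
       mact = (\<lambda>u C. \<Union>p\<in>C. left_mult U u p +o N)\<rparr>)"

section \<open>Structure morphisms\<close>

definition linear_endos :: "('k, 'u, 'm) super_module \<Rightarrow> ('m \<Rightarrow> 'm) set" where
  "linear_endos M =
     {f \<in> carrier M \<rightarrow>\<^sub>E carrier M.
        (\<forall>x\<in>carrier M. \<forall>y\<in>carrier M. f (madd M x y) = madd M (f x) (f y)) \<and>
        (\<forall>c. \<forall>x\<in>carrier M. f (mscale M c x) = mscale M c (f x))}"

definition end_algebra :: "('k, 'u, 'm) super_module \<Rightarrow> ('k, 'm \<Rightarrow> 'm) super_algebra" where
  "end_algebra M =
     \<lparr>carrier = linear_endos M,
      mult = (\<lambda>f g. compose (carrier M) f g),
      one = (\<lambda>x\<in>carrier M. x),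
      zero = (\<lambda>x\<in>carrier M. mzero M),
      add = (\<lambda>f g. \<lambda>x\<in>carrier M. madd M (f x) (g x)),
      smult = (\<lambda>c f. \<lambda>x\<in>carrier M. mscale M c (f x)),
      homog = (\<lambda>d. {f \<in> linear_endos M. \<forall>e. f ` mpart M e \<subseteq> mpart M (d + e)})\<rparr>"

definition structure_morphism :: "('k, 'u, 'm) super_module \<Rightarrow> 'u \<Rightarrow> 'm \<Rightarrow> 'm" where
  "structure_morphism M u = (\<lambda>x\<in>carrier M. mact M u x)"

definition morphism_kernel ::
    "('k::field, 'g::ab_group_add) super_lie
      \<Rightarrow> ('k, ('g fword \<Rightarrow>\<^sub>0 'k) set, 'm) super_module \<Rightarrow> ('g fword \<Rightarrow>\<^sub>0 'k) set set" where
  "morphism_kernel L M = a_kernel (env_algebra L) (end_algebra M) (structure_morphism M)"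

end

theory Submission
  imports Defs
begin

text \<open>
  The module induced from a polarization \<open>h\<close>, with a generator of either parity, is the quotient of the
  enveloping algebra \<open>U\<close> by the left ideal \<open>J h\<close> generated by the elements \<open>t - lam t\<close> with \<open>t\<close>
  in \<open>h\<close>. Its annihilator consists of the \<open>u\<close> with \<open>u U\<close> inside \<open>J h\<close>; it is the largest
  two-sided ideal in \<open>J h\<close>. The claim is that this ideal is the same for all polarizations.

  Call the core of \<open>g\<close> the set of all \<open>x\<close> such that \<open>lam\<close> vanishes on the ideal generated by
  \<open>[g, x]\<close>. Every polarization contains it. If it is all of \<open>g\<close>, there is only one polarization.
  Otherwise nilpotency provides a homogeneous \<open>y\<close> outside the core with \<open>[g, y]\<close> inside it, and over an
  algebraically closed field \<open>y\<close> can be taken isotropic unless \<open>g\<close> is spanned by \<open>y\<close> and the core, in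
  which case there is again only one polarization (\<open>exists_isotropic_near_center\<close>). The orthogonal
  \<open>g'\<close> of such a \<open>y\<close> is an ideal of codimension one.

  A polarization \<open>h\<close> that is not inside \<open>g'\<close> is spanned by \<open>h\<^sub>0 = h \<inter> g'\<close> and an \<open>x\<close> with
  \<open>lam [x, y] = 1\<close>, and then \<open>h\<^sub>0\<close> and \<open>y\<close> span a polarization inside \<open>g'\<close>. Modulo \<open>J h\<^sub>0\<close>
  the elements \<open>x\<close> and \<open>y\<close> form a Weyl pair (even case) or a Clifford pair (odd case), and a two-sided
  ideal inside \<open>J h\<^sub>0 + U x\<close> or inside \<open>J h\<^sub>0 + U y\<close> already lies in \<open>J h\<^sub>0\<close>
  (\<open>even_exchange\<close>, \<open>odd_exchange\<close>). So both polarizations have the same annihilator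
  (\<open>move_polarization\<close>), and both given polarizations may be assumed to lie in \<open>g'\<close>.

  Modulo the relations that make the core act by \<open>lam\<close>, the element \<open>y\<close> commutes, in the super sense,
  with \<open>U(g')\<close>, and \<open>[x, y] = 1\<close>. Commutation with \<open>y\<close> therefore acts as \<open>- d/dx\<close> on expressions
  \<open>\<Sum>x\<^sup>i c\<^sub>i\<close> with coefficients from \<open>U(g')\<close>; in the odd case only \<open>i = 0\<close> and \<open>i = 1\<close> occur,
  and a similar computation applies. It follows that such expressions are unique, that the
  coefficients of an annihilating element annihilate the module induced to \<open>g'\<close>, and induction on the
  dimension concludes (\<open>annihilator_reduction\<close>, \<open>char_ann_independent\<close>).

  The classical argument uses the theorem of Poincare, Birkhoff and Witt to compare \<open>U(g')\<close> with
  \<open>U(g)\<close>. It is avoided by proving the statement not for \<open>U(g)\<close> but for every quotient of the free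
  algebra on \<open>g\<close> by a graded ideal \<open>D\<close> that contains the relations of \<open>U(g)\<close>. In passing to \<open>g'\<close>
  one first enlarges \<open>D\<close> by the relations of the core, and then intersects it with the free algebra on
  \<open>g'\<close>. The uniqueness of the expansions modulo \<open>D\<close> comes from \<open>y\<close> alone.
\<close>

section \<open>Exchange and independence in rings with a Weyl or Clifford pair\<close>

locale unital_subring =
  fixes A :: "'a::ring_1 set"
  assumes one_mem: "1 \<in> A"
    and diff_mem: "a \<in> A \<Longrightarrow> b \<in> A \<Longrightarrow> a - b \<in> A"
    and mult_mem: "a \<in> A \<Longrightarrow> b \<in> A \<Longrightarrow> a * b \<in> A"
begin

lemma zero_mem: "0 \<in> A" using diff_mem[OF one_mem one_mem] by simp
lemma uminus_mem: "a \<in> A \<Longrightarrow> - a \<in> A" using diff_mem[OF zero_mem] by simp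
lemma add_mem: "a \<in> A \<Longrightarrow> b \<in> A \<Longrightarrow> a + b \<in> A" using diff_mem[of a "- b"] uminus_mem by simp
lemma of_nat_mem: "of_nat n \<in> A" by (induction n) (auto intro: zero_mem one_mem add_mem)
lemma power_mem: "a \<in> A \<Longrightarrow> a ^ n \<in> A" by (induction n) (auto intro: one_mem mult_mem)

end

locale left_ideal_of = unital_subring A for A :: "'a::ring_1 set" +
  fixes J :: "'a set"
  assumes subset: "J \<subseteq> A"
    and zero_ideal: "0 \<in> J"
    and add_ideal: "p \<in> J \<Longrightarrow> q \<in> J \<Longrightarrow> p + q \<in> J"
    and lmult_ideal: "a \<in> A \<Longrightarrow> p \<in> J \<Longrightarrow> a * p \<in> J"
begin

lemma uminus_ideal: "p \<in> J \<Longrightarrow> - p \<in> J"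
  using lmult_ideal[OF uminus_mem[OF one_mem]] by fastforce
lemma diff_ideal: "p \<in> J \<Longrightarrow> q \<in> J \<Longrightarrow> p - q \<in> J"
  using add_ideal[of p "- q"] uminus_ideal by simp
lemma diff_trans: "p - q \<in> J \<Longrightarrow> q - r \<in> J \<Longrightarrow> p - r \<in> J"
  using add_ideal[of "p - q" "q - r"] by simp
lemma diff_sym: "p - q \<in> J \<Longrightarrow> q - p \<in> J"
  using uminus_ideal[of "p - q"] by simp
lemma mem_cong: "p - q \<in> J \<Longrightarrow> q \<in> J \<Longrightarrow> p \<in> J"
  using add_ideal[of "p - q" q] by simp
lemma sum_ideal: "(\<And>i. i \<in> I \<Longrightarrow> f i \<in> J) \<Longrightarrow> sum f I \<in> J"
  by (induction I rule: infinite_finite_induct) (auto intro: zero_ideal add_ideal)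

end

locale two_sided_ideal_of = left_ideal_of +
  assumes rmult_ideal: "p \<in> J \<Longrightarrow> a \<in> A \<Longrightarrow> p * a \<in> J"

abbreviation commutator :: "'a::ring \<Rightarrow> 'a \<Rightarrow> 'a" where
  "commutator y u \<equiv> y * u - u * y"

lemma (in unital_subring) commutator_pow_mem:
  "y \<in> A \<Longrightarrow> u \<in> A \<Longrightarrow> (commutator y ^^ n) u \<in> A"
  by (induction n) (auto intro: diff_mem mult_mem)

text \<open>Modulo \<open>J\<close>, right multiplication by \<open>x\<close> and \<open>y\<close> satisfies the Weyl relation, so that commutation
  with \<open>y\<close> is differentiation with respect to \<open>x\<close> up to sign. If \<open>u = j + w x\<close> has its derivative in \<open>J\<close>, then
  repeated differentiation gives \<open>(i + 1) w\<^sub>i = w\<^sub>i\<^sub>+\<^sub>1 x\<close> modulo \<open>J\<close> for the derivatives \<open>w\<^sub>i\<close> of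
  \<open>w\<close>. These vanish for large \<open>i\<close>, hence for all \<open>i\<close>, and \<open>u\<close> lies in \<open>J\<close>. Induction on the
  number of derivatives that bring \<open>u\<close> into \<open>J\<close> covers all of \<open>N\<close>.\<close>

lemma (in left_ideal_of) even_exchange:
  assumes x: "x \<in> A" "\<And>p. p \<in> J \<Longrightarrow> p * x \<in> J"
    and y: "y \<in> A" "\<And>p. p \<in> J \<Longrightarrow> p * y \<in> J"
    and weyl: "x * y - y * x - 1 \<in> J"
    and inverse_nat: "\<And>n. \<exists>c\<in>A. c * of_nat (Suc n) = 1"
    and nilpotent: "\<And>w. w \<in> A \<Longrightarrow> \<exists>m. (commutator y ^^ m) w \<in> J"
    and N: "\<And>u. u \<in> N \<Longrightarrow> \<exists>j\<in>J. \<exists>w\<in>A. u = j + w * x"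
    and N_stable: "\<And>u. u \<in> N \<Longrightarrow> commutator y u \<in> N"
  shows "N \<subseteq> J"
proof -
  have com: "commutator y p \<in> J" if "p \<in> J" for p
    using lmult_ideal[OF y(1) that] y(2)[OF that] diff_ideal by blast
  have key: "u \<in> J" if u: "u = j + w * x" "j \<in> J" "w \<in> A" "commutator y u \<in> J" for u j w
  proof -
    let ?a = "\<lambda>i. (commutator y ^^ i) w"
    have a: "?a i \<in> A" for i using commutator_pow_mem[OF y(1) u(3)] .
    have leibniz: "commutator y (v * x) - (commutator y v * x - v) \<in> J" if "v \<in> A" for v
    proof -
      have "commutator y (v * x) - (commutator y v * x - v) = - (v * (x * y - y * x - 1))"
        by (simp add: algebra_simps)
      then show ?thesis using lmult_ideal[OF that weyl] uminus_ideal by auto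
    qed
    \<comment> \<open>the commutator of \<open>y\<close> and \<open>w x\<close> is \<open>w' x - w\<close>, and it is in \<open>J\<close> as those with \<open>u\<close> and \<open>j\<close> are\<close>
    have step: "?a (Suc i) * x - of_nat (Suc i) * ?a i \<in> J" for i
    proof (induction i)
      case 0
      have "commutator y (w * x) = commutator y u - commutator y j"
        using u(1) by (simp add: algebra_simps)
      then have "commutator y (w * x) \<in> J" using com u(2,4) diff_ideal by auto
      then have "commutator y w * x - w \<in> J"
        using leibniz[OF u(3)] diff_ideal[of "commutator y (w * x)"] by fastforce
      then show ?case by simp
    next
      case (Suc i)
      have "commutator y (?a (Suc i) * x - of_nat (Suc i) * ?a i) \<in> J"
        using com Suc by blast
      moreover have "commutator y (of_nat (Suc i) * ?a i) = of_nat (Suc i) * ?a (Suc i)"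
      proof -
        have "y * (of_nat (Suc i) * v) = of_nat (Suc i) * (y * v)" for v
          by (simp only: mult.assoc[symmetric] mult_of_nat_commute[of "Suc i" y])
        then show ?thesis by (simp only: funpow.simps o_apply right_diff_distrib mult.assoc)
      qed
      moreover have "commutator y p - q' \<in> J"
        if "commutator y (p - q) \<in> J" "commutator y q = q'" for p q q'
      proof -
        have "commutator y (p - q) = commutator y p - commutator y q" by (simp add: algebra_simps)
        then show ?thesis using that by simp
      qed
      ultimately have "commutator y (?a (Suc i) * x) - of_nat (Suc i) * ?a (Suc i) \<in> J"
        by blast
      moreover have "r - (s + q) \<in> J" if "p - s \<in> J" "p - (r - q) \<in> J" for p q r s
        using diff_ideal[OF that] by (simp add: algebra_simps)
      ultimately have "commutator y (?a (Suc i)) * x - (of_nat (Suc i) * ?a (Suc i) + ?a (Suc i)) \<in> J"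
        using leibniz[OF a[of "Suc i"]] by blast
      moreover have "of_nat (Suc i) * ?a (Suc i) + ?a (Suc i) = of_nat (Suc (Suc i)) * ?a (Suc i)"
        by (simp only: of_nat_Suc[of "Suc i"] distrib_right mult_1_left add.commute)
      ultimately show ?case by simp
    qed
    have down: "?a i \<in> J" if "?a (Suc i) \<in> J" for i
    proof -
      have "?a (Suc i) * x \<in> J" using x that by blast
      then have "of_nat (Suc i) * ?a i \<in> J"
        using diff_ideal[OF _ step[of i], of "?a (Suc i) * x"] by simp
      moreover obtain c where c: "c \<in> A" "c * of_nat (Suc i) = 1" using inverse_nat by blast
      ultimately have "c * (of_nat (Suc i) * ?a i) \<in> J" using lmult_ideal by blast
      then show ?thesis by (simp only: mult.assoc[symmetric] c(2) mult_1_left)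
    qed
    have "w \<in> J" if "?a m \<in> J" for m
      using that
    proof (induction m)
      case (Suc m)
      then show ?case using down[of m] by blast
    qed simp
    then have "w \<in> J" using nilpotent[OF u(3)] by blast
    then show ?thesis using u x add_ideal by auto
  qed
  have "u \<in> J" if "u \<in> N" "(commutator y ^^ m) u \<in> J" for u m
    using that
  proof (induction m arbitrary: u)
    case (Suc m)
    have com_u: "commutator y u \<in> J"
      using Suc.IH[OF N_stable[OF Suc.prems(1)]] Suc.prems(2)
      unfolding funpow_Suc_right o_apply by blast
    obtain j w where "u = j + w * x" "j \<in> J" "w \<in> A" using N[OF Suc.prems(1)] by blast
    then show ?case using com_u by (rule key)
  qed simp
  moreover have "u \<in> A" if "u \<in> N" for u
    using N[OF that] subset x add_mem mult_mem by blast
  ultimately show ?thesis using nilpotent by blast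
qed

text \<open>For a Clifford pair one step suffices. As \<open>x y = 1 - y x\<close>, multiplying \<open>j + w x\<close> by \<open>y\<close> leaves \<open>w\<close>
  up to terms in \<open>J + A x\<close>, so \<open>w\<close> itself is in \<open>J + A x\<close>, and \<open>w x\<close> is in \<open>J\<close> because
  \<open>x\<^sup>2\<close> is.\<close>

lemma (in left_ideal_of) odd_exchange:
  assumes x: "x \<in> A" "\<And>p. p \<in> J \<Longrightarrow> p * x \<in> J"
    and y: "y \<in> A" "\<And>p. p \<in> J \<Longrightarrow> p * y \<in> J"
    and clifford: "x * y + y * x - 1 \<in> J" and square: "x * x \<in> J"
    and N: "\<And>u. u \<in> N \<Longrightarrow> \<exists>j\<in>J. \<exists>w\<in>A. u = j + w * x"
    and N_stable: "\<And>u. u \<in> N \<Longrightarrow> u * y \<in> N"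
  shows "N \<subseteq> J"
proof
  fix u assume "u \<in> N"
  obtain j w where u: "u = j + w * x" "j \<in> J" "w \<in> A" using N[OF \<open>u \<in> N\<close>] by blast
  obtain j' w' where uy: "u * y = j' + w' * x" "j' \<in> J" "w' \<in> A"
    using N[OF N_stable[OF \<open>u \<in> N\<close>]] by blast
  define q where "q = j' - j * y - w * (x * y + y * x - 1)"
  have "q \<in> J" unfolding q_def using diff_ideal[OF diff_ideal[OF uy(2) y(2)[OF u(2)]] lmult_ideal[OF u(3) clifford]] .
  have "w = q + (w' + w * y) * x + (u * y - (j' + w' * x))"
    unfolding u(1) q_def by (simp add: algebra_simps)
  then have "w = q + (w' + w * y) * x" unfolding uy(1) by (simp only: diff_self add_0_right)
  from arg_cong[OF this, of "\<lambda>t. t * x"]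
  have "w * x = q * x + (w' + w * y) * (x * x)" by (simp only: distrib_right mult.assoc)
  moreover have "q * x + (w' + w * y) * (x * x) \<in> J"
    by (rule add_ideal[OF x(2)[OF \<open>q \<in> J\<close>]
          lmult_ideal[OF add_mem[OF uy(3) mult_mem[OF u(3) y(1)]] square]])
  ultimately have "w * x \<in> J" by (simp only:)
  then show "u \<in> J" unfolding u(1) by (rule add_ideal[OF u(2)])
qed

text \<open>By the Leibniz rule, the elements that some power of a derivation sends into an ideal form a subalgebra.\<close>

lemma (in two_sided_ideal_of) commutator_nilpotent_mult:
  assumes "y \<in> A" "u \<in> A" "v \<in> A" "(commutator y ^^ a) u \<in> J" "(commutator y ^^ b) v \<in> J"
  shows "(commutator y ^^ (a + b)) (u * v) \<in> J"
  using assms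
proof (induction "a + b" arbitrary: a b u v)
  case 0
  then show ?case using rmult_ideal by auto
next
  case (Suc n)
  have com: "commutator y p \<in> J" if "p \<in> J" for p
    using that Suc.prems by (intro diff_ideal lmult_ideal rmult_ideal)
  have pow: "(commutator y ^^ m) p \<in> J" if "p \<in> J" for p m
    using that by (induction m) (auto intro: com)
  have add: "(commutator y ^^ m) (p + q) = (commutator y ^^ m) p + (commutator y ^^ m) q" for m p q
    by (induction m) (auto simp: algebra_simps)
  consider "a = 0" | "b = 0" | a' b' where "a = Suc a'" "b = Suc b'"
    using not0_implies_Suc by blast
  then show ?case
  proof cases
    case 1
    then show ?thesis using Suc.prems rmult_ideal pow by auto
  next
    case 2
    then show ?thesis using Suc.prems lmult_ideal pow by auto
  next
    case 3
    have c: "commutator y u \<in> A" "commutator y v \<in> A"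
      using Suc.prems by (auto intro: diff_mem mult_mem)
    have "(commutator y ^^ (a' + b)) (commutator y u * v) \<in> J"
      using Suc.hyps(1)[of a' b "commutator y u" v] Suc.hyps(2) Suc.prems c
      unfolding 3 funpow_Suc_right o_apply by simp
    moreover have "(commutator y ^^ (a + b')) (u * commutator y v) \<in> J"
      using Suc.hyps(1)[of a b' u "commutator y v"] Suc.hyps(2) Suc.prems c
      unfolding 3 funpow_Suc_right o_apply by simp
    moreover have leibniz: "commutator y (u * v) = commutator y u * v + u * commutator y v"
      by (simp add: algebra_simps)
    have sums: "a + b = Suc (a' + b)" "a + b' = a' + b" using 3 by simp_all
    have "(commutator y ^^ (a + b)) (u * v)
        = (commutator y ^^ (a' + b)) (commutator y u * v) + (commutator y ^^ (a + b')) (u * commutator y v)"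
      unfolding sums funpow_Suc_right o_apply leibniz add ..
    ultimately show ?thesis using add_ideal by simp
  qed
qed

text \<open>Commutation with \<open>y\<close> acts as \<open>- d/dx\<close> because it kills the coefficients, so it lowers the number of
  terms, and multiplies the coefficients only by invertible integers.\<close>

lemma (in two_sided_ideal_of) even_independent:
  assumes x: "x \<in> A" and y: "y \<in> A" and A': "A' \<subseteq> A"
    and weyl: "x * y - y * x - 1 \<in> J"
    and inverse_nat: "\<And>n. \<exists>c\<in>A. c * of_nat (Suc n) = 1"
    and mult_nat: "\<And>n c. c \<in> A' \<Longrightarrow> of_nat n * c \<in> A'"
    and central: "\<And>c. c \<in> A' \<Longrightarrow> commutator y c \<in> J"
  shows "(\<And>i. c i \<in> A') \<Longrightarrow> (\<Sum>i<m. x ^ i * c i) \<in> J \<Longrightarrow> i < m \<Longrightarrow> c i \<in> J"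
proof (induction m arbitrary: c i)
  case (Suc m)
  have cA: "c i \<in> A" for i using Suc.prems A' by blast
  have com_pow: "commutator y (x ^ n) + of_nat n * x ^ (n - 1) \<in> J" for n
  proof (induction n)
    case 0 then show ?case using zero_ideal by simp
  next
    case (Suc n)
    have "commutator y (x ^ Suc n) + of_nat (Suc n) * x ^ (Suc n - 1)
        = x * (commutator y (x ^ n) + of_nat n * x ^ (n - 1))
          - (x * y - y * x - 1) * x ^ n + (of_nat n * x ^ n - x * (of_nat n * x ^ (n - 1)))"
      by (simp add: algebra_simps)
    moreover have "of_nat n * x ^ n = x * (of_nat n * x ^ (n - 1))"
    proof (cases n)
      case (Suc k)
      have "of_nat n * (x * x ^ k) = x * (of_nat n * x ^ k)"
        by (simp only: mult.assoc[symmetric] mult_of_nat_commute[of n x])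
      then show ?thesis using Suc by simp
    qed simp
    ultimately have eq: "commutator y (x ^ Suc n) + of_nat (Suc n) * x ^ (Suc n - 1)
        = x * (commutator y (x ^ n) + of_nat n * x ^ (n - 1)) - (x * y - y * x - 1) * x ^ n"
      by simp
    show ?case unfolding eq
      by (rule diff_ideal[OF lmult_ideal[OF x Suc] rmult_ideal[OF weyl power_mem[OF x]]])
  qed
  have summand: "commutator y (x ^ n * c n) + of_nat n * x ^ (n - 1) * c n \<in> J" for n
  proof -
    have "commutator y (x ^ n * c n) + of_nat n * x ^ (n - 1) * c n
      = (commutator y (x ^ n) + of_nat n * x ^ (n - 1)) * c n + x ^ n * commutator y (c n)"
      by (simp add: algebra_simps)
    then show ?thesis
      using add_ideal[OF rmult_ideal[OF com_pow cA] lmult_ideal[OF power_mem[OF x] central[OF Suc.prems(1)]]]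
      by simp
  qed
  let ?c' = "\<lambda>n. of_nat (Suc n) * c (Suc n)"
  have "commutator y (\<Sum>i<Suc m. x ^ i * c i) \<in> J"
    using Suc.prems y by (intro diff_ideal lmult_ideal rmult_ideal)
  then have "(\<Sum>i<Suc m. commutator y (x ^ i * c i)) \<in> J"
    by (simp only: sum_distrib_left sum_distrib_right sum_subtractf)
  moreover have "(\<Sum>i<Suc m. commutator y (x ^ i * c i) + of_nat i * x ^ (i - 1) * c i) \<in> J"
    using summand by (intro sum_ideal)
  ultimately have "(\<Sum>i<Suc m. of_nat i * x ^ (i - 1) * c i) \<in> J"
    unfolding sum.distrib using diff_ideal by fastforce
  also have "(\<Sum>i<Suc m. of_nat i * x ^ (i - 1) * c i) = (\<Sum>i<m. x ^ i * ?c' i)"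
  proof -
    have "of_nat (Suc i) * x ^ i * c (Suc i) = x ^ i * ?c' i" for i
      by (simp only: mult.assoc[symmetric] mult_of_nat_commute[of "Suc i" "x ^ i"])
    then show ?thesis unfolding sum.lessThan_Suc_shift by (simp del: of_nat_Suc)
  qed
  finally have c': "?c' n \<in> J" if "n < m" for n
    using Suc.IH[of ?c'] mult_nat Suc.prems(1) that by blast
  have c_Suc: "c (Suc n) \<in> J" if "n < m" for n
  proof -
    obtain d where "d \<in> A" "d * of_nat (Suc n) = 1" using inverse_nat by blast
    then show ?thesis using lmult_ideal[OF _ c'[OF that], of d] by (simp add: mult.assoc[symmetric])
  qed
  have "c 0 + (\<Sum>i<m. x ^ Suc i * c (Suc i)) \<in> J"
    using Suc.prems(2) unfolding sum.lessThan_Suc_shift by simp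
  moreover have "(\<Sum>i<m. x ^ Suc i * c (Suc i)) \<in> J"
    using c_Suc x by (intro sum_ideal lmult_ideal power_mem) auto
  ultimately have "c 0 \<in> J" using diff_ideal by fastforce
  then show ?case using c_Suc Suc.prems(3) by (cases i) auto
qed simp

text \<open>Since \<open>y x y = y\<close> modulo the ideal, multiplying the relation by \<open>y\<close> on both sides isolates \<open>c\<^sub>1 y\<close>; multiplying on
  one side then gives \<open>c\<^sub>0 y\<close> and finally \<open>c\<^sub>1\<close>. Here \<open>y\<close> commutes with the coefficients only up
  to the twist \<open>\<sigma>\<close>, and the third condition on \<open>\<sigma>\<close> is where gradedness of the ideal enters: it fails in
  the quotient of the Clifford algebra on three generators in which the product of an orthogonal
  basis is a scalar, and so does the conclusion.\<close>

lemma (in two_sided_ideal_of) odd_independent: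
  assumes x: "x \<in> A" and y: "y \<in> A" and A': "A' \<subseteq> A"
    and clifford: "x * y + y * x - 1 \<in> J" and square: "y * y \<in> J"
    and twist: "\<And>c. c \<in> A' \<Longrightarrow> \<sigma> c \<in> A'" "\<And>c. c \<in> A' \<Longrightarrow> y * c - \<sigma> c * y \<in> J"
      "\<And>c. c \<in> A' \<Longrightarrow> c * y \<in> J \<Longrightarrow> \<sigma> c * y \<in> J"
    and c: "c\<^sub>0 \<in> A'" "c\<^sub>1 \<in> A'" "c\<^sub>0 + x * c\<^sub>1 \<in> J"
  shows "c\<^sub>0 \<in> J" "c\<^sub>1 \<in> J"
proof -
  have s: "\<sigma> c\<^sub>0 \<in> A" "\<sigma> c\<^sub>1 \<in> A" "c\<^sub>0 \<in> A" "c\<^sub>1 \<in> A" using twist(1) A' c by auto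
  note t = twist(2)[OF c(1)] twist(2)[OF c(2)]
  have "c\<^sub>1 * y = y * (c\<^sub>0 + x * c\<^sub>1) * y - (y * c\<^sub>0 - \<sigma> c\<^sub>0 * y) * y - \<sigma> c\<^sub>0 * (y * y)
      - (x * y + y * x - 1) * (c\<^sub>1 * y) + x * (y * c\<^sub>1 - \<sigma> c\<^sub>1 * y) * y + x * \<sigma> c\<^sub>1 * (y * y)"
    by (simp add: algebra_simps)
  also have "\<dots> \<in> J"
    by (intro add_ideal diff_ideal rmult_ideal[OF lmult_ideal[OF y c(3)] y] rmult_ideal[OF t(1) y]
        lmult_ideal[OF s(1) square] rmult_ideal[OF clifford mult_mem[OF s(4) y]]
        rmult_ideal[OF lmult_ideal[OF x t(2)] y] lmult_ideal[OF mult_mem[OF x s(2)] square])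
  finally have c1y: "c\<^sub>1 * y \<in> J" .
  have "c\<^sub>0 * y = (c\<^sub>0 + x * c\<^sub>1) * y - x * (c\<^sub>1 * y)" by (simp add: algebra_simps)
  also have "\<dots> \<in> J" by (intro diff_ideal lmult_ideal[OF x c1y] rmult_ideal[OF c(3) y])
  finally have "\<sigma> c\<^sub>0 * y \<in> J" using twist(3) c by blast
  moreover have "\<sigma> c\<^sub>1 * y \<in> J" using twist(3) c c1y by blast
  moreover have "c\<^sub>1 = y * (c\<^sub>0 + x * c\<^sub>1) - (y * c\<^sub>0 - \<sigma> c\<^sub>0 * y) - \<sigma> c\<^sub>0 * y
      - (x * y + y * x - 1) * c\<^sub>1 + x * (y * c\<^sub>1 - \<sigma> c\<^sub>1 * y) + x * (\<sigma> c\<^sub>1 * y)"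
    by (simp add: algebra_simps)
  moreover have "y * (c\<^sub>0 + x * c\<^sub>1) - (y * c\<^sub>0 - \<sigma> c\<^sub>0 * y) - \<sigma> c\<^sub>0 * y
      - (x * y + y * x - 1) * c\<^sub>1 + x * (y * c\<^sub>1 - \<sigma> c\<^sub>1 * y) + x * (\<sigma> c\<^sub>1 * y) \<in> J"
    by (intro add_ideal diff_ideal lmult_ideal[OF y c(3)] t(1) calculation(1)
        rmult_ideal[OF clifford s(4)] lmult_ideal[OF x t(2)] lmult_ideal[OF x calculation(2)])
  ultimately show c1: "c\<^sub>1 \<in> J" by simp
  have "c\<^sub>0 = (c\<^sub>0 + x * c\<^sub>1) - x * c\<^sub>1" by simp
  also have "\<dots> \<in> J" by (intro diff_ideal lmult_ideal[OF x c1] c(3))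
  finally show "c\<^sub>0 \<in> J" .
qed

section \<open>The free algebra on words\<close>

lemma poly_mapping_sum_single: "p = (\<Sum>k\<in>Poly_Mapping.keys p. Poly_Mapping.single k (Poly_Mapping.lookup p k))"
  by (rule poly_mapping_eqI)
    (simp add: lookup_sum lookup_single when_def in_keys_iff sum.delta)

lemma poly_mapping_single_induct [case_names single add]:
  assumes "\<And>k c. P (Poly_Mapping.single k c)" and "\<And>p q. P p \<Longrightarrow> P q \<Longrightarrow> P (p + q)"
  shows "P (p :: 'a \<Rightarrow>\<^sub>0 'b::comm_monoid_add)"
proof -
  have "P 0" using assms(1)[of undefined 0] by simp
  then have "P (\<Sum>k\<in>K. Poly_Mapping.single k (Poly_Mapping.lookup p k))" for K
    by (induction K rule: infinite_finite_induct) (auto intro: assms)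
  then show ?thesis using poly_mapping_sum_single[of p] by metis
qed

definition linear_extension :: "('a \<Rightarrow> 'b \<Rightarrow> 'c::comm_monoid_add) \<Rightarrow> ('a \<Rightarrow>\<^sub>0 'b::zero) \<Rightarrow> 'c" where
  "linear_extension f p = (\<Sum>k\<in>Poly_Mapping.keys p. f k (Poly_Mapping.lookup p k))"

lemma linear_extension_single:
  "f k 0 = 0 \<Longrightarrow> linear_extension f (Poly_Mapping.single k c) = f k c"
  by (cases "c = 0") (auto simp: linear_extension_def)

lemma linear_extension_add:
  assumes "\<And>k. f k 0 = 0" "\<And>k a b. f k (a + b) = f k a + f k b"
  shows "linear_extension f (p + q) = linear_extension f p + linear_extension f (q :: 'a \<Rightarrow>\<^sub>0 'b::comm_monoid_add)"
  unfolding linear_extension_def using assms by (intro setsum_keys_plus_distrib) auto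

lemma fconst_central: "Poly_Mapping.single 0 c * p = p * Poly_Mapping.single 0 (c :: 'k::comm_ring_1)"
  by (induction p rule: poly_mapping_single_induct)
    (simp_all add: mult_single algebra_simps)

lemma fconst_mult: "Poly_Mapping.single 0 (c * d) = Poly_Mapping.single 0 c * Poly_Mapping.single 0 d"
  by (simp add: mult_single)

definition words_on :: "'a set \<Rightarrow> ('a fword \<Rightarrow>\<^sub>0 'k::ring_1) set" where
  "words_on S = {p. \<forall>w\<in>Poly_Mapping.keys p. set (letters w) \<subseteq> S}"

lemma words_on_unital_subring: "unital_subring (words_on S :: ('a fword \<Rightarrow>\<^sub>0 'k::ring_1) set)"
proof
  show "1 \<in> words_on S" by (simp add: words_on_def zero_fword_def)
next
  fix a b :: "'a fword \<Rightarrow>\<^sub>0 'k"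
  assume a: "a \<in> words_on S" "b \<in> words_on S"
  have "Poly_Mapping.keys (a - b) \<subseteq> Poly_Mapping.keys a \<union> Poly_Mapping.keys b"
    by (auto simp: in_keys_iff lookup_minus)
  then show "a - b \<in> words_on S" using a by (auto simp: words_on_def)
  have "set (letters w) \<subseteq> S" if "w \<in> Poly_Mapping.keys (a * b)" for w
  proof -
    from that keys_mult[of a b] obtain u v
      where "u \<in> Poly_Mapping.keys a" "v \<in> Poly_Mapping.keys b" "w = u + v" by blast
    then show ?thesis using a by (auto simp: words_on_def plus_fword_def)
  qed
  then show "a * b \<in> words_on S" by (simp add: words_on_def)
qed

lemma fgen_in_words: "x \<in> S \<Longrightarrow> fgen x \<in> words_on S"
  by (simp add: words_on_def)

lemma fconst_in_words: "fconst c \<in> words_on S"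
  by (simp add: words_on_def zero_fword_def)

lemma words_on_mono: "S \<subseteq> T \<Longrightarrow> words_on S \<subseteq> words_on T"
  by (auto simp: words_on_def)

lemma words_on_induct [consumes 1, case_names const add gen]:
  assumes "p \<in> words_on S"
    and const: "\<And>c. P (fconst c)"
    and add: "\<And>p q. p \<in> words_on S \<Longrightarrow> q \<in> words_on S \<Longrightarrow> P p \<Longrightarrow> P q \<Longrightarrow> P (p + q)"
    and gen: "\<And>x p. x \<in> S \<Longrightarrow> p \<in> words_on S \<Longrightarrow> P p \<Longrightarrow> P (fgen x * p)"
  shows "P (p :: 'a fword \<Rightarrow>\<^sub>0 'k::ring_1)"
proof -
  interpret unital_subring "words_on S :: ('a fword \<Rightarrow>\<^sub>0 'k) set"
    by (rule words_on_unital_subring)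
  have word: "P (Poly_Mapping.single (FWord l) c) \<and> Poly_Mapping.single (FWord l) c \<in> words_on S"
    if "set l \<subseteq> S" for l c
    using that
  proof (induction l)
    case Nil
    then show ?case using const[of c] fconst_in_words[of c] by (simp add: zero_fword_def)
  next
    case (Cons x l)
    have "Poly_Mapping.single (FWord (x # l)) c = fgen x * Poly_Mapping.single (FWord l) c"
      by (simp add: mult_single plus_fword_def)
    then show ?case using Cons gen[of x] unital_subring.mult_mem[OF words_on_unital_subring fgen_in_words]
      by auto
  qed
  have "P (\<Sum>k\<in>K. Poly_Mapping.single k (Poly_Mapping.lookup p k)) \<and>
      (\<Sum>k\<in>K. Poly_Mapping.single k (Poly_Mapping.lookup p k)) \<in> words_on S"
    if "K \<subseteq> Poly_Mapping.keys p" for K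
    using that
  proof (induction K rule: infinite_finite_induct)
    case (insert k K)
    have "set (letters k) \<subseteq> S" using insert assms(1) by (auto simp: words_on_def)
    from word[OF this] show ?case
      using insert add add_mem by auto
  qed (use const[of 0] fconst_in_words[of 0] in auto)
  from this[of "Poly_Mapping.keys p"] show ?thesis
    using poly_mapping_sum_single[of p] by simp
qed

lemma words_on_inverse_nat:
  "\<exists>c\<in>words_on S. c * of_nat (Suc n) = (1 :: 'a fword \<Rightarrow>\<^sub>0 'k::field_char_0)"
proof -
  have "fconst (1 / of_nat (Suc n)) * of_nat (Suc n) = (1 :: 'a fword \<Rightarrow>\<^sub>0 'k)"
    by (simp only: single_of_nat[symmetric] mult_single)
      (simp only: add_0_left nonzero_divide_eq_eq of_nat_eq_0_iff nat.distinct times_divide_eq_left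
        mult_1_left divide_self of_nat_neq_0 not_False_eq_True single_one)
  then show ?thesis using fconst_in_words by blast
qed

definition map_letters :: "('a \<Rightarrow> 'b) \<Rightarrow> ('a fword \<Rightarrow>\<^sub>0 'k::ring_1) \<Rightarrow> ('b fword \<Rightarrow>\<^sub>0 'k)" where
  "map_letters s = linear_extension (\<lambda>w. Poly_Mapping.single (FWord (map s (letters w))))"

lemma map_letters_single:
  "map_letters s (Poly_Mapping.single w c) = Poly_Mapping.single (FWord (map s (letters w))) c"
  by (simp add: map_letters_def linear_extension_single)

lemma map_letters_add: "map_letters s (p + q) = map_letters s p + map_letters s q"
  unfolding map_letters_def by (rule linear_extension_add) (auto simp: single_add)

lemma map_letters_mult: "map_letters s (p * q) = map_letters s p * map_letters s q"
proof (induction p rule: poly_mapping_single_induct)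
  case (single v a)
  show ?case
    by (induction q rule: poly_mapping_single_induct)
      (simp_all add: mult_single map_letters_single map_letters_add plus_fword_def distrib_left)
qed (simp add: distrib_right map_letters_add)

lemma map_letters_fgen: "map_letters s (fgen x) = fgen (s x)"
  by (simp add: map_letters_single)

lemma map_letters_fconst: "map_letters s (fconst c) = fconst c"
  by (simp add: map_letters_single zero_fword_def)

lemma map_letters_diff: "map_letters s (p - q) = map_letters s p - map_letters s q"
  using map_letters_add[of s "p - q" q] by (simp add: algebra_simps)

lemma map_letters_in_words:
  assumes "p \<in> words_on S" "\<And>x. x \<in> S \<Longrightarrow> s x \<in> T"
  shows "map_letters s p \<in> words_on T"
  using assms(1)
  by (induction rule: words_on_induct)
    (auto simp: map_letters_fconst map_letters_add map_letters_mult map_letters_fgen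
      intro: fconst_in_words fgen_in_words assms(2)
        unital_subring.add_mem[OF words_on_unital_subring]
        unital_subring.mult_mem[OF words_on_unital_subring])

text \<open>The set \<open>D\<close> is kept as a separate argument because left ideals of \<open>A/D\<close> are described by their
  preimages in \<open>A\<close>. With the powers of an element in place of \<open>A\<close>, the same closure is the set of
  expansions in powers of that element.\<close>

inductive_set left_ideal_gen :: "'a::ring_1 set \<Rightarrow> 'a set \<Rightarrow> 'a set \<Rightarrow> 'a set"
  for A D X where
  base: "d \<in> D \<Longrightarrow> d \<in> left_ideal_gen A D X"
| gen: "a \<in> A \<Longrightarrow> x \<in> X \<Longrightarrow> a * x \<in> left_ideal_gen A D X"
| add: "p \<in> left_ideal_gen A D X \<Longrightarrow> q \<in> left_ideal_gen A D X \<Longrightarrow> p + q \<in> left_ideal_gen A D X"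

lemma left_ideal_gen_left_ideal:
  assumes "left_ideal_of A D" "X \<subseteq> A"
  shows "left_ideal_of A (left_ideal_gen A D X)"
proof -
  interpret left_ideal_of A D by (rule assms(1))
  show ?thesis
  proof
    show "left_ideal_gen A D X \<subseteq> A"
    proof
      fix p assume "p \<in> left_ideal_gen A D X"
      then show "p \<in> A"
        by induction (use subset assms(2) in \<open>auto intro: mult_mem add_mem\<close>)
    qed
    show "a * p \<in> left_ideal_gen A D X" if "a \<in> A" "p \<in> left_ideal_gen A D X" for a p
      using that(2)
    proof induction
      case (gen b x)
      then show ?case
        using left_ideal_gen.gen[of "a * b"] mult_mem[OF that(1)] by (simp add: mult.assoc)
    qed (auto simp: distrib_left intro: left_ideal_gen.base left_ideal_gen.add lmult_ideal that(1))
  qed (auto intro: left_ideal_gen.base left_ideal_gen.add zero_ideal)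
qed

lemma left_ideal_gen_least:
  assumes "left_ideal_of A J" "D \<subseteq> J" "X \<subseteq> J"
  shows "left_ideal_gen A D X \<subseteq> J"
proof
  fix p assume "p \<in> left_ideal_gen A D X"
  then show "p \<in> J"
    by induction (use assms left_ideal_of.add_ideal left_ideal_of.lmult_ideal in blast)+
qed

section \<open>Graded subspaces and even functionals\<close>

context super_lie_algebra
begin

sublocale vs: vector_space "lscale L" by (rule vector_space)

lemma bit_exhaust: "(d::bit) = 0 \<or> d = 1" by (cases d) auto

lemma zero_in_part: "0 \<in> lpart L d" using part_subspace vs.subspace_0 by blast

lemma part_in_lspace: "x \<in> lpart L d \<Longrightarrow> x \<in> lspace L"
  using bit_exhaust[of d] zero_in_part[of 0] zero_in_part[of 1]
  unfolding underlying_def by (force intro: exI[of _ 0])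

lemma lspaceE:
  assumes "x \<in> lspace L"
  obtains a b where "a \<in> lpart L 0" "b \<in> lpart L 1" "x = a + b"
  using assms unfolding underlying_def by blast

lemma lspace_subspace: "vs.subspace (lspace L)"
proof (rule vs.subspaceI)
  show "0 \<in> lspace L" using zero_in_part part_in_lspace by blast
  show "x + y \<in> lspace L" if xy: "x \<in> lspace L" "y \<in> lspace L" for x y
  proof -
    obtain a b where 1: "a \<in> lpart L 0" "b \<in> lpart L 1" "x = a + b" by (rule lspaceE[OF xy(1)])
    obtain a' b' where 2: "a' \<in> lpart L 0" "b' \<in> lpart L 1" "y = a' + b'" by (rule lspaceE[OF xy(2)])
    have "x + y = (a + a') + (b + b')" using 1 2 by (simp add: algebra_simps)
    then show ?thesis using 1 2 vs.subspace_add[OF part_subspace] unfolding underlying_def by blast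
  qed
  show "lscale L c x \<in> lspace L" if xy: "x \<in> lspace L" for c x
  proof -
    obtain a b where 1: "a \<in> lpart L 0" "b \<in> lpart L 1" "x = a + b" by (rule lspaceE[OF xy])
    then have "lscale L c x = lscale L c a + lscale L c b" by (simp add: vs.scale_right_distrib)
    then show ?thesis using 1 vs.subspace_scale[OF part_subspace] unfolding underlying_def by blast
  qed
qed

lemma parts_unique:
  assumes "a \<in> lpart L 0" "b \<in> lpart L 1" "a' \<in> lpart L 0" "b' \<in> lpart L 1" "a + b = a' + b'"
  shows "a = a'" "b = b'"
proof -
  have "a - a' = b' - b" using assms(5) by (simp add: algebra_simps)
  moreover have "a - a' \<in> lpart L 0" "b' - b \<in> lpart L 1"
    using assms vs.subspace_diff[OF part_subspace] by auto
  ultimately have "a - a' \<in> lpart L 0 \<inter> lpart L 1" by simp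
  then show "a = a'" using parts_disjoint by simp
  then show "b = b'" using assms(5) by simp
qed

lemma bracket_mem: "x \<in> lspace L \<Longrightarrow> y \<in> lspace L \<Longrightarrow> lbracket L x y \<in> lspace L"
proof -
  assume *: "x \<in> lspace L" "y \<in> lspace L"
  obtain a b where 1: "a \<in> lpart L 0" "b \<in> lpart L 1" "x = a + b" by (rule lspaceE[OF *(1)])
  obtain a' b' where 2: "a' \<in> lpart L 0" "b' \<in> lpart L 1" "y = a' + b'" by (rule lspaceE[OF *(2)])
  note p = part_in_lspace[OF bracket_degree[OF 1(1) 2(1)]] part_in_lspace[OF bracket_degree[OF 1(1) 2(2)]]
    part_in_lspace[OF bracket_degree[OF 1(2) 2(1)]] part_in_lspace[OF bracket_degree[OF 1(2) 2(2)]]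
  have "lbracket L x y = (lbracket L a a' + lbracket L a b') + (lbracket L b a' + lbracket L b b')"
    using 1 2 * by (simp add: bracket_add_left bracket_add_right part_in_lspace)
  then show ?thesis using p vs.subspace_add[OF lspace_subspace] by simp
qed

lemma bracket_zero_left: "y \<in> lspace L \<Longrightarrow> lbracket L 0 y = 0"
  using bracket_scale_left[of 0 y 0] vs.subspace_0[OF lspace_subspace] by simp

lemma gradedD:
  assumes "graded_subspace L S"
  shows "vs.subspace S" "x \<in> S \<Longrightarrow> x \<in> lspace L"
    "x \<in> S \<Longrightarrow> \<exists>a\<in>S \<inter> lpart L 0. \<exists>b\<in>S \<inter> lpart L 1. x = a + b"
proof -
  have S: "vs.subspace S" "S = underlying (\<lambda>d. S \<inter> lpart L d)"
    using assms unfolding graded_subspace_def by auto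
  show "vs.subspace S" by (rule S)
  show dec: "\<exists>a\<in>S \<inter> lpart L 0. \<exists>b\<in>S \<inter> lpart L 1. x = a + b" if "x \<in> S" for x
    using that S(2) unfolding underlying_def by blast
  show "x \<in> lspace L" if "x \<in> S"
    using dec[OF that] unfolding underlying_def by blast
qed

lemma gradedI:
  assumes "vs.subspace S" "\<And>x. x \<in> S \<Longrightarrow> \<exists>a\<in>S \<inter> lpart L 0. \<exists>b\<in>S \<inter> lpart L 1. x = a + b"
  shows "graded_subspace L S"
proof -
  have "S = underlying (\<lambda>d. S \<inter> lpart L d)"
  proof
    show "S \<subseteq> underlying (\<lambda>d. S \<inter> lpart L d)"
      using assms(2) unfolding underlying_def by blast
    show "underlying (\<lambda>d. S \<inter> lpart L d) \<subseteq> S"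
      unfolding underlying_def by (auto intro: vs.subspace_add[OF assms(1)])
  qed
  then show ?thesis using assms(1) unfolding graded_subspace_def by blast
qed

lemma graded_components:
  assumes "graded_subspace L S" "a + b \<in> S" "a \<in> lpart L 0" "b \<in> lpart L 1"
  shows "a \<in> S" "b \<in> S"
  using gradedD(3)[OF assms(1,2)] parts_unique[OF assms(3,4)] by blast+

lemma lspace_graded: "graded_subspace L (lspace L)"
  by (rule gradedI[OF lspace_subspace]) (blast elim: lspaceE intro: part_in_lspace)

definition parity where
  "parity x = (SOME y. \<exists>a\<in>lpart L 0. \<exists>b\<in>lpart L 1. x = a + b \<and> y = a - b)"

lemma parity_eq: "a \<in> lpart L 0 \<Longrightarrow> b \<in> lpart L 1 \<Longrightarrow> parity (a + b) = a - b"
  unfolding parity_def by (rule some_equality) (auto dest: parts_unique)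

lemma parity_even: "a \<in> lpart L 0 \<Longrightarrow> parity a = a"
  using parity_eq[of a 0] zero_in_part by simp

lemma parity_odd: "a \<in> lpart L 1 \<Longrightarrow> parity a = - a"
  using parity_eq[of 0 a] zero_in_part by simp

lemma parity_mem: "graded_subspace L S \<Longrightarrow> x \<in> S \<Longrightarrow> parity x \<in> S"
  using gradedD(1,3)[of S] parity_eq vs.subspace_diff by fastforce

lemma restrict_lspace: "graded_subspace L S \<Longrightarrow> lspace (restrict_lie L S) = S"
  by (simp add: restrict_lie_def graded_subspace_def)

lemma restrict_simps: "lscale (restrict_lie L S) = lscale L" "lbracket (restrict_lie L S) = lbracket L"
    "lpart (restrict_lie L S) d = S \<inter> lpart L d"
  by (simp_all add: restrict_lie_def)

lemma restrict_lie_lspace: "restrict_lie L (lspace L) = L"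
proof -
  have "(\<lambda>d. lspace L \<inter> lpart L d) = lpart L" using part_in_lspace by blast
  then show ?thesis by (simp add: restrict_lie_def)
qed

lemma env_relations_words:
  assumes "lie_subalgebra L S"
  shows "env_relations (restrict_lie L S) \<subseteq> (words_on S :: ('g fword \<Rightarrow>\<^sub>0 'k) set)"
proof -
  interpret A: unital_subring "words_on S :: ('g fword \<Rightarrow>\<^sub>0 'k) set" by (rule words_on_unital_subring)
  have S: "graded_subspace L S" "\<And>x y. x \<in> S \<Longrightarrow> y \<in> S \<Longrightarrow> lbracket L x y \<in> S"
    using assms unfolding lie_subalgebra_def by auto
  show ?thesis
    unfolding env_relations_def restrict_lspace[OF S(1)] restrict_simps
    using gradedD(1)[OF S(1)] S(2)
    by (auto intro!: A.diff_mem A.mult_mem fgen_in_words fconst_in_words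
        intro: vs.subspace_add vs.subspace_scale)
qed

lemma env_relations_mono:
  assumes "graded_subspace L S" "graded_subspace L T" "S \<subseteq> T"
  shows "env_relations (restrict_lie L S) \<subseteq> env_relations (restrict_lie L T)"
  unfolding env_relations_def restrict_lspace[OF assms(1)] restrict_lspace[OF assms(2)] restrict_simps
  using assms(3) by (intro Un_mono) blast+

end

locale lie_functional = super_lie_algebra L
  for L :: "('k::field_char_0, 'g::ab_group_add) super_lie" +
  fixes lam :: "'g \<Rightarrow> 'k"
  assumes functional: "even_functional L lam"
begin

abbreviation form :: "'g \<Rightarrow> 'g \<Rightarrow> 'k" where "form x y \<equiv> lam (lbracket L x y)"

lemma lam_add: "x \<in> lspace L \<Longrightarrow> y \<in> lspace L \<Longrightarrow> lam (x + y) = lam x + lam y"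
  using functional unfolding even_functional_def by blast
lemma lam_scale: "x \<in> lspace L \<Longrightarrow> lam (lscale L c x) = c * lam x"
  using functional unfolding even_functional_def by blast
lemma lam_odd: "x \<in> lpart L 1 \<Longrightarrow> lam x = 0"
  using functional unfolding even_functional_def by blast
lemma lam_zero: "lam 0 = 0"
  using lam_odd zero_in_part by blast

lemma form_add_left: "x \<in> lspace L \<Longrightarrow> y \<in> lspace L \<Longrightarrow> z \<in> lspace L \<Longrightarrow> form (x + y) z = form x z + form y z"
  by (simp add: bracket_add_left lam_add bracket_mem)
lemma form_add_right: "x \<in> lspace L \<Longrightarrow> y \<in> lspace L \<Longrightarrow> z \<in> lspace L \<Longrightarrow> form x (y + z) = form x y + form x z"
  by (simp add: bracket_add_right lam_add bracket_mem)
lemma form_scale_left: "x \<in> lspace L \<Longrightarrow> y \<in> lspace L \<Longrightarrow> form (lscale L c x) y = c * form x y"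
  by (simp add: bracket_scale_left lam_scale bracket_mem)
lemma form_scale_right: "x \<in> lspace L \<Longrightarrow> y \<in> lspace L \<Longrightarrow> form x (lscale L c y) = c * form x y"
  by (simp add: bracket_scale_right lam_scale bracket_mem)

lemma form_degree: "x \<in> lpart L d \<Longrightarrow> y \<in> lpart L e \<Longrightarrow> d \<noteq> e \<Longrightarrow> form x y = 0"
  using bracket_degree[of x d y e] bit_exhaust[of d] bit_exhaust[of e] lam_odd by fastforce

lemma form_antisym:
  assumes "x \<in> lpart L d" "y \<in> lpart L e"
  shows "form x y = - koszul d e * form y x"
proof -
  have m: "lbracket L y x \<in> lspace L" using assms bracket_mem part_in_lspace by blast
  have "lbracket L x y = lscale L (- koszul d e) (lbracket L y x)"
    using bracket_antisym[OF assms] by (simp only: vs.scale_minus_left)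
  then show ?thesis using lam_scale[OF m, of "- koszul d e"] by (simp only:)
qed

lemma form_sym_zero:
  assumes "x \<in> lpart L d" "y \<in> lspace L" "graded_subspace L S" "\<And>t. t \<in> S \<Longrightarrow> form x t = 0" "y \<in> S"
  shows "form y x = 0"
proof -
  obtain a b where ab: "a \<in> S \<inter> lpart L 0" "b \<in> S \<inter> lpart L 1" "y = a + b"
    using gradedD(3)[OF assms(3,5)] by blast
  have "form a x = 0" using form_antisym[of a 0 x d] ab assms by simp
  moreover have "form b x = 0" using form_antisym[of b 1 x d] ab assms by simp
  moreover have "a \<in> lspace L" "b \<in> lspace L" "x \<in> lspace L"
    using ab assms(1) part_in_lspace by blast+
  ultimately show ?thesis using ab(3) by (simp add: form_add_left)
qed

text \<open>The last condition is what maximality among isotropic subspaces provides. In this form polarizations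
  of \<open>g\<close> that lie in a smaller subalgebra are polarizations of that subalgebra by definition.\<close>

definition polarization_on :: "'g set \<Rightarrow> 'g set \<Rightarrow> bool" where
  "polarization_on g h \<longleftrightarrow> lie_subalgebra L h \<and> h \<subseteq> g \<and> (\<forall>s\<in>h. \<forall>t\<in>h. form s t = 0) \<and>
     (\<forall>d. \<forall>s\<in>g \<inter> lpart L d. (\<forall>t\<in>h. form s t = 0) \<and> form s s = 0 \<longrightarrow> s \<in> h)"

lemma subalgebraD:
  assumes "lie_subalgebra L h"
  shows "graded_subspace L h" "x \<in> h \<Longrightarrow> y \<in> h \<Longrightarrow> lbracket L x y \<in> h"
  using assms unfolding lie_subalgebra_def by auto

lemma polarization_onD:
  assumes "polarization_on g h"
  shows "lie_subalgebra L h" "h \<subseteq> g" "s \<in> h \<Longrightarrow> t \<in> h \<Longrightarrow> form s t = 0"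
    "s \<in> g \<Longrightarrow> s \<in> lpart L d \<Longrightarrow> (\<And>t. t \<in> h \<Longrightarrow> form s t = 0) \<Longrightarrow> form s s = 0 \<Longrightarrow> s \<in> h"
  using assms unfolding polarization_on_def by blast+

lemma graded_adjoin:
  assumes "graded_subspace L S" "s \<in> lpart L d"
  shows "graded_subspace L {x. \<exists>c. x - lscale L c s \<in> S}"
proof (rule gradedI)
  have S: "vs.subspace S" using gradedD(1)[OF assms(1)] .
  then have "{x. \<exists>c. x - lscale L c s \<in> S} = vs.span (insert s S)"
    by (simp add: vs.span_insert vs.span_eq_iff[THEN iffD2])
  then show "vs.subspace {x. \<exists>c. x - lscale L c s \<in> S}" by simp
  fix x assume "x \<in> {x. \<exists>c. x - lscale L c s \<in> S}"
  then obtain c where c: "x - lscale L c s \<in> S" by blast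
  obtain a b where ab: "a \<in> S \<inter> lpart L 0" "b \<in> S \<inter> lpart L 1" "x - lscale L c s = a + b"
    using gradedD(3)[OF assms(1) c] by blast
  have cs: "lscale L c s \<in> lpart L d" using assms(2) vs.subspace_scale[OF part_subspace] by blast
  have S': "a \<in> {x. \<exists>c. x - lscale L c s \<in> S}" if "a \<in> S" for a
    using that by (auto intro!: exI[of _ 0])
  have S'': "a + lscale L c s \<in> {x. \<exists>c. x - lscale L c s \<in> S}" if "a \<in> S" for a
    using that by (auto intro!: exI[of _ c])
  from bit_exhaust[of d]
  show "\<exists>a\<in>{x. \<exists>c. x - lscale L c s \<in> S} \<inter> lpart L 0. \<exists>b\<in>{x. \<exists>c. x - lscale L c s \<in> S} \<inter> lpart L 1. x = a + b"
  proof
    assume d: "d = 0"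
    have "x = (a + lscale L c s) + b" using ab(3) by (simp add: algebra_simps)
    moreover have "a + lscale L c s \<in> lpart L 0" using ab cs d vs.subspace_add[OF part_subspace] by blast
    ultimately show ?thesis using S' S'' ab by blast
  next
    assume d: "d = 1"
    have "x = a + (b + lscale L c s)" using ab(3) by (simp add: algebra_simps)
    moreover have "b + lscale L c s \<in> lpart L 1" using ab cs d vs.subspace_add[OF part_subspace] by blast
    ultimately show ?thesis using S' S'' ab by blast
  qed
qed

text \<open>An isotropic homogeneous vector that is orthogonal to \<open>h\<close> can be adjoined to \<open>h\<close>, and the result is
  again totally isotropic. Homogeneity makes left and right orthogonality equivalent.\<close>

lemma polarization_imp_polarization_on:
  assumes "polarization L lam h"
  shows "polarization_on (lspace L) h"
proof -
  have h: "lie_subalgebra L h" and iso: "totally_isotropic L lam h"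
    and max: "\<And>S. totally_isotropic L lam S \<Longrightarrow> h \<subseteq> S \<Longrightarrow> S = h"
    using assms unfolding polarization_def subordinate_def by auto
  note gr = subalgebraD(1)[OF h]
  have form_h: "form s t = 0" if "s \<in> h" "t \<in> h" for s t
    using iso that unfolding totally_isotropic_def lie_form_def by blast
  have "s \<in> h" if s: "s \<in> lpart L d" "\<forall>t\<in>h. form s t = 0" "form s s = 0" for s d
  proof -
    let ?S = "{x. \<exists>c. x - lscale L c s \<in> h}"
    have form_s: "form t s = 0" if "t \<in> h" for t
      using form_sym_zero[OF s(1) gradedD(2)[OF gr that] gr _ that] s(2) by blast
    have "form x y = 0" if xy: "x \<in> ?S" "y \<in> ?S" for x y
    proof -
      obtain c where c: "x - lscale L c s \<in> h" using xy by blast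
      obtain c' where c': "y - lscale L c' s \<in> h" using xy by blast
      define u v where "u = x - lscale L c s" and "v = y - lscale L c' s"
      have uv: "u \<in> h" "v \<in> h" "u \<in> lspace L" "v \<in> lspace L" using c c' gradedD(2)[OF gr] u_def v_def by auto
      have sl: "s \<in> lspace L" using s part_in_lspace by blast
      then have sl': "lscale L c s \<in> lspace L" "lscale L c' s \<in> lspace L"
        using vs.subspace_scale[OF lspace_subspace] by blast+
      have "form (u + lscale L c s) (v + lscale L c' s) = 0"
        using uv sl sl' form_h form_s s(2,3) vs.subspace_add[OF lspace_subspace]
        by (simp add: form_add_left form_add_right form_scale_left form_scale_right)
      then show ?thesis unfolding u_def v_def by simp
    qed
    then have "totally_isotropic L lam ?S"
      unfolding totally_isotropic_def lie_form_def using graded_adjoin[OF gr s(1)] by blast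
    moreover have "h \<subseteq> ?S" by (auto intro!: exI[of _ 0])
    ultimately have "?S = h" using max by blast
    moreover have "s \<in> ?S" using vs.subspace_0[OF gradedD(1)[OF gr]] by (auto intro!: exI[of _ 1])
    ultimately show ?thesis by blast
  qed
  then show ?thesis
    unfolding polarization_on_def using h form_h gradedD(2)[OF gr] by blast
qed

section \<open>Ideals of the enveloping algebra of a subalgebra\<close>

text \<open>The graded ideals of the enveloping algebra of \<open>g\<close>, as ideals of the free algebra on \<open>g\<close>.\<close>

definition env_ideal_on :: "'g set \<Rightarrow> ('g fword \<Rightarrow>\<^sub>0 'k) set \<Rightarrow> bool" where
  "env_ideal_on g D \<longleftrightarrow> two_sided_ideal_of (words_on g) D \<and>
     env_relations (restrict_lie L g) \<subseteq> D \<and> map_letters parity ` D \<subseteq> D"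

definition char_gens :: "'g set \<Rightarrow> ('g fword \<Rightarrow>\<^sub>0 'k) set" where
  "char_gens h = {fgen t - fconst (lam t) | t d. t \<in> h \<inter> lpart L d}"

text \<open>The left ideal that annihilates the generator of the module induced from the character \<open>lam\<close> of
  \<open>h\<close>, over the quotient of the free algebra by \<open>D\<close>.\<close>

definition char_ideal :: "'g set \<Rightarrow> ('g fword \<Rightarrow>\<^sub>0 'k) set \<Rightarrow> 'g set \<Rightarrow> ('g fword \<Rightarrow>\<^sub>0 'k) set" where
  "char_ideal g D h = left_ideal_gen (words_on g) D (char_gens h)"

definition char_ann :: "'g set \<Rightarrow> ('g fword \<Rightarrow>\<^sub>0 'k) set \<Rightarrow> 'g set \<Rightarrow> ('g fword \<Rightarrow>\<^sub>0 'k) set" where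
  "char_ann g D h = {u \<in> words_on g. \<forall>b\<in>words_on g. u * b \<in> char_ideal g D h}"

end

locale env_on = lie_functional L lam
  for L :: "('k::field_char_0, 'g::ab_group_add) super_lie" and lam +
  fixes g :: "'g set" and D :: "('g fword \<Rightarrow>\<^sub>0 'k) set"
  assumes subalgebra: "lie_subalgebra L g" and env: "env_ideal_on g D"
begin

sublocale D: two_sided_ideal_of "words_on g" D
  using env unfolding env_ideal_on_def by blast

lemmas g_graded = subalgebraD(1)[OF subalgebra]
lemmas g_subspace = gradedD(1)[OF g_graded]
lemmas g_lspace = gradedD(2)[OF g_graded]

lemma parity_D: "p \<in> D \<Longrightarrow> map_letters parity p \<in> D"
  using env unfolding env_ideal_on_def by blast

lemma relations: "env_relations (restrict_lie L g) \<subseteq> D"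
  using env unfolding env_ideal_on_def by blast

lemma gen_add: "x \<in> g \<Longrightarrow> y \<in> g \<Longrightarrow> fgen (x + y) - (fgen x + fgen y) \<in> D"
proof -
  assume "x \<in> g" "y \<in> g"
  then have "fgen (x + y) - fgen x - fgen y \<in> env_relations (restrict_lie L g)"
    unfolding env_relations_def restrict_lspace[OF g_graded] by blast
  then show ?thesis using relations by (auto simp: algebra_simps)
qed

lemma gen_scale: "x \<in> g \<Longrightarrow> fgen (lscale L c x) - fconst c * fgen x \<in> D"
proof -
  assume "x \<in> g"
  then have "fgen (lscale L c x) - fconst c * fgen x \<in> env_relations (restrict_lie L g)"
    unfolding env_relations_def restrict_lspace[OF g_graded] restrict_simps by blast
  then show ?thesis using relations by blast
qed

lemma gen_comm:
  assumes "x \<in> g \<inter> lpart L d" "y \<in> g \<inter> lpart L e"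
  shows "fgen x * fgen y - fconst (koszul d e) * (fgen y * fgen x) - fgen (lbracket L x y) \<in> D"
proof -
  have "fgen x * fgen y - fconst (koszul d e) * (fgen y * fgen x) - fgen (lbracket L x y)
      \<in> env_relations (restrict_lie L g)"
    unfolding env_relations_def restrict_simps using assms by blast
  then show ?thesis using relations by blast
qed

lemma gen_zero: "fgen 0 \<in> D"
  using gen_scale[of 0 0] vs.subspace_0[OF g_subspace] by simp

lemma gen_uminus: "x \<in> g \<Longrightarrow> fgen (- x) + fgen x \<in> D"
  using gen_scale[of x "- 1"] by (simp add: single_uminus)

lemma fgen_mem: "x \<in> g \<Longrightarrow> fgen x \<in> words_on g" by (rule fgen_in_words)

lemma char_gens_words: "h \<subseteq> g \<Longrightarrow> char_gens h \<subseteq> words_on g"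
  unfolding char_gens_def using fgen_mem fconst_in_words D.diff_mem by fast

lemma char_ideal_left_ideal:
  assumes "h \<subseteq> g"
  shows "left_ideal_of (words_on g) (char_ideal g D h)"
  unfolding char_ideal_def
  using left_ideal_gen_left_ideal[OF D.left_ideal_of_axioms char_gens_words[OF assms]] .

lemma D_char_ideal: "D \<subseteq> char_ideal g D h"
  unfolding char_ideal_def by (auto intro: left_ideal_gen.base)

lemma char_gen_mem: "t \<in> h \<Longrightarrow> t \<in> lpart L d \<Longrightarrow> fgen t - fconst (lam t) \<in> char_ideal g D h"
proof -
  assume "t \<in> h" "t \<in> lpart L d"
  then have "fgen t - fconst (lam t) \<in> char_gens h" unfolding char_gens_def by blast
  from left_ideal_gen.gen[OF D.one_mem this] show ?thesis unfolding char_ideal_def by simp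
qed

lemma char_ideal_least:
  assumes "left_ideal_of (words_on g) J" "D \<subseteq> J"
    "\<And>t d. t \<in> h \<Longrightarrow> t \<in> lpart L d \<Longrightarrow> fgen t - fconst (lam t) \<in> J"
  shows "char_ideal g D h \<subseteq> J"
  unfolding char_ideal_def
  by (rule left_ideal_gen_least[OF assms(1,2)]) (auto simp: char_gens_def intro: assms(3))

lemma char_ideal_mono: "h \<subseteq> h' \<Longrightarrow> h' \<subseteq> g \<Longrightarrow> char_ideal g D h \<subseteq> char_ideal g D h'"
  by (rule char_ideal_least[OF char_ideal_left_ideal D_char_ideal]) (auto intro: char_gen_mem)

lemma char_gen_mem':
  assumes "graded_subspace L h" "h \<subseteq> g" "t \<in> h"
  shows "fgen t - fconst (lam t) \<in> char_ideal g D h"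
proof -
  let ?J = "char_ideal g D h"
  interpret J: left_ideal_of "words_on g" ?J using char_ideal_left_ideal[OF assms(2)] .
  obtain a b where ab: "a \<in> h \<inter> lpart L 0" "b \<in> h \<inter> lpart L 1" "t = a + b"
    using gradedD(3)[OF assms(1,3)] by blast
  have "fgen (a + b) - (fgen a + fgen b) \<in> ?J"
    using gen_add ab assms(2) D_char_ideal by blast
  moreover have "fgen a - fconst (lam a) \<in> ?J" "fgen b - fconst (lam b) \<in> ?J"
    using ab char_gen_mem by blast+
  ultimately have "(fgen (a + b) - (fgen a + fgen b)) + ((fgen a - fconst (lam a)) + (fgen b - fconst (lam b)))
      \<in> ?J" by (intro J.add_ideal)
  moreover have "lam t = lam a + lam b" using ab part_in_lspace lam_add by blast
  ultimately show ?thesis using ab(3) by (simp add: single_add algebra_simps)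
qed

text \<open>The condition on \<open>y\<close> says that it normalizes the pair of \<open>h\<close> and its character: moving \<open>y\<close> to the left
  past \<open>t - lam t\<close> only produces \<open>[t, y]\<close>, which equals \<open>[t, y] - lam [t, y]\<close>. The sign in this
  computation is harmless because \<open>lam\<close> vanishes on odd vectors.\<close>

lemma char_ideal_rmult_gen:
  assumes h: "h \<subseteq> g" and y: "y \<in> g \<inter> lpart L d"
    and br: "\<And>t. t \<in> h \<Longrightarrow> lbracket L t y \<in> h" "\<And>t. t \<in> h \<Longrightarrow> form t y = 0"
    and p: "p \<in> char_ideal g D h"
  shows "p * fgen y \<in> char_ideal g D h"
proof -
  let ?J = "char_ideal g D h"
  interpret J: left_ideal_of "words_on g" ?J using char_ideal_left_ideal[OF h] .
  have Y: "fgen y \<in> words_on g" using y fgen_mem by blast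
  have gen_mult: "(fgen t - fconst (lam t)) * fgen y \<in> ?J"
    if t: "t \<in> h" "t \<in> lpart L e" for t e
  proof -
    have k: "koszul e d * lam t = lam t"
    proof (cases "e = 0")
      case True then show ?thesis by (simp add: koszul_def)
    next
      case False
      then have "e = 1" using bit_exhaust by blast
      then show ?thesis using lam_odd t by simp
    qed
    let ?K = "fconst (koszul e d) :: 'g fword \<Rightarrow>\<^sub>0 'k"
    have K: "?K * fconst (lam t) = fconst (lam t)" by (simp only: fconst_mult[symmetric] k)
    have "fgen t * fgen y - ?K * (fgen y * fgen t) - fgen (lbracket L t y) \<in> ?J"
      using gen_comm[of t e y d] t y h D_char_ideal by blast
    moreover have "fgen (lbracket L t y) - fconst (form t y) \<in> ?J"
      using char_gen_mem[OF br(1)[OF t(1)] bracket_degree[OF t(2)]] y by blast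
    moreover have "?K * fgen y * (fgen t - fconst (lam t)) \<in> ?J"
      using J.lmult_ideal[OF D.mult_mem[OF fconst_in_words Y] char_gen_mem[OF t]] .
    ultimately have "(fgen t * fgen y - ?K * (fgen y * fgen t) - fgen (lbracket L t y)) +
        ((fgen (lbracket L t y) - fconst (form t y)) + ?K * fgen y * (fgen t - fconst (lam t)))
        \<in> ?J"
      by (intro J.add_ideal)
    moreover have "?K * fgen y * fconst (lam t) = fconst (lam t) * fgen y"
      by (metis K fconst_central mult.assoc)
    ultimately show ?thesis using br(2)[OF t(1)] by (simp add: algebra_simps)
  qed
  show ?thesis using p unfolding char_ideal_def
  proof induction
    case (base p)
    then show ?case using D.rmult_ideal[OF _ Y] by (blast intro: left_ideal_gen.base)
  next
    case (gen a x)
    then obtain t e where "x = fgen t - fconst (lam t)" "t \<in> h" "t \<in> lpart L e"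
      unfolding char_gens_def by blast
    then show ?case
      using J.lmult_ideal[OF gen(1) gen_mult]
      by (simp add: mult.assoc char_ideal_def)
  qed (auto simp: distrib_right intro: left_ideal_gen.add)
qed

text \<open>All of \<open>g\<close> normalizes the character of such a \<open>c\<close>, so the left ideal is two-sided.\<close>

lemma char_ideal_env:
  assumes c: "graded_subspace L c" "c \<subseteq> g"
    and br: "\<And>t b. t \<in> c \<Longrightarrow> b \<in> g \<Longrightarrow> lbracket L t b \<in> c" "\<And>t b. t \<in> c \<Longrightarrow> b \<in> g \<Longrightarrow> form t b = 0"
  shows "env_ideal_on g (char_ideal g D c)"
proof -
  let ?J = "char_ideal g D c"
  interpret J: left_ideal_of "words_on g" ?J using char_ideal_left_ideal[OF c(2)] .
  have hom: "p * fgen b \<in> ?J" if "p \<in> ?J" "b \<in> g \<inter> lpart L d" for p b d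
    using char_ideal_rmult_gen[OF c(2) that(2) _ _ that(1)] br that(2) by blast
  have gen_right: "p * fgen b \<in> ?J" if p: "p \<in> ?J" and b: "b \<in> g" for p b
  proof -
    obtain a a' where a: "a \<in> g \<inter> lpart L 0" "a' \<in> g \<inter> lpart L 1" "b = a + a'"
      using gradedD(3)[OF g_graded b] by blast
    have "p * (fgen (a + a') - (fgen a + fgen a')) \<in> ?J"
      using J.lmult_ideal[of p] p J.subset gen_add[of a a'] a D_char_ideal by blast
    then have "p * (fgen (a + a') - (fgen a + fgen a')) + (p * fgen a + p * fgen a') \<in> ?J"
      using hom[OF p a(1)] hom[OF p a(2)] by (intro J.add_ideal)
    then show ?thesis unfolding a(3) by (simp add: algebra_simps)
  qed
  have right: "p * b \<in> ?J" if "b \<in> words_on g" "p \<in> ?J" for p b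
    using that
  proof (induction arbitrary: p rule: words_on_induct)
    case (const c)
    then show ?case using J.lmult_ideal[OF fconst_in_words] fconst_central by metis
  next
    case (add q r)
    then show ?case by (simp add: distrib_left J.add_ideal)
  next
    case (gen x q)
    then show ?case using gen_right[of p x] by (simp add: mult.assoc[symmetric])
  qed
  have "map_letters parity p \<in> ?J" if "p \<in> ?J" for p
    using that unfolding char_ideal_def
  proof induction
    case (base p)
    then show ?case using parity_D by (blast intro: left_ideal_gen.base)
  next
    case (gen a x)
    then obtain t e where t: "x = fgen t - fconst (lam t)" "t \<in> c" "t \<in> lpart L e"
      unfolding char_gens_def by blast
    have a: "map_letters parity a \<in> words_on g"
      using map_letters_in_words[OF gen(1)] parity_mem[OF g_graded] by blast
    have "map_letters parity x \<in> ?J"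
    proof (cases "e = 0")
      case True
      then show ?thesis using t char_gen_mem[OF t(2,3)]
        by (simp add: map_letters_diff map_letters_fgen map_letters_fconst parity_even)
    next
      case False
      then have "e = 1" using bit_exhaust by blast
      then have *: "map_letters parity x = fgen (- t)" "lam t = 0"
        using t by (simp_all add: map_letters_diff map_letters_fgen map_letters_fconst parity_odd lam_odd)
      have "fgen (- t) + fgen t \<in> ?J" using gen_uminus t(2) c(2) D_char_ideal by blast
      moreover have "fgen t \<in> ?J" using char_gen_mem[OF t(2,3)] * by simp
      ultimately show ?thesis using J.diff_ideal * by fastforce
    qed
    then show ?case
      using J.lmult_ideal[OF a] by (simp add: map_letters_mult char_ideal_def)
  qed (auto simp: map_letters_add intro: left_ideal_gen.add)
  moreover have "two_sided_ideal_of (words_on g) (?J)"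
    by unfold_locales (rule right)
  ultimately show ?thesis
    unfolding env_ideal_on_def using relations D_char_ideal by blast
qed

lemma char_ideal_absorb:
  assumes "c \<subseteq> h"
  shows "char_ideal g (char_ideal g D c) h = char_ideal g D h"
proof
  have "p \<in> char_ideal g D h" if "p \<in> char_ideal g D c" for p
    using that unfolding char_ideal_def
    by induction (use assms in \<open>auto simp: char_gens_def intro: left_ideal_gen.intros\<close>)
  then show "char_ideal g (char_ideal g D c) h \<subseteq> char_ideal g D h"
  proof -
    assume *: "\<And>p. p \<in> char_ideal g D c \<Longrightarrow> p \<in> char_ideal g D h"
    have "p \<in> char_ideal g D h" if "p \<in> char_ideal g (char_ideal g D c) h" for p
      using that unfolding char_ideal_def[of g "char_ideal g D c"]
      by induction (auto simp: char_ideal_def[of g D h] intro: left_ideal_gen.intros *[unfolded char_ideal_def[of g D h]])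
    then show ?thesis by blast
  qed
  have "p \<in> char_ideal g (char_ideal g D c) h" if "p \<in> char_ideal g D h" for p
    using that unfolding char_ideal_def[of g D h]
    by induction (use D_char_ideal in \<open>auto simp: char_ideal_def[of g "char_ideal g D c"] intro: left_ideal_gen.intros\<close>)
  then show "char_ideal g D h \<subseteq> char_ideal g (char_ideal g D c) h" by blast
qed

lemma char_ann_subset: "char_ann g D h \<subseteq> char_ideal g D h"
  unfolding char_ann_def using D.one_mem by fastforce

lemma char_ann_rmult: "u \<in> char_ann g D h \<Longrightarrow> b \<in> words_on g \<Longrightarrow> u * b \<in> char_ann g D h"
  unfolding char_ann_def using D.mult_mem by (auto simp: mult.assoc)

lemma char_ann_lmult: "h \<subseteq> g \<Longrightarrow> u \<in> char_ann g D h \<Longrightarrow> b \<in> words_on g \<Longrightarrow> b * u \<in> char_ann g D h"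
  unfolding char_ann_def using D.mult_mem left_ideal_of.lmult_ideal[OF char_ideal_left_ideal]
  by (auto simp: mult.assoc)

lemma char_ann_diff: "h \<subseteq> g \<Longrightarrow> u \<in> char_ann g D h \<Longrightarrow> v \<in> char_ann g D h \<Longrightarrow> u - v \<in> char_ann g D h"
  unfolding char_ann_def using D.diff_mem left_ideal_of.diff_ideal[OF char_ideal_left_ideal]
  by (auto simp: left_diff_distrib)

text \<open>Because the annihilator is stable under right multiplication.\<close>

lemma char_ann_leI:
  assumes "char_ann g D h \<subseteq> char_ideal g D h'"
  shows "char_ann g D h \<subseteq> char_ann g D h'"
  using assms char_ann_rmult unfolding char_ann_def by blast

end

section \<open>Choosing a vector near the center\<close>

context super_lie_algebra
begin

lemma graded_components':
  assumes "graded_subspace L S" "a + b \<in> S" "a \<in> lpart L d" "b \<in> lpart L e" "d \<noteq> e"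
  shows "a \<in> S" "b \<in> S"
proof -
  have "b + a \<in> S" using assms(2) by (simp add: add.commute)
  then show "a \<in> S" "b \<in> S"
    using graded_components[OF assms(1), of a b] graded_components[OF assms(1), of b a] assms
      bit_exhaust[of d] bit_exhaust[of e] by auto
qed

lemma bracket_extend:
  assumes A: "graded_subspace L A" and B: "graded_subspace L B" and S: "vs.subspace S"
    and hom: "\<And>a b d e. a \<in> A \<inter> lpart L d \<Longrightarrow> b \<in> B \<inter> lpart L e \<Longrightarrow> lbracket L a b \<in> S"
    and ab: "a \<in> A" "b \<in> B"
  shows "lbracket L a b \<in> S"
proof -
  obtain a0 a1 where a: "a0 \<in> A \<inter> lpart L 0" "a1 \<in> A \<inter> lpart L 1" "a = a0 + a1"
    using gradedD(3)[OF A ab(1)] by blast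
  obtain b0 b1 where b: "b0 \<in> B \<inter> lpart L 0" "b1 \<in> B \<inter> lpart L 1" "b = b0 + b1"
    using gradedD(3)[OF B ab(2)] by blast
  have l: "a0 \<in> lspace L" "a1 \<in> lspace L" "b0 \<in> lspace L" "b1 \<in> lspace L" "b0 + b1 \<in> lspace L"
    using a b part_in_lspace vs.subspace_add[OF lspace_subspace] by blast+
  have "lbracket L a b = (lbracket L a0 b0 + lbracket L a0 b1) + (lbracket L a1 b0 + lbracket L a1 b1)"
    unfolding a(3) b(3) using l by (simp add: bracket_add_left bracket_add_right)
  moreover have "\<dots> \<in> S"
    using hom[OF a(1) b(1)] hom[OF a(1) b(2)] hom[OF a(2) b(1)] hom[OF a(2) b(2)]
    by (intro vs.subspace_add[OF S])
  ultimately show ?thesis by simp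
qed

lemma bracket_swap_mem:
  assumes "vs.subspace S" "a \<in> lpart L d" "b \<in> lpart L e" "lbracket L b a \<in> S"
  shows "lbracket L a b \<in> S"
  using bracket_antisym[OF assms(2,3)] vs.subspace_neg[OF assms(1)] vs.subspace_scale[OF assms(1,4)]
  by simp

text \<open>Take the last term of the lower central series that meets \<open>g\<close> outside \<open>i\<close>. Since \<open>i\<close> is graded, one
  of the two components of an element found there does as well.\<close>

lemma exists_central_mod_ideal:
  assumes nil: "nilpotent_super_lie L" and g: "lie_subalgebra L g"
    and i: "graded_subspace L i" "i \<subseteq> g" "i \<noteq> g" "\<And>b x. b \<in> g \<Longrightarrow> x \<in> i \<Longrightarrow> lbracket L b x \<in> i"
  shows "\<exists>d y. y \<in> g \<and> y \<in> lpart L d \<and> y \<notin> i \<and> (\<forall>b\<in>g. lbracket L b y \<in> i)"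
proof -
  have gr: "graded_subspace L g" and closed: "\<And>x y. x \<in> g \<Longrightarrow> y \<in> g \<Longrightarrow> lbracket L x y \<in> g"
    using g unfolding lie_subalgebra_def by auto
  define P where "P m \<longleftrightarrow> (\<exists>y\<in>g \<inter> lower_central L m. y \<notin> i)" for m
  obtain n where n: "lower_central L n = {0}" using nil unfolding nilpotent_super_lie_def by blast
  have "P 0" unfolding P_def using i(2,3) gradedD(2)[OF gr] by auto
  moreover have "\<not> P n" unfolding P_def using n vs.subspace_0[OF gradedD(1)[OF i(1)]] by auto
  ultimately obtain m where m: "P m" "\<not> P (Suc m)"
    by (metis nat_induct)
  obtain y where y: "y \<in> g" "y \<in> lower_central L m" "y \<notin> i" using m(1) unfolding P_def by blast
  have step: "lbracket L b y \<in> i" if "b \<in> g" for b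
  proof -
    have "lbracket L b y \<in> lower_central L (Suc m)"
      using that y gradedD(2)[OF gr] unfolding lower_central.simps bracket_space_def
      by (blast intro: vs.span_base)
    then show ?thesis using m(2) closed[OF that y(1)] unfolding P_def by blast
  qed
  obtain a a' where a: "a \<in> g \<inter> lpart L 0" "a' \<in> g \<inter> lpart L 1" "y = a + a'"
    using gradedD(3)[OF gr y(1)] by blast
  have hom: "lbracket L b a \<in> i \<and> lbracket L b a' \<in> i" if b: "b \<in> g \<inter> lpart L e" for b e
  proof -
    have "b \<in> lspace L" "a \<in> lspace L" "a' \<in> lspace L" using a b part_in_lspace by blast+
    then have "lbracket L b a + lbracket L b a' \<in> i"
      using step[of b] b a(3) by (simp add: bracket_add_right)
    moreover have "lbracket L b a \<in> lpart L (e + 0)" "lbracket L b a' \<in> lpart L (e + 1)"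
      using a b bracket_degree by blast+
    moreover have "e + 0 \<noteq> e + 1" by simp
    ultimately show ?thesis using graded_components'[OF i(1)] by blast
  qed
  have all: "lbracket L b c \<in> i" if b: "b \<in> g" and c: "c = a \<or> c = a'" for b c
  proof -
    obtain b0 b1 where b01: "b0 \<in> g \<inter> lpart L 0" "b1 \<in> g \<inter> lpart L 1" "b = b0 + b1"
      using gradedD(3)[OF gr b] by blast
    have l: "b0 \<in> lspace L" "b1 \<in> lspace L" "c \<in> lspace L" using a b01 c part_in_lspace by blast+
    have "lbracket L b0 c \<in> i" "lbracket L b1 c \<in> i" using hom[OF b01(1)] hom[OF b01(2)] c by auto
    then show ?thesis unfolding b01(3) bracket_add_left[OF l]
      by (intro vs.subspace_add[OF gradedD(1)[OF i(1)]])
  qed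
  have "a \<notin> i \<or> a' \<notin> i" using y(3) a(3) vs.subspace_add[OF gradedD(1)[OF i(1)]] by blast
  then show ?thesis using a(1,2) all by blast
qed

end

context lie_functional
begin

definition homogeneous :: "'g set \<Rightarrow> 'g set" where
  "homogeneous g = {b \<in> g. \<exists>d. b \<in> lpart L d}"

text \<open>The null ideal is the largest ideal of \<open>g\<close> inside the kernel of \<open>lam\<close>, and the core is the preimage of
  the center of the quotient by it. On that center \<open>lam\<close> is injective (\<open>core_lam_zero\<close>).
  Replacing quotients by the core keeps all computations inside \<open>g\<close>. The brackets are taken with homogeneous vectors so that iterated brackets have a degree.\<close>

definition null_ideal :: "'g set \<Rightarrow> 'g set" where
  "null_ideal g = {x \<in> g. \<forall>bs\<in>lists (homogeneous g). lam (foldr (lbracket L) bs x) = 0}"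

definition core :: "'g set \<Rightarrow> 'g set" where
  "core g = {x \<in> g. \<forall>b\<in>homogeneous g. lbracket L b x \<in> null_ideal g}"

context
  fixes g :: "'g set"
  assumes g: "lie_subalgebra L g"
begin

private lemmas gr = subalgebraD(1)[OF g]
private lemmas closed = subalgebraD(2)[OF g]
private lemmas sub = gradedD(1)[OF gr]
private lemmas lsp = gradedD(2)[OF gr]

lemma foldr_bracket_mem: "bs \<in> lists (homogeneous g) \<Longrightarrow> x \<in> g \<Longrightarrow> foldr (lbracket L) bs x \<in> g"
  by (induction bs) (auto simp: homogeneous_def intro: closed)

lemma foldr_bracket_add:
  "bs \<in> lists (homogeneous g) \<Longrightarrow> x \<in> g \<Longrightarrow> y \<in> g \<Longrightarrow>
    foldr (lbracket L) bs (x + y) = foldr (lbracket L) bs x + foldr (lbracket L) bs y"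
proof (induction bs)
  case (Cons b bs)
  then have "b \<in> lspace L" "foldr (lbracket L) bs x \<in> lspace L" "foldr (lbracket L) bs y \<in> lspace L"
    using lsp foldr_bracket_mem by (auto simp: homogeneous_def)
  then show ?case using Cons by (simp add: bracket_add_right)
qed simp

lemma foldr_bracket_scale:
  "bs \<in> lists (homogeneous g) \<Longrightarrow> x \<in> g \<Longrightarrow>
    foldr (lbracket L) bs (lscale L c x) = lscale L c (foldr (lbracket L) bs x)"
proof (induction bs)
  case (Cons b bs)
  then have "b \<in> lspace L" "foldr (lbracket L) bs x \<in> lspace L"
    using lsp foldr_bracket_mem by (auto simp: homogeneous_def)
  then show ?case using Cons by (simp add: bracket_scale_right)
qed simp

lemma foldr_bracket_degree:
  "bs \<in> lists (homogeneous g) \<Longrightarrow> \<exists>e. \<forall>d x. x \<in> lpart L d \<longrightarrow> foldr (lbracket L) bs x \<in> lpart L (e + d)"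
proof (induction bs)
  case Nil
  then show ?case by (intro exI[of _ 0]) simp
next
  case (Cons b bs)
  then obtain e where e: "\<forall>d x. x \<in> lpart L d \<longrightarrow> foldr (lbracket L) bs x \<in> lpart L (e + d)" by auto
  obtain f where f: "b \<in> lpart L f" using Cons.prems by (auto simp: homogeneous_def)
  have "foldr (lbracket L) (b # bs) x \<in> lpart L (f + e + d)" if "x \<in> lpart L d" for d x
  proof -
    have "foldr (lbracket L) bs x \<in> lpart L (e + d)" using e that by blast
    from bracket_degree[OF f this] show ?thesis by (simp only: foldr_Cons o_apply add.assoc)
  qed
  then show ?case by blast
qed

lemma null_ideal_graded: "graded_subspace L (null_ideal g)"
proof (rule gradedI)
  show "vs.subspace (null_ideal g)"
  proof (rule vs.subspaceI)
    show "0 \<in> null_ideal g"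
      using foldr_bracket_scale[of _ 0 0] vs.subspace_0[OF sub] lam_zero
      by (auto simp: null_ideal_def)
    show "x + y \<in> null_ideal g" if xy: "x \<in> null_ideal g" "y \<in> null_ideal g" for x y
    proof -
      have m: "x \<in> g" "y \<in> g" using xy by (auto simp: null_ideal_def)
      have "lam (foldr (lbracket L) bs (x + y)) = 0" if "bs \<in> lists (homogeneous g)" for bs
        using foldr_bracket_add[OF that m] xy that lsp[OF foldr_bracket_mem[OF that m(1)]]
          lsp[OF foldr_bracket_mem[OF that m(2)]] by (simp add: null_ideal_def lam_add)
      then show ?thesis using vs.subspace_add[OF sub m] by (simp add: null_ideal_def)
    qed
    show "lscale L c x \<in> null_ideal g" if x: "x \<in> null_ideal g" for c x
    proof -
      have m: "x \<in> g" using x by (auto simp: null_ideal_def)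
      have "lam (foldr (lbracket L) bs (lscale L c x)) = 0" if "bs \<in> lists (homogeneous g)" for bs
        using foldr_bracket_scale[OF that m] x that lsp[OF foldr_bracket_mem[OF that m]]
        by (simp add: null_ideal_def lam_scale)
      then show ?thesis using vs.subspace_scale[OF sub m] by (simp add: null_ideal_def)
    qed
  qed
next
  fix x assume x: "x \<in> null_ideal g"
  then have "x \<in> g" by (simp add: null_ideal_def)
  from gradedD(3)[OF gr this] obtain a b
    where ab: "a \<in> g \<inter> lpart L 0" "b \<in> g \<inter> lpart L 1" "x = a + b" by blast
  have "lam (foldr (lbracket L) bs a) = 0 \<and> lam (foldr (lbracket L) bs b) = 0"
    if bs: "bs \<in> lists (homogeneous g)" for bs
  proof -
    obtain e where "\<forall>d x. x \<in> lpart L d \<longrightarrow> foldr (lbracket L) bs x \<in> lpart L (e + d)"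
      using foldr_bracket_degree[OF bs] by blast
    then have deg: "foldr (lbracket L) bs a \<in> lpart L (e + 0)" "foldr (lbracket L) bs b \<in> lpart L (e + 1)"
      using ab by blast+
    have m: "a \<in> g" "b \<in> g" using ab by auto
    have "lam (foldr (lbracket L) bs (a + b)) = 0"
      using x bs unfolding null_ideal_def ab(3) by blast
    then have "lam (foldr (lbracket L) bs a) + lam (foldr (lbracket L) bs b) = 0"
      unfolding foldr_bracket_add[OF bs m]
        lam_add[OF lsp[OF foldr_bracket_mem[OF bs m(1)]] lsp[OF foldr_bracket_mem[OF bs m(2)]]] .
    moreover have "lam (foldr (lbracket L) bs a) = 0 \<or> lam (foldr (lbracket L) bs b) = 0"
      using deg lam_odd bit_exhaust[of e] by fastforce
    ultimately show ?thesis by auto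
  qed
  then have "a \<in> null_ideal g" "b \<in> null_ideal g" using ab by (auto simp: null_ideal_def)
  then show "\<exists>a\<in>null_ideal g \<inter> lpart L 0. \<exists>b\<in>null_ideal g \<inter> lpart L 1. x = a + b"
    using ab by blast
qed

lemma null_ideal_subset: "x \<in> null_ideal g \<Longrightarrow> x \<in> g" by (simp add: null_ideal_def)

lemma null_ideal_lam: "x \<in> null_ideal g \<Longrightarrow> lam x = 0"
  unfolding null_ideal_def by (auto dest: bspec[of _ _ "[]"])

lemma null_ideal_bracket_hom:
  assumes "x \<in> null_ideal g" "b \<in> homogeneous g"
  shows "lbracket L b x \<in> null_ideal g"
proof -
  have "lam (foldr (lbracket L) bs (lbracket L b x)) = 0" if "bs \<in> lists (homogeneous g)" for bs
  proof -
    have "bs @ [b] \<in> lists (homogeneous g)" using that assms(2) by auto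
    then have "lam (foldr (lbracket L) (bs @ [b]) x) = 0" using assms(1) unfolding null_ideal_def by blast
    then show ?thesis by simp
  qed
  moreover have "lbracket L b x \<in> g" using assms closed by (auto simp: null_ideal_def homogeneous_def)
  ultimately show ?thesis by (simp add: null_ideal_def)
qed

lemma core_subset: "core g \<subseteq> g" by (auto simp: core_def)

lemma null_ideal_core: "null_ideal g \<subseteq> core g"
  using null_ideal_bracket_hom null_ideal_subset by (auto simp: core_def)

lemma core_graded: "graded_subspace L (core g)"
proof (rule gradedI)
  have null: "vs.subspace (null_ideal g)" using gradedD(1)[OF null_ideal_graded] .
  have hl: "b \<in> lspace L" if "b \<in> homogeneous g" for b using that lsp by (simp add: homogeneous_def)
  show "vs.subspace (core g)"
  proof (rule vs.subspaceI)
    show "0 \<in> core g"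
      using null_ideal_core vs.subspace_0[OF null] by blast
    show "x + y \<in> core g" if "x \<in> core g" "y \<in> core g" for x y
      using that vs.subspace_add[OF sub] vs.subspace_add[OF null] lsp hl
      by (auto simp: core_def bracket_add_right)
    show "lscale L c x \<in> core g" if "x \<in> core g" for c x
      using that vs.subspace_scale[OF sub] vs.subspace_scale[OF null] lsp hl
      by (auto simp: core_def bracket_scale_right)
  qed
next
  fix x assume x: "x \<in> core g"
  then have "x \<in> g" by (simp add: core_def)
  from gradedD(3)[OF gr this] obtain a b
    where ab: "a \<in> g \<inter> lpart L 0" "b \<in> g \<inter> lpart L 1" "x = a + b" by blast
  have "lbracket L c a \<in> null_ideal g \<and> lbracket L c b \<in> null_ideal g" if c: "c \<in> homogeneous g" for c
  proof -
    obtain e where e: "c \<in> lpart L e" "c \<in> g" using c by (auto simp: homogeneous_def)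
    have l: "c \<in> lspace L" "a \<in> lspace L" "b \<in> lspace L" using ab e lsp by auto
    have "lbracket L c (a + b) \<in> null_ideal g" using x c unfolding core_def ab(3) by blast
    then have "lbracket L c a + lbracket L c b \<in> null_ideal g" unfolding bracket_add_right[OF l] .
    moreover have "lbracket L c a \<in> lpart L (e + 0)" "lbracket L c b \<in> lpart L (e + 1)"
      using ab e bracket_degree by blast+
    moreover have "e + 0 \<noteq> e + 1" by simp
    ultimately show ?thesis using graded_components'[OF null_ideal_graded] by blast
  qed
  then have "a \<in> core g" "b \<in> core g" using ab by (auto simp: core_def)
  then show "\<exists>a\<in>core g \<inter> lpart L 0. \<exists>b\<in>core g \<inter> lpart L 1. x = a + b" using ab by blast
qed

lemma core_bracket_null:
  assumes "b \<in> g" "x \<in> core g"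
  shows "lbracket L b x \<in> null_ideal g" "lbracket L x b \<in> null_ideal g"
proof -
  note null = gradedD(1)[OF null_ideal_graded]
  have hom: "lbracket L b x \<in> null_ideal g" if "b \<in> g \<inter> lpart L d" "x \<in> core g" for b x d
    using that by (auto simp: core_def homogeneous_def)
  show "lbracket L b x \<in> null_ideal g"
    by (rule bracket_extend[OF gr core_graded null _ assms]) (use hom in blast)
  show "lbracket L x b \<in> null_ideal g"
    by (rule bracket_extend[OF core_graded gr null _ assms(2,1)])
      (use hom in \<open>blast intro: bracket_swap_mem[OF null]\<close>)
qed

lemma core_bracket:
  assumes "b \<in> g" "x \<in> core g"
  shows "lbracket L b x \<in> core g" "lbracket L x b \<in> core g" "form b x = 0" "form x b = 0"
  using core_bracket_null[OF assms] null_ideal_core null_ideal_lam by auto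

lemma core_lam_zero:
  assumes "x \<in> core g" "lam x = 0"
  shows "x \<in> null_ideal g"
proof -
  have "lam (foldr (lbracket L) bs x) = 0" if bs: "bs \<in> lists (homogeneous g)" for bs
  proof (cases bs rule: rev_cases)
    case Nil
    then show ?thesis using assms by simp
  next
    case (snoc cs b)
    then have "b \<in> homogeneous g" "cs \<in> lists (homogeneous g)" using bs by auto
    then have "lbracket L b x \<in> null_ideal g" using assms by (auto simp: core_def)
    then show ?thesis using snoc \<open>cs \<in> _\<close> by (simp add: null_ideal_def)
  qed
  then show ?thesis using assms core_subset by (auto simp: null_ideal_def)
qed

text \<open>The homogeneous vectors of the core are orthogonal to all of \<open>g\<close>, so maximality applies to them.\<close>

lemma core_polarization: "polarization_on g h \<Longrightarrow> core g \<subseteq> h"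
proof
  fix x assume h: "polarization_on g h" and x: "x \<in> core g"
  obtain a b where ab: "a \<in> core g \<inter> lpart L 0" "b \<in> core g \<inter> lpart L 1" "x = a + b"
    using gradedD(3)[OF core_graded x] by blast
  have hom: "c \<in> h" if c: "c \<in> core g" "c \<in> lpart L d" for c d
    using polarization_onD(2,4)[OF h] core_bracket(4) c core_subset by blast
  have "a \<in> h" "b \<in> h" using ab hom by blast+
  then show "x \<in> h"
    unfolding ab(3) by (rule vs.subspace_add[OF gradedD(1)[OF subalgebraD(1)[OF polarization_onD(1)[OF h]]]])
qed

definition orth :: "'g \<Rightarrow> 'g set" where "orth y = {a \<in> g. form a y = 0}"

context
  fixes y d
  assumes y: "y \<in> g" "y \<in> lpart L d" and y_core: "\<And>b. b \<in> g \<Longrightarrow> lbracket L b y \<in> core g"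
begin

lemma core_bracket_left: "b \<in> g \<Longrightarrow> lbracket L y b \<in> core g"
proof -
  assume b: "b \<in> g"
  note cs = gradedD(1)[OF core_graded]
  obtain b0 b1 where b01: "b0 \<in> g \<inter> lpart L 0" "b1 \<in> g \<inter> lpart L 1" "b = b0 + b1"
    using gradedD(3)[OF gr b] by blast
  have "lbracket L y b0 \<in> core g" "lbracket L y b1 \<in> core g"
    using bracket_swap_mem[OF cs y(2)] b01 y_core by blast+
  moreover have "y \<in> lspace L" "b0 \<in> lspace L" "b1 \<in> lspace L" using lsp y b01 by auto
  ultimately show ?thesis unfolding b01(3) using vs.subspace_add[OF cs] by (simp add: bracket_add_right)
qed

lemma orth_subset: "orth y \<subseteq> g" by (auto simp: orth_def)

lemma orth_subspace: "vs.subspace (orth y)"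
proof -
  have "y \<in> lspace L" using y lsp by blast
  then show ?thesis
    using vs.subspace_0[OF sub] vs.subspace_add[OF sub] vs.subspace_scale[OF sub] lsp
    by (intro vs.subspaceI)
      (auto simp: orth_def form_add_left form_scale_left bracket_zero_left lam_zero)
qed

lemma orth_graded: "graded_subspace L (orth y)"
proof (rule gradedI[OF orth_subspace])
  fix x assume x: "x \<in> orth y"
  then have "x \<in> g" by (simp add: orth_def)
  from gradedD(3)[OF gr this] obtain a b
    where ab: "a \<in> g \<inter> lpart L 0" "b \<in> g \<inter> lpart L 1" "x = a + b" by blast
  have "form a y + form b y = 0" using x ab lsp y by (simp add: orth_def form_add_left)
  moreover have "form a y = 0 \<or> form b y = 0"
    using form_degree[OF _ y(2)] ab bit_exhaust[of d] by fastforce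
  ultimately have "form a y = 0" "form b y = 0" by auto
  then have "a \<in> orth y" "b \<in> orth y" using ab by (auto simp: orth_def)
  then show "\<exists>a\<in>orth y \<inter> lpart L 0. \<exists>b\<in>orth y \<inter> lpart L 1. x = a + b" using ab by blast
qed

text \<open>By the Jacobi identity, since a bracket with \<open>y\<close> lies in the core, where the form vanishes.\<close>

lemma bracket_in_orth:
  assumes "a \<in> g" "b \<in> g"
  shows "lbracket L a b \<in> orth y"
proof (rule bracket_extend[OF gr gr orth_subspace _ assms])
  fix a b e f assume a: "a \<in> g \<inter> lpart L e" and b: "b \<in> g \<inter> lpart L f"
  have c: "form a (lbracket L b y) = 0" "form b (lbracket L a y) = 0"
    using a b y_core core_bracket(3) by blast+
  have l: "lbracket L (lbracket L a b) y \<in> lspace L" "lbracket L b (lbracket L a y) \<in> lspace L"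
    using a b y closed lsp by blast+
  have "lam (lbracket L (lbracket L a b) y + lscale L (koszul e f) (lbracket L b (lbracket L a y))) = 0"
    using c(1) bracket_jacobi[of a e b f y d] a b y by simp
  then have "form (lbracket L a b) y = 0"
    using l c(2) vs.subspace_scale[OF lspace_subspace l(2)] by (simp add: lam_add lam_scale)
  then show "lbracket L a b \<in> orth y" using closed a b by (simp add: orth_def)
qed

lemma orth_subalgebra: "lie_subalgebra L (orth y)"
  unfolding lie_subalgebra_def using orth_graded bracket_in_orth orth_subset by blast

lemma core_orth: "core g \<subseteq> orth y"
  using core_bracket(4)[OF y(1)] core_subset by (auto simp: orth_def)

end

end

end

locale nilpotent_functional = lie_functional L lam
  for L :: "('k::{alg_closed_field, field_char_0}, 'g::ab_group_add) super_lie" and lam +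
  assumes nilpotent: "nilpotent_super_lie L"
begin

text \<open>If the vector \<open>y\<close> that nilpotency provides is not isotropic, then \<open>g\<close> is spanned by \<open>y\<close> and its
  orthogonal. Applying nilpotency to the orthogonal gives a second such vector \<open>a\<close>, which is orthogonal
  to \<open>y\<close>, and some combination of \<open>y\<close> and \<open>a\<close> is isotropic. This only fails if the orthogonal of
  \<open>y\<close> is the core, and then every isotropic subspace lies in the core.\<close>

lemma exists_isotropic_near_center:
  assumes g: "lie_subalgebra L g" and h: "polarization_on g h" and h': "polarization_on g h'"
    and ne: "h \<noteq> h'"
  shows "\<exists>d y. y \<in> g \<and> y \<in> lpart L d \<and> (\<forall>b\<in>g. lbracket L b y \<in> core g) \<and>
    (\<exists>b\<in>g. form b y \<noteq> 0) \<and> form y y = 0"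
proof -
  note gr = subalgebraD(1)[OF g] and closed = subalgebraD(2)[OF g]
  note sub = gradedD(1)[OF gr] and lsp = gradedD(2)[OF gr]
  note cs = gradedD(1)[OF core_graded[OF g]]
  have nonzero: "\<exists>b\<in>g. form b y \<noteq> 0" if yc: "y \<in> g" "y \<notin> core g" "\<And>b. b \<in> g \<Longrightarrow> lbracket L b y \<in> core g" for y
  proof (rule ccontr)
    assume "\<not> ?thesis"
    then have "lbracket L b y \<in> null_ideal g" if "b \<in> homogeneous g" for b
      using core_lam_zero[OF g] that yc(3) by (auto simp: homogeneous_def)
    then show False using yc(1,2) by (simp add: core_def)
  qed
  have odd: "e = 1" if "v \<in> lpart L e" "form v v \<noteq> 0" for v e
  proof (rule ccontr)
    assume "e \<noteq> 1"
    then have "e = 0" using bit_exhaust by blast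
    then have "form v v = - form v v" using form_antisym[OF that(1) that(1)] by (simp add: koszul_def)
    then have "2 * form v v = 0" unfolding mult_2 using eq_neg_iff_add_eq_0 by blast
    then show False using that(2) by simp
  qed
  have "core g \<noteq> g"
  proof
    assume "core g = g"
    then have "k = g" if "polarization_on g k" for k
      using core_polarization[OF g that] polarization_onD(2)[OF that] by blast
    then show False using h h' ne by blast
  qed
  then obtain d y where y: "y \<in> g" "y \<in> lpart L d" "y \<notin> core g" "\<And>b. b \<in> g \<Longrightarrow> lbracket L b y \<in> core g"
    using exists_central_mod_ideal[OF nilpotent g core_graded[OF g] core_subset[OF g] \<open>core g \<noteq> g\<close> core_bracket(1)[OF g]]
    by blast
  show ?thesis
  proof (cases "form y y = 0")
    case True
    then show ?thesis using y nonzero[OF y(1,3,4)] by blast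
  next
    case False
    let ?g' = "orth g y"
    note g' = orth_subalgebra[OF g y(1,2,4)]
    have split: "b - lscale L (form b y / form y y) y \<in> ?g'" if b: "b \<in> g" for b
    proof -
      let ?t = "form b y / form y y"
      have "b - lscale L ?t y \<in> g" using b y vs.subspace_diff[OF sub] vs.subspace_scale[OF sub] by blast
      moreover have "form (b - lscale L ?t y + lscale L ?t y) y = form (b - lscale L ?t y) y + ?t * form y y"
        using calculation y lsp vs.subspace_scale[OF sub] by (simp only: form_add_left form_scale_left)
      ultimately show ?thesis using False by (simp add: orth_def[OF g])
    qed
    have core_eq: "core g \<noteq> ?g'"
    proof
      assume eq: "core g = ?g'"
      have "k = core g" if k: "polarization_on g k" for k
      proof
        show "core g \<subseteq> k" using core_polarization[OF g k] .
        show "k \<subseteq> core g"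
        proof
          fix s assume s: "s \<in> k"
          then have sg: "s \<in> g" using polarization_onD(2)[OF k] by blast
          define t where "t = form s y / form y y"
          define c where "c = s - lscale L t y"
          have c: "c \<in> core g" unfolding c_def t_def using split[OF sg] eq by simp
          have s_eq: "s = c + lscale L t y" by (simp add: c_def)
          have ty: "lscale L t y \<in> g" using vs.subspace_scale[OF sub y(1)] .
          have "form s s = form c s + form (lscale L t y) s"
            unfolding s_eq using c ty sg core_subset[OF g] lsp vs.subspace_add[OF sub]
            by (intro form_add_left) auto
          also have "form c s = 0" using core_bracket(4)[OF g sg c] .
          also have "form (lscale L t y) s = t * form y s" using y sg lsp by (simp add: form_scale_left)
          also have "form y s = form y c + form y (lscale L t y)"
            unfolding s_eq using c ty y core_subset[OF g] lsp by (intro form_add_right) auto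
          also have "form y c = 0" using core_bracket(3)[OF g y(1) c] .
          also have "form y (lscale L t y) = t * form y y" using y lsp by (simp add: form_scale_right)
          finally have "t * t * form y y = 0" using polarization_onD(3)[OF k s s] by simp
          then have "t = 0" using False by simp
          then show "s \<in> core g" using s_eq c by simp
        qed
      qed
      then show False using h h' ne by blast
    qed
    have "lbracket L b x \<in> core g" if "b \<in> ?g'" "x \<in> core g" for b x
      using that core_bracket(1)[OF g] orth_subset[OF g y(1,2,4)] by blast
    from exists_central_mod_ideal[OF nilpotent g' core_graded[OF g] core_orth[OF g y(1,2,4)] core_eq this]
    obtain e a where a: "a \<in> ?g'" "a \<in> lpart L e" "a \<notin> core g" "\<And>b. b \<in> ?g' \<Longrightarrow> lbracket L b a \<in> core g"
      by blast
    have ag: "a \<in> g" "form a y = 0" using a(1) by (auto simp: orth_def[OF g])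
    have ya: "form y a = 0" using form_antisym[OF y(2) a(2)] ag(2) by simp
    have a_core: "lbracket L b a \<in> core g" if b: "b \<in> g" for b
    proof -
      define t where "t = form b y / form y y"
      have b': "b - lscale L t y \<in> ?g'" using split[OF b] t_def by simp
      have "lbracket L y a \<in> core g" using core_bracket_left[OF g y(1,2,4) ag(1)] .
      then have "lbracket L (b - lscale L t y) a + lscale L t (lbracket L y a) \<in> core g"
        using a(4)[OF b'] vs.subspace_add[OF cs] vs.subspace_scale[OF cs] by blast
      also have "lbracket L (b - lscale L t y) a + lscale L t (lbracket L y a)
          = lbracket L (b - lscale L t y + lscale L t y) a"
        using b' y ag lsp orth_subset[OF g y(1,2,4)] vs.subspace_scale[OF sub y(1)]
        by (subst bracket_add_left) (auto simp: bracket_scale_left)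
      finally show ?thesis by simp
    qed
    show ?thesis
    proof (cases "form a a = 0")
      case True
      then show ?thesis using ag(1) a(2) a_core nonzero[OF ag(1) a(3) a_core] by blast
    next
      case a_ne: False
      have de: "d = 1" "e = 1" using odd[OF y(2) False] odd[OF a(2) a_ne] by auto
      \<comment> \<open>chosen so that \<open>y + w a\<close> is isotropic; the mixed terms vanish\<close>
      obtain w where w: "w ^ 2 = - form y y / form a a" using nth_root_exists[of 2] by auto
      have wa: "lscale L w a \<in> g" using vs.subspace_scale[OF sub ag(1)] .
      let ?v = "y + lscale L w a"
      have l: "y \<in> lspace L" "a \<in> lspace L" "lscale L w a \<in> lspace L" "?v \<in> lspace L"
        using y ag wa lsp vs.subspace_add[OF sub] by auto
      have "?v \<in> g" using vs.subspace_add[OF sub y(1) wa] .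
      moreover have "?v \<in> lpart L 1"
        using y(2) a(2) de vs.subspace_add[OF part_subspace] vs.subspace_scale[OF part_subspace] by blast
      moreover have "lbracket L b ?v \<in> core g" if "b \<in> g" for b
        using that l lsp[OF that] y(4)[OF that] a_core[OF that] vs.subspace_add[OF cs] vs.subspace_scale[OF cs]
        by (simp add: bracket_add_right bracket_scale_right)
      moreover have "form ?v ?v = form y y + w ^ 2 * form a a"
        using l ya ag(2) by (simp add: form_add_left form_add_right form_scale_left form_scale_right power2_eq_square)
      then have "form ?v ?v = 0" using w a_ne by simp
      moreover have "form y ?v = form y y" using l ya by (simp add: form_add_right form_scale_right)
      then have "\<exists>b\<in>g. form b ?v \<noteq> 0" using False y(1) by force
      ultimately show ?thesis by blast
    qed
  qed
qed

end

section \<open>Moving a polarization into the orthogonal of a vector\<close>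

context lie_functional
begin

context
  fixes g y d h x
  assumes g: "lie_subalgebra L g" and y: "y \<in> g" "y \<in> lpart L d"
    and y_core: "\<And>b. b \<in> g \<Longrightarrow> lbracket L b y \<in> core g" and yy: "form y y = 0"
    and h: "polarization_on g h" and x: "x \<in> h" "x \<in> lpart L d" "form x y = 1"
begin

private lemmas g_gr = subalgebraD(1)[OF g]
private lemmas g_sub = gradedD(1)[OF g_gr]
private lemmas g_lsp = gradedD(2)[OF g_gr]
private lemmas hD = polarization_onD[OF h]
private lemmas h_sub = gradedD(1)[OF subalgebraD(1)[OF hD(1)]]

lemma polarization_split:
  assumes "t \<in> h"
  shows "t - lscale L (form t y) x \<in> h \<inter> orth g y"
proof -
  have t: "t \<in> g" "x \<in> g" using assms x hD(2) by auto
  let ?u = "t - lscale L (form t y) x"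
  have u: "?u \<in> h" using assms x vs.subspace_diff[OF h_sub] vs.subspace_scale[OF h_sub] by blast
  have "form (?u + lscale L (form t y) x) y = form ?u y + form t y * form x y"
    using u t y g_lsp hD(2) vs.subspace_scale[OF g_sub] by (subst form_add_left) (auto simp: form_scale_left)
  then show ?thesis using u x(3) hD(2) by (auto simp: orth_def[OF g])
qed

lemma polarization_decompose: "h = {v. \<exists>c. v - lscale L c x \<in> h \<inter> orth g y}"
proof
  show "h \<subseteq> {v. \<exists>c. v - lscale L c x \<in> h \<inter> orth g y}" using polarization_split by blast
  show "{v. \<exists>c. v - lscale L c x \<in> h \<inter> orth g y} \<subseteq> h"
  proof
    fix v assume "v \<in> {v. \<exists>c. v - lscale L c x \<in> h \<inter> orth g y}"
    then obtain c where "v - lscale L c x \<in> h" by blast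
    then have "(v - lscale L c x) + lscale L c x \<in> h"
      using x vs.subspace_scale[OF h_sub] vs.subspace_add[OF h_sub] by blast
    then show "v \<in> h" by simp
  qed
qed

lemma inter_orth_graded: "graded_subspace L (h \<inter> orth g y)"
proof (rule gradedI)
  show "vs.subspace (h \<inter> orth g y)"
    using h_sub orth_subspace[OF g y y_core] by (rule vs.subspace_inter)
  fix v assume v: "v \<in> h \<inter> orth g y"
  obtain a b where ab: "a \<in> h \<inter> lpart L 0" "b \<in> h \<inter> lpart L 1" "v = a + b"
    using gradedD(3)[OF subalgebraD(1)[OF hD(1)]] v by blast
  then have "a \<in> orth g y" "b \<in> orth g y"
    using graded_components[OF orth_graded[OF g y y_core], of a b] v by auto
  then show "\<exists>a\<in>h \<inter> orth g y \<inter> lpart L 0. \<exists>b\<in>h \<inter> orth g y \<inter> lpart L 1. v = a + b"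
    using ab by blast
qed

lemma core_inter_orth: "core g \<subseteq> h \<inter> orth g y"
  using core_polarization[OF g h] core_orth[OF g y y_core] by blast

text \<open>Orthogonality from the other side, which is equivalent on a graded subspace.\<close>

lemma form_y_orth:
  assumes "t \<in> orth g y"
  shows "form y t = 0"
proof -
  obtain a b where ab: "a \<in> orth g y \<inter> lpart L 0" "b \<in> orth g y \<inter> lpart L 1" "t = a + b"
    using gradedD(3)[OF orth_graded[OF g y y_core] assms] by blast
  have "form y a = 0" "form y b = 0"
    using form_antisym[OF y(2), of a 0] form_antisym[OF y(2), of b 1] ab by (auto simp: orth_def[OF g])
  moreover have "y \<in> lspace L" "a \<in> lspace L" "b \<in> lspace L"
    using y ab g_lsp by (auto simp: orth_def[OF g])
  ultimately show ?thesis unfolding ab(3) by (simp add: form_add_right)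
qed

lemma moved_polarization:
  defines "h\<^sub>1 \<equiv> {v. \<exists>c. v - lscale L c y \<in> h \<inter> orth g y}"
  shows "polarization_on g h\<^sub>1" "h\<^sub>1 \<subseteq> orth g y"
proof -
  let ?h0 = "h \<inter> orth g y"
  note s0 = gradedD(1)[OF inter_orth_graded]
  have xg: "x \<in> g" using x hD(2) by blast
  have elim: "\<exists>u c. u \<in> ?h0 \<and> v = u + lscale L c y" if v: "v \<in> h\<^sub>1" for v
  proof -
    obtain c where "v - lscale L c y \<in> ?h0" using v unfolding h\<^sub>1_def by blast
    then show ?thesis by (intro exI[of _ "v - lscale L c y"] exI[of _ c]) simp
  qed
  have intro: "u + lscale L c y \<in> h\<^sub>1" if "u \<in> ?h0" for u c
    unfolding h\<^sub>1_def using that by (auto intro!: exI[of _ c])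
  have y_orth: "y \<in> orth g y" using y yy by (simp add: orth_def[OF g])
  show h1_orth: "h\<^sub>1 \<subseteq> orth g y"
  proof
    fix v assume "v \<in> h\<^sub>1"
    from elim[OF this] obtain u c where "u \<in> ?h0" "v = u + lscale L c y" by blast
    then show "v \<in> orth g y"
      using y_orth vs.subspace_add[OF orth_subspace[OF g y y_core]] vs.subspace_scale[OF orth_subspace[OF g y y_core]]
      by blast
  qed
  have graded: "graded_subspace L h\<^sub>1"
    unfolding h\<^sub>1_def by (rule graded_adjoin[OF inter_orth_graded y(2)])
  have prods: "lbracket L v v' \<in> h\<^sub>1 \<and> form v v' = 0" if vv: "v \<in> h\<^sub>1" "v' \<in> h\<^sub>1" for v v'
  proof -
    obtain u c where u: "u \<in> ?h0" "v = u + lscale L c y" using elim[OF vv(1)] by blast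
    obtain u' c' where u': "u' \<in> ?h0" "v' = u' + lscale L c' y" using elim[OF vv(2)] by blast
    have m: "u \<in> g" "u' \<in> g" "y \<in> g" "lscale L c y \<in> g" "lscale L c' y \<in> g"
      using u u' y vs.subspace_scale[OF g_sub] by (auto simp: orth_def[OF g])
    then have l: "u \<in> lspace L" "u' \<in> lspace L" "y \<in> lspace L" "lscale L c y \<in> lspace L"
      "lscale L c' y \<in> lspace L" "u' + lscale L c' y \<in> lspace L"
      using g_lsp vs.subspace_add[OF g_sub] by blast+
    have eq: "lbracket L v v' = (lbracket L u u' + lscale L c' (lbracket L u y)) +
        (lscale L c (lbracket L y u') + lscale L c (lscale L c' (lbracket L y y)))"
      unfolding u(2) u'(2) using l
      by (simp add: bracket_add_left bracket_add_right bracket_scale_left bracket_scale_right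
          vs.scale_right_distrib bracket_mem)
    have "lbracket L u u' \<in> ?h0"
      using u u' subalgebraD(2)[OF hD(1)] bracket_in_orth[OF g y y_core] m by blast
    moreover have "lbracket L u y \<in> ?h0" "lbracket L y u' \<in> ?h0" "lbracket L y y \<in> ?h0"
      using y_core core_bracket_left[OF g y y_core] m core_inter_orth by blast+
    ultimately have "lbracket L v v' \<in> ?h0" unfolding eq
      by (intro vs.subspace_add[OF s0] vs.subspace_scale[OF s0])
    moreover have "form v v' = (form u u' + c' * form u y) + (c * form y u' + c * (c' * form y y))"
      unfolding u(2) u'(2) using l
      by (simp add: form_add_left form_add_right form_scale_left form_scale_right algebra_simps)
    then have "form v v' = 0"
      using hD(3)[of u u'] u u' yy form_y_orth[of u'] by (auto simp: orth_def[OF g])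
    ultimately show ?thesis using intro[of "lbracket L v v'" 0] by simp
  qed
  have max: "s \<in> h\<^sub>1" if s: "s \<in> g" "s \<in> lpart L e" "\<And>t. t \<in> h\<^sub>1 \<Longrightarrow> form s t = 0" "form s s = 0" for s e
  proof -
    have "y \<in> h\<^sub>1" using intro[of 0 1] vs.subspace_0[OF s0] by simp
    then have sy: "form s y = 0" using s(3) by blast
    then have s_orth: "s \<in> orth g y" using s(1) by (simp add: orth_def[OF g])
    have yx: "form y x \<noteq> 0" using form_antisym[OF y(2) x(2)] x(3) by (simp add: koszul_def)
    \<comment> \<open>subtracting \<open>c y\<close> makes \<open>s\<close> orthogonal to \<open>x\<close> as well; \<open>c\<close> is zero if \<open>s\<close> and \<open>y\<close> differ in parity\<close>
    define c where "c = form s x / form y x"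
    define s' where "s' = s - lscale L c y"
    have m: "s \<in> lspace L" "lscale L c y \<in> lspace L" "y \<in> lspace L" "lscale L c y \<in> g" "s' \<in> g"
      using s y g_lsp vs.subspace_scale[OF g_sub] vs.subspace_diff[OF g_sub] unfolding s'_def by blast+
    have s_eq: "s = s' + lscale L c y" by (simp add: s'_def)
    have s'l: "s' \<in> lspace L" using m g_lsp by blast
    have fl: "form s' t = form s t - c * form y t" if "t \<in> lspace L" for t
      using form_add_left[OF s'l m(2) that] form_scale_left[OF m(3) that] s_eq by simp
    have s'_part: "s' \<in> lpart L e"
    proof (cases "e = d")
      case True
      then show ?thesis unfolding s'_def
        using s y vs.subspace_diff[OF part_subspace] vs.subspace_scale[OF part_subspace] by blast
    next
      case False
      then have "c = 0" using form_degree[OF s(2) x(2)] by (simp add: c_def)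
      then show ?thesis using s by (simp add: s'_def)
    qed
    have ys: "form y s = 0" using form_y_orth[OF s_orth] .
    have form_s'_h: "form s' t = 0" if t: "t \<in> h" for t
    proof -
      define t0 where "t0 = t - lscale L (form t y) x"
      have t0: "t0 \<in> ?h0" unfolding t0_def using polarization_split[OF t] .
      have l: "t0 \<in> lspace L" "x \<in> lspace L" "lscale L (form t y) x \<in> lspace L"
        using t0 g_lsp xg vs.subspace_scale[OF g_sub] by (auto simp: orth_def[OF g])
      have "form s' t0 = 0"
        using fl[OF l(1)] s(3)[of t0] intro[OF t0, of 0] form_y_orth[of t0] t0 by auto
      moreover have "form s' x = 0" using fl[OF l(2)] yx by (simp add: c_def)
      moreover have "form s' (t0 + lscale L (form t y) x) = form s' t0 + form t y * form s' x"
        using l s'l by (simp add: form_add_right form_scale_right)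
      ultimately show ?thesis by (simp add: t0_def)
    qed
    have "form s' (s' + lscale L c y) = form s' s' + c * form s' y"
      using s'l m by (simp add: form_add_right form_scale_right)
    moreover have s'y: "form s' y = 0" using fl[OF m(3)] sy yy by simp
    moreover have "form s' s = 0" using fl[OF m(1)] s(4) ys by simp
    ultimately have "form s' s' = 0" using s_eq by simp
    then have "s' \<in> h" using hD(4)[OF m(5) s'_part] form_s'_h by blast
    then have "s' \<in> ?h0" using s'y m(5) by (simp add: orth_def[OF g])
    then show ?thesis using intro[of s' c] s_eq by simp
  qed
  have sub_g: "h\<^sub>1 \<subseteq> g" using h1_orth orth_subset[OF g y y_core] by blast
  have "lie_subalgebra L h\<^sub>1" unfolding lie_subalgebra_def using graded prods by blast
  then show "polarization_on g h\<^sub>1"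
    unfolding polarization_on_def using prods max sub_g by blast
qed

end

end

section \<open>Size of a subspace\<close>

context super_lie_algebra
begin

definition rank_le where
  "rank_le S n \<longleftrightarrow> (\<forall>B. vs.independent B \<and> B \<subseteq> S \<longrightarrow> finite B \<and> card B \<le> n)"

lemma rank_le_exists: "\<exists>n. rank_le (lspace L) n"
proof -
  obtain B where "finite B" "lspace L = vs.span B" using finite_dimensional by blast
  then show ?thesis using vs.independent_span_bound unfolding rank_le_def by blast
qed

text \<open>A vector outside of \<open>T\<close> extends every independent subset of \<open>T\<close>. So the bound is a measure that
  decreases along proper subspaces.\<close>

lemma rank_le_psubset:
  assumes "rank_le S n" "vs.subspace T" "T \<subseteq> S" "x \<in> S" "x \<notin> T"
  obtains m where "m < n" "rank_le T m"
proof -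
  have bound: "finite B \<and> Suc (card B) \<le> n" if B: "vs.independent B" "B \<subseteq> T" for B
  proof -
    have x: "x \<notin> vs.span B" using vs.span_minimal[OF B(2) assms(2)] assms(5) by blast
    then have "vs.independent (insert x B)" using B(1) vs.independent_insertI by blast
    then have "finite (insert x B)" "card (insert x B) \<le> n"
      using assms B unfolding rank_le_def by blast+
    moreover have "x \<notin> B" using x vs.span_base by blast
    ultimately show ?thesis by simp
  qed
  have "0 < n" using bound[of "{}"] vs.independent_empty by simp
  moreover have "rank_le T (n - 1)" unfolding rank_le_def using bound by fastforce
  ultimately show thesis using that[of "n - 1"] by simp
qed

end

section \<open>Reduction to a subalgebra\<close>

lemma (in two_sided_ideal_of) power_expansion:
  assumes u: "u \<in> left_ideal_gen {x ^ i | i. i \<in> I} J T"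
    and T: "0 \<in> T" "\<And>s t. s \<in> T \<Longrightarrow> t \<in> T \<Longrightarrow> s + t \<in> T"
  shows "\<exists>n c. (\<forall>i. c i \<in> T) \<and> (\<forall>i. i \<notin> I \<or> n \<le> i \<longrightarrow> c i = 0) \<and> u - (\<Sum>i<n. x ^ i * c i) \<in> J"
  using u
proof induction
  case (base u)
  then show ?case using T(1) by (intro exI[of _ 0] exI[of _ "\<lambda>_. 0"]) simp
next
  case (gen a t)
  then obtain i where i: "a = x ^ i" "i \<in> I" by blast
  let ?c = "\<lambda>j. if j = i then t else 0"
  have "(\<Sum>j<Suc i. x ^ j * ?c j) = x ^ i * t" by (simp add: if_distrib sum.delta cong: if_cong)
  then show ?case using gen T(1) i zero_ideal by (intro exI[of _ "Suc i"] exI[of _ ?c]) auto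
next
  case (add u v)
  from add.IH obtain m b n c where
    b: "\<forall>i. b i \<in> T" "\<forall>i. i \<notin> I \<or> m \<le> i \<longrightarrow> b i = 0" "u - (\<Sum>i<m. x ^ i * b i) \<in> J" and
    c: "\<forall>i. c i \<in> T" "\<forall>i. i \<notin> I \<or> n \<le> i \<longrightarrow> c i = 0" "v - (\<Sum>i<n. x ^ i * c i) \<in> J" by blast
  let ?k = "max m n"
  have "(\<Sum>i<m. x ^ i * b i) = (\<Sum>i<?k. x ^ i * b i)" "(\<Sum>i<n. x ^ i * c i) = (\<Sum>i<?k. x ^ i * c i)"
    by (intro sum.mono_neutral_left ballI; use b(2) c(2) in simp)+
  then have "(\<Sum>i<?k. x ^ i * (b i + c i)) = (\<Sum>i<m. x ^ i * b i) + (\<Sum>i<n. x ^ i * c i)"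
    by (simp add: distrib_left sum.distrib)
  then have eq: "u + v - (\<Sum>i<?k. x ^ i * (b i + c i))
      = (u - (\<Sum>i<m. x ^ i * b i)) + (v - (\<Sum>i<n. x ^ i * c i))" by (simp add: algebra_simps)
  then have "u + v - (\<Sum>i<?k. x ^ i * (b i + c i)) \<in> J"
    by (subst eq) (rule add_ideal[OF b(3) c(3)])
  then show ?case using b(1,2) c(1,2) T(2)
    by (intro exI[of _ ?k] exI[of _ "\<lambda>i. b i + c i"]) auto
qed

text \<open>Modulo \<open>J\<close> every element has an expansion \<open>\<Sum>x\<^sup>i c\<^sub>i\<close> with coefficients in the subring \<open>A'\<close> that
  are unique modulo \<open>J\<close>, and those of elements of \<open>K\<close> can be taken in \<open>K'\<close>. Right multiplication by \<open>b\<close> in \<open>A'\<close> acts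
  on the coefficients. Hence the coefficients of an element with \<open>u A \<subseteq> K\<close> satisfy the same condition for
  \<open>A'\<close> and \<open>K'\<close>. This replaces the freeness of \<open>U(g)\<close> over \<open>U(g')\<close>.\<close>

lemma (in two_sided_ideal_of) annihilator_reduction:
  assumes A': "unital_subring A'" "A' \<subseteq> A" and x: "x \<in> A"
    and span: "A \<subseteq> left_ideal_gen {x ^ i | i. i \<in> I} J A'"
    and indep: "\<And>n c i. (\<And>i. c i \<in> A') \<Longrightarrow> (\<And>i. i \<notin> I \<Longrightarrow> c i = 0) \<Longrightarrow>
      (\<Sum>i<n. x ^ i * c i) \<in> J \<Longrightarrow> i < n \<Longrightarrow> c i \<in> J"
    and K': "left_ideal_of A' K'" "J \<inter> A' \<subseteq> K'"
    and K: "K \<subseteq> left_ideal_gen {x ^ i | i. i \<in> I} J K'"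
    and M: "left_ideal_of A M" "J \<subseteq> M"
    and ann: "\<And>a. a \<in> A' \<Longrightarrow> (\<And>b. b \<in> A' \<Longrightarrow> a * b \<in> K') \<Longrightarrow> a \<in> M"
    and u: "u \<in> A" "\<And>b. b \<in> A \<Longrightarrow> u * b \<in> K"
  shows "u \<in> M"
proof -
  interpret A': unital_subring A' by (rule A'(1))
  interpret K': left_ideal_of A' K' by (rule K'(1))
  interpret M: left_ideal_of A M by (rule M(1))
  obtain n c where c: "\<And>i. c i \<in> A'" "\<And>i. i \<notin> I \<or> n \<le> i \<Longrightarrow> c i = 0" "u - (\<Sum>i<n. x ^ i * c i) \<in> J"
    using power_expansion[OF subsetD[OF span u(1)] A'.zero_mem A'.add_mem] by blast
  have "c i * b \<in> K'" if b: "b \<in> A'" for i b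
  proof -
    have "u * b \<in> left_ideal_gen {x ^ i | i. i \<in> I} J K'" using u(2) b A'(2) K by blast
    then obtain m k where k: "\<And>i. k i \<in> K'" "\<And>i. i \<notin> I \<or> m \<le> i \<Longrightarrow> k i = 0"
      "u * b - (\<Sum>i<m. x ^ i * k i) \<in> J"
      using power_expansion[OF _ K'.zero_ideal K'.add_ideal] by blast
    let ?N = "Suc (i + max m n)"
    have kN: "(\<Sum>i<m. x ^ i * k i) = (\<Sum>i<?N. x ^ i * k i)"
      using k(2) by (intro sum.mono_neutral_left) auto
    have cN: "(\<Sum>i<n. x ^ i * c i) = (\<Sum>i<?N. x ^ i * c i)"
      using c(2) by (intro sum.mono_neutral_left) auto
    have "(u - (\<Sum>i<n. x ^ i * c i)) * b \<in> J" using c(3) rmult_ideal b A'(2) by blast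
    then have "(u * b - (\<Sum>i<m. x ^ i * k i)) - (u - (\<Sum>i<n. x ^ i * c i)) * b \<in> J"
      using diff_ideal k(3) by blast
    also have "(u * b - (\<Sum>i<m. x ^ i * k i)) - (u - (\<Sum>i<n. x ^ i * c i)) * b
        = (\<Sum>i<?N. x ^ i * (c i * b - k i))"
      unfolding kN cN
      by (simp only: left_diff_distrib right_diff_distrib sum_distrib_right sum_subtractf mult.assoc) simp
    finally have "(\<Sum>i<?N. x ^ i * (c i * b - k i)) \<in> J" .
    moreover have "c i * b - k i \<in> A'" for i
      using c(1) b k(1) K'.subset by (auto intro!: A'.diff_mem A'.mult_mem)
    moreover have "c i * b - k i = 0" if "i \<notin> I" for i using c(2) k(2) that by simp
    ultimately have "c i * b - k i \<in> J" using indep[of "\<lambda>i. c i * b - k i" ?N i] by simp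
    then have "c i * b - k i \<in> K'" using K'(2) \<open>c i * b - k i \<in> A'\<close> by blast
    then show ?thesis using K'.mem_cong k(1) by blast
  qed
  then have "c i \<in> M" for i using ann c(1) by blast
  then have "(\<Sum>i<n. x ^ i * c i) \<in> M" using x by (intro M.sum_ideal M.lmult_ideal power_mem)
  then show ?thesis using M.mem_cong c(3) M(2) by blast
qed

section \<open>Commutation with a vector near the center\<close>

context env_on
begin

lemma half_mem:
  fixes p :: "'g fword \<Rightarrow>\<^sub>0 'k"
  assumes "left_ideal_of (words_on g) J" "p + p \<in> J"
  shows "p \<in> J"
proof -
  obtain c :: "'g fword \<Rightarrow>\<^sub>0 'k" where c: "c \<in> words_on g" "c * of_nat (Suc 1) = 1"
    using words_on_inverse_nat by blast
  have "c * (p + p) \<in> J" using left_ideal_of.lmult_ideal[OF assms(1) c(1) assms(2)] .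
  also have "c * (p + p) = (c * of_nat (Suc 1)) * p"
    by (simp only: of_nat_Suc of_nat_1 distrib_left distrib_right mult_1_right mult_1_left)
  finally show ?thesis using c(2) by simp
qed

lemma gen_comm_even:
  assumes "x \<in> g \<inter> lpart L 0" "y \<in> g \<inter> lpart L e"
  shows "fgen x * fgen y - fgen y * fgen x - fgen (lbracket L x y) \<in> D"
  using gen_comm[OF assms] by (simp add: koszul_def)

lemma gen_comm_odd:
  assumes "x \<in> g \<inter> lpart L 1" "y \<in> g \<inter> lpart L 1"
  shows "fgen x * fgen y + fgen y * fgen x - fgen (lbracket L x y) \<in> D"
  using gen_comm[OF assms] by (simp add: koszul_def single_uminus)

text \<open>For even \<open>x\<close> there is no sign, so the relation extends linearly from homogeneous \<open>y\<close>.\<close>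

lemma gen_comm_even':
  assumes x: "x \<in> g \<inter> lpart L 0" and y: "y \<in> g"
  shows "fgen x * fgen y - fgen y * fgen x - fgen (lbracket L x y) \<in> D"
proof -
  obtain a b where ab: "a \<in> g \<inter> lpart L 0" "b \<in> g \<inter> lpart L 1" "y = a + b"
    using gradedD(3)[OF g_graded y] by blast
  let ?X = "fgen x" and ?A = "fgen a" and ?B = "fgen b" and ?Y = "fgen (a + b)"
  have s: "?Y - (?A + ?B) \<in> D" using gen_add ab by blast
  have "lbracket L x a \<in> g" "lbracket L x b \<in> g" using subalgebraD(2)[OF subalgebra] x ab by blast+
  then have t: "fgen (lbracket L x a + lbracket L x b) - (fgen (lbracket L x a) + fgen (lbracket L x b)) \<in> D"
    by (rule gen_add)
  have X: "?X \<in> words_on g" using x fgen_mem by blast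
  have "(?X * ?A - ?A * ?X - fgen (lbracket L x a)) + (?X * ?B - ?B * ?X - fgen (lbracket L x b))
      + (?X * (?Y - (?A + ?B)) - (?Y - (?A + ?B)) * ?X)
      - (fgen (lbracket L x a + lbracket L x b) - (fgen (lbracket L x a) + fgen (lbracket L x b))) \<in> D"
    by (intro D.diff_ideal D.add_ideal gen_comm_even[OF x ab(1)] gen_comm_even[OF x ab(2)]
        D.lmult_ideal[OF X s] D.rmult_ideal[OF s X] t)
  moreover have "lbracket L x (a + b) = lbracket L x a + lbracket L x b"
    using x ab g_lspace by (intro bracket_add_right) auto
  ultimately show ?thesis unfolding ab(3) by (simp add: algebra_simps)
qed

text \<open>For letters this is the nilpotency of \<open>L\<close>, and products follow by the Leibniz rule.\<close>

lemma commutator_nilpotent: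
  assumes nil: "nilpotent_super_lie L" and y: "y \<in> g \<inter> lpart L 0" and w: "w \<in> words_on g"
  shows "\<exists>m. (commutator (fgen y) ^^ m) w \<in> D"
  using w
proof (induction rule: words_on_induct)
  let ?Y = "fgen y :: 'g fword \<Rightarrow>\<^sub>0 'k"
  let ?c = "commutator ?Y"
  have Y: "?Y \<in> words_on g" using y fgen_mem by blast
  have com: "?c p \<in> D" if "p \<in> D" for p
    using D.diff_ideal[OF D.lmult_ideal[OF Y that] D.rmult_ideal[OF that Y]] .
  have pow: "(?c ^^ m) p \<in> D" if "p \<in> D" for p m
    using that by (induction m) (auto intro: com)
  have pow_add: "(?c ^^ (n + m)) p \<in> D" if "(?c ^^ m) p \<in> D" for p m n
    using pow[OF that] by (simp only: funpow_add o_apply)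
  {
    case (const c)
    have "(?c ^^ 1) (fconst c) = 0" by (simp add: fconst_central)
    then have "(?c ^^ 1) (fconst c) \<in> D" by (simp only: D.zero_ideal)
    then show ?case by blast
  next
    case (add p q)
    then obtain m n where mn: "(?c ^^ m) p \<in> D" "(?c ^^ n) q \<in> D" by blast
    have lin: "(?c ^^ k) (p + q) = (?c ^^ k) p + (?c ^^ k) q" for k
      by (induction k) (auto simp: algebra_simps)
    have "(?c ^^ (n + m)) (p + q) \<in> D"
      unfolding lin using pow_add[OF mn(1), of n] pow_add[OF mn(2), of m]
      by (intro D.add_ideal) (simp_all only: add.commute)
    then show ?case by blast
  next
    case (gen x p)
    have *: "(?c ^^ m) (fgen x) - fgen ((lbracket L y ^^ m) x) \<in> D \<and>
      (lbracket L y ^^ m) x \<in> g \<and> (lbracket L y ^^ m) x \<in> lower_central L m" for m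
    proof (induction m)
      case 0
      then show ?case using D.zero_ideal gen(1) g_lspace by simp
    next
      case (Suc m)
      let ?b = "(lbracket L y ^^ m) x"
      have b: "?b \<in> g" "?b \<in> lower_central L m" using Suc by auto
      have "?c ((?c ^^ m) (fgen x) - fgen ?b) + (?c (fgen ?b) - fgen (lbracket L y ?b)) \<in> D"
        using com Suc gen_comm_even'[OF y b(1)] by (intro D.add_ideal) auto
      moreover have "?c ((?c ^^ m) (fgen x) - fgen ?b) + (?c (fgen ?b) - fgen (lbracket L y ?b))
          = ?c ((?c ^^ m) (fgen x)) - fgen (lbracket L y ?b)"
        by (simp add: left_diff_distrib right_diff_distrib)
      moreover have "lbracket L y ?b \<in> g" using subalgebraD(2)[OF subalgebra] y b by blast
      moreover have "lbracket L y ?b \<in> lower_central L (Suc m)"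
        unfolding lower_central.simps bracket_space_def using y b g_lspace by (blast intro: vs.span_base)
      ultimately show ?case by simp
    qed
    obtain n where "lower_central L n = {0}" using nil unfolding nilpotent_super_lie_def by blast
    then have "(?c ^^ n) (fgen x) - fgen 0 \<in> D" using *[of n] by auto
    then have n: "(?c ^^ n) (fgen x) \<in> D" using gen_zero D.mem_cong by blast
    obtain m where m: "(?c ^^ m) p \<in> D" using gen(3) by blast
    have "(?c ^^ (n + m)) (fgen x * p) \<in> D"
      by (rule D.commutator_nilpotent_mult[OF Y fgen_mem[OF gen(1)] gen(2) n m])
    then show ?case by blast
  }
qed

text \<open>A generator \<open>t - lam t\<close> with \<open>t = u + c x\<close> is congruent to \<open>u - lam u\<close> plus \<open>c (x - lam x)\<close>.\<close>

lemma char_ideal_adjoin: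
  assumes h\<^sub>0: "graded_subspace L h\<^sub>0" "h\<^sub>0 \<subseteq> g" and x: "x \<in> g"
    and p: "p \<in> char_ideal g D {v. \<exists>c. v - lscale L c x \<in> h\<^sub>0}"
  shows "\<exists>j\<in>char_ideal g D h\<^sub>0. \<exists>w\<in>words_on g. p = j + w * (fgen x - fconst (lam x))"
proof -
  let ?J = "char_ideal g D h\<^sub>0"
  interpret J: left_ideal_of "words_on g" ?J using char_ideal_left_ideal[OF h\<^sub>0(2)] .
  show ?thesis using p unfolding char_ideal_def[of g D "{v. \<exists>c. v - lscale L c x \<in> h\<^sub>0}"]
  proof induction
    case (base d)
    then show ?case using D_char_ideal D.zero_mem by (intro bexI[of _ d] bexI[of _ 0]) auto
  next
    case (gen a q)
    then obtain t c where t: "q = fgen t - fconst (lam t)" "t - lscale L c x \<in> h\<^sub>0"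
      unfolding char_gens_def by blast
    define u where "u = t - lscale L c x"
    have u: "u \<in> h\<^sub>0" "t = u + lscale L c x" using t by (auto simp: u_def)
    have cx: "lscale L c x \<in> g" using x vs.subspace_scale[OF g_subspace] by blast
    have m: "u \<in> g" "u \<in> lspace L" "x \<in> lspace L" "lscale L c x \<in> lspace L"
      using u h\<^sub>0(2) x cx g_lspace by auto
    define r where "r = (fgen (u + lscale L c x) - (fgen u + fgen (lscale L c x)))
      + (fgen (lscale L c x) - fconst c * fgen x) + (fgen u - fconst (lam u))"
    have "r \<in> ?J" unfolding r_def
      using gen_add[OF m(1) cx] gen_scale[OF x] char_gen_mem'[OF h\<^sub>0 u(1)] D_char_ideal
      by (intro J.add_ideal) blast+
    then have "a * r \<in> ?J" using gen(1) J.lmult_ideal by blast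
    moreover have "lam t = lam u + c * lam x" unfolding u(2) using m by (simp add: lam_add lam_scale)
    then have "a * q = a * r + (a * fconst c) * (fgen x - fconst (lam x))"
      unfolding t(1) u(2) r_def by (simp add: algebra_simps single_add fconst_mult)
    moreover have "a * fconst c \<in> words_on g" using gen(1) D.mult_mem fconst_in_words by blast
    ultimately show ?case by blast
  next
    case (add p q)
    then obtain j w j' w' where "j \<in> ?J" "w \<in> words_on g" "j' \<in> ?J"
      "w' \<in> words_on g" "p = j + w * (fgen x - fconst (lam x))" "q = j' + w' * (fgen x - fconst (lam x))"
      by blast
    then show ?case
      by (intro bexI[of _ "j + j'"] bexI[of _ "w + w'"])
        (auto simp: distrib_right intro: J.add_ideal D.add_mem)
  qed
qed

text \<open>The exchange lemmas apply to \<open>x - lam x\<close> and \<open>z - lam z\<close>, which form a Weyl or a Clifford pair modulo the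
  left ideal of \<open>h\<^sub>0\<close>. They are applied with the annihilator for \<open>h\<^sub>0 + k x\<close> in the role of \<open>N\<close>:
  it is stable under multiplication by \<open>z\<close> from both sides.\<close>

lemma char_ann_adjoin:
  assumes nil: "nilpotent_super_lie L"
    and h\<^sub>0: "graded_subspace L h\<^sub>0" "h\<^sub>0 \<subseteq> g"
    and x: "x \<in> g \<inter> lpart L d" and z: "z \<in> g \<inter> lpart L d"
    and xz: "form x z = 1" "lbracket L x z \<in> h\<^sub>0"
    and xx: "lbracket L x x \<in> h\<^sub>0" "form x x = 0"
    and norm_x: "\<And>t. t \<in> h\<^sub>0 \<Longrightarrow> lbracket L t x \<in> h\<^sub>0" "\<And>t. t \<in> h\<^sub>0 \<Longrightarrow> form t x = 0"
    and norm_z: "\<And>t. t \<in> h\<^sub>0 \<Longrightarrow> lbracket L t z \<in> h\<^sub>0" "\<And>t. t \<in> h\<^sub>0 \<Longrightarrow> form t z = 0"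
    and h: "h = {v. \<exists>c. v - lscale L c x \<in> h\<^sub>0}" "h \<subseteq> g"
  shows "char_ann g D h \<subseteq> char_ideal g D h\<^sub>0"
proof -
  let ?J = "char_ideal g D h\<^sub>0"
  interpret J: left_ideal_of "words_on g" ?J using char_ideal_left_ideal[OF h\<^sub>0(2)] .
  let ?X = "fgen x - fconst (lam x)" and ?Z = "fgen z - fconst (lam z)"
  have gx: "fgen x \<in> words_on g" "fgen z \<in> words_on g" using x z fgen_mem by auto
  have X: "?X \<in> words_on g" "?Z \<in> words_on g" using gx fconst_in_words D.diff_mem by auto
  have right: "p * (fgen v - fconst (lam v)) \<in> ?J"
    if "p \<in> ?J" "p * fgen v \<in> ?J" for p v
    using that J.lmult_ideal[OF fconst_in_words that(1), of "lam v"]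
    by (simp add: right_diff_distrib fconst_central[symmetric] J.diff_ideal)
  have rX: "p * ?X \<in> ?J" if "p \<in> ?J" for p
    using right[OF that] char_ideal_rmult_gen[OF h\<^sub>0(2) x norm_x that] by blast
  have rZ: "p * ?Z \<in> ?J" if "p \<in> ?J" for p
    using right[OF that] char_ideal_rmult_gen[OF h\<^sub>0(2) z norm_z that] by blast
  have N: "\<exists>j\<in>?J. \<exists>w\<in>words_on g. u = j + w * ?X" if "u \<in> char_ann g D h" for u
    using char_ideal_adjoin[OF h\<^sub>0, of x u] x that char_ann_subset[of h] unfolding h(1) by blast
  have one: "fgen (lbracket L x z) - 1 \<in> ?J"
    using char_gen_mem'[OF h\<^sub>0 xz(2)] xz(1) by simp
  from bit_exhaust[of d] show ?thesis
  proof
    assume d: "d = 0"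
    have comm: "commutator ?Z u = commutator (fgen z) u" for u
      by (simp add: algebra_simps fconst_central)
    show ?thesis
    proof (rule J.even_exchange[of ?X ?Z])
      have "(fgen x * fgen z - fgen z * fgen x - fgen (lbracket L x z)) + (fgen (lbracket L x z) - 1)
          \<in> ?J"
        using gen_comm_even[of x z 0] x z d one D_char_ideal by (intro J.add_ideal) auto
      then show "?X * ?Z - ?Z * ?X - 1 \<in> ?J"
        by (simp add: algebra_simps fconst_central mult_single)
      show "\<exists>m. (commutator ?Z ^^ m) w \<in> ?J" if "w \<in> words_on g" for w
        using commutator_nilpotent[OF nil _ that, of z] z d D_char_ideal unfolding comm by blast
      show "commutator ?Z u \<in> char_ann g D h" if "u \<in> char_ann g D h" for u
        using char_ann_diff[OF h(2) char_ann_lmult[OF h(2) that X(2)] char_ann_rmult[OF that X(2)]] .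
    qed (use X rX rZ N words_on_inverse_nat in blast)+
  next
    assume d: "d = 1"
    have l: "lam x = 0" "lam z = 0" using x z d lam_odd by auto
    show ?thesis
    proof (rule J.odd_exchange[of ?X ?Z])
      have "(fgen x * fgen z + fgen z * fgen x - fgen (lbracket L x z)) + (fgen (lbracket L x z) - 1)
          \<in> ?J"
        using gen_comm_odd[of x z] x z d one D_char_ideal by (intro J.add_ideal) auto
      then show "?X * ?Z + ?Z * ?X - 1 \<in> ?J" using l by simp
      have "(fgen x * fgen x + fgen x * fgen x - fgen (lbracket L x x)) + fgen (lbracket L x x)
          \<in> ?J"
        using gen_comm_odd[of x x] x d char_gen_mem'[OF h\<^sub>0 xx(1)] xx(2) D_char_ideal
        by (intro J.add_ideal) auto
      then show "?X * ?X \<in> ?J"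
        using half_mem[OF J.left_ideal_of_axioms, of "fgen x * fgen x"] l by simp
      show "u * ?Z \<in> char_ann g D h" if "u \<in> char_ann g D h" for u
        using char_ann_rmult[OF that X(2)] .
    qed (use X rX rZ N in blast)+
  qed
qed

end

text \<open>A vector \<open>y\<close> that is central modulo the core, with \<open>x\<close> dual to it, over an ideal \<open>D\<close> modulo which the
  core acts by \<open>lam\<close>. The orthogonal of \<open>y\<close> is the subalgebra to which the problem is reduced.\<close>

locale near_center = env_on L lam g D
  for L :: "('k::field_char_0, 'g::ab_group_add) super_lie" and lam g D +
  fixes y x :: 'g and d :: bit
  assumes y: "y \<in> g" "y \<in> lpart L d" and y_core: "\<And>b. b \<in> g \<Longrightarrow> lbracket L b y \<in> core g"
    and yy: "form y y = 0" and x: "x \<in> g" "x \<in> lpart L d" "form x y = 1"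
    and core_D: "\<And>t. t \<in> core g \<Longrightarrow> fgen t - fconst (lam t) \<in> D"
begin

lemma orth_y_graded: "graded_subspace L (orth g y)"
  by (rule orth_graded[OF subalgebra y y_core])
lemma orth_y_subset: "orth g y \<subseteq> g"
  by (rule orth_subset[OF subalgebra y y_core])
lemma orth_y_bracket: "a \<in> g \<Longrightarrow> b \<in> g \<Longrightarrow> lbracket L a b \<in> orth g y"
  by (rule bracket_in_orth[OF subalgebra y y_core])
lemma orth_y_subalgebra: "lie_subalgebra L (orth g y)"
  by (rule orth_subalgebra[OF subalgebra y y_core])

abbreviation restricted :: "('g fword \<Rightarrow>\<^sub>0 'k) set" where
  "restricted \<equiv> D \<inter> words_on (orth g y)"

text \<open>For odd \<open>x\<close> the square of \<open>x\<close> is half of \<open>[x, x]\<close> and belongs to the smaller algebra.\<close>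

abbreviation exponents :: "nat set" where
  "exponents \<equiv> (if d = 0 then UNIV else {0, 1})"

abbreviation X :: "'g fword \<Rightarrow>\<^sub>0 'k" where "X \<equiv> fgen x"
abbreviation Y :: "'g fword \<Rightarrow>\<^sub>0 'k" where "Y \<equiv> fgen y"

lemma X_mem: "X \<in> words_on g" and Y_mem: "Y \<in> words_on g"
  using x y fgen_mem by auto

lemma orth_words: "words_on (orth g y) \<subseteq> words_on g"
  by (rule words_on_mono[OF orth_y_subset])

lemma bracket_y_D:
  assumes "a \<in> orth g y" "a \<in> lpart L e"
  shows "fgen (lbracket L y a) \<in> D"
proof -
  have "form y a = 0" using form_antisym[OF y(2) assms(2)] assms(1) by (simp add: orth_def[OF subalgebra])
  moreover have "lbracket L y a \<in> core g"
    using core_bracket_left[OF subalgebra y y_core] assms(1) orth_y_subset by blast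
  ultimately show ?thesis using core_D[of "lbracket L y a"] by simp
qed

lemma bracket_xy_D: "fgen (lbracket L x y) - 1 \<in> D"
  using core_D[OF y_core[OF x(1)]] x(3) by simp

lemma even_central:
  assumes d: "d = 0" and c: "c \<in> words_on (orth g y)"
  shows "commutator Y c \<in> D"
  using c
proof (induction rule: words_on_induct)
  case (const c)
  then show ?case using D.zero_ideal by (simp add: fconst_central)
next
  case (add p q)
  have "commutator Y (p + q) = commutator Y p + commutator Y q" by (simp add: algebra_simps)
  then show ?case using add D.add_ideal by simp
next
  case (gen a p)
  obtain a0 a1 where a: "a0 \<in> orth g y \<inter> lpart L 0" "a1 \<in> orth g y \<inter> lpart L 1" "a = a0 + a1"
    using gradedD(3)[OF orth_y_graded gen(1)] by blast
  have ag: "a0 \<in> g" "a1 \<in> g" "a \<in> g" using a gen(1) orth_y_subset by auto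
  have "lbracket L y a0 \<in> g" "lbracket L y a1 \<in> g" using subalgebraD(2)[OF subalgebra] y(1) ag by blast+
  then have "fgen (lbracket L y a0 + lbracket L y a1) - (fgen (lbracket L y a0) + fgen (lbracket L y a1)) \<in> D"
    by (rule gen_add)
  moreover have "fgen (lbracket L y a0) + fgen (lbracket L y a1) \<in> D"
    using bracket_y_D a by (intro D.add_ideal) blast+
  ultimately have "fgen (lbracket L y a0 + lbracket L y a1) \<in> D" by (rule D.mem_cong)
  moreover have "lbracket L y a = lbracket L y a0 + lbracket L y a1"
    unfolding a(3) using y ag g_lspace by (intro bracket_add_right) auto
  moreover have "Y * fgen a - fgen a * Y - fgen (lbracket L y a) \<in> D"
    using gen_comm_even'[of y a] y d ag by blast
  ultimately have com: "commutator Y (fgen a) \<in> D" using D.mem_cong by metis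
  have leibniz: "commutator Y (fgen a * p) = commutator Y (fgen a) * p + fgen a * commutator Y p"
    by (simp add: algebra_simps)
  have "p \<in> words_on g" using gen(2) orth_words by blast
  then show ?case unfolding leibniz
    by (intro D.add_ideal D.rmult_ideal[OF com] D.lmult_ideal[OF fgen_mem[OF ag(3)] gen(3)])
qed

text \<open>An odd \<open>y\<close> anticommutes with odd letters, so the twist is the parity automorphism.\<close>

lemma odd_twist:
  assumes d: "d = 1" and c: "c \<in> words_on (orth g y)"
  shows "Y * c - map_letters parity c * Y \<in> D"
  using c
proof (induction rule: words_on_induct)
  case (const c)
  then show ?case using D.zero_ideal by (simp add: fconst_central map_letters_fconst)
next
  case (add p q)
  have "Y * (p + q) - map_letters parity (p + q) * Y
      = (Y * p - map_letters parity p * Y) + (Y * q - map_letters parity q * Y)"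
    by (simp add: algebra_simps map_letters_add)
  then show ?case using add D.add_ideal by simp
next
  case (gen a p)
  obtain a0 a1 where a: "a0 \<in> orth g y \<inter> lpart L 0" "a1 \<in> orth g y \<inter> lpart L 1" "a = a0 + a1"
    using gradedD(3)[OF orth_y_graded gen(1)] by blast
  have ag: "a0 \<in> g" "a1 \<in> g" "a \<in> g" using a gen(1) orth_y_subset by auto
  have na1: "- a1 \<in> g" using vs.subspace_neg[OF g_subspace ag(2)] .
  have par: "parity a = a0 + - a1" using parity_eq a by simp
  let ?M = "fgen a0" and ?M' = "fgen a1" and ?P = "fgen (a0 + - a1)" and ?N = "fgen (- a1)"
    and ?A = "fgen (a0 + a1)"
  have "Y * ?M - fconst (koszul 1 0) * (?M * Y) - fgen (lbracket L y a0) \<in> D"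
    using gen_comm[of y 1 a0 0] y d a(1) ag(1) by blast
  then have r0: "Y * ?M - ?M * Y - fgen (lbracket L y a0) \<in> D" by (simp add: koszul_def)
  have r1: "Y * ?M' + ?M' * Y - fgen (lbracket L y a1) \<in> D"
    using gen_comm_odd[of y a1] y d a(2) ag(2) by blast
  have b: "fgen (lbracket L y a0) \<in> D" "fgen (lbracket L y a1) \<in> D" using bracket_y_D a(1,2) by blast+
  note s = gen_add[OF ag(1,2)] gen_add[OF ag(1) na1] gen_uminus[OF ag(2)]
  have "Y * (?A - (?M + ?M')) - (?P - (?M + ?N)) * Y - (?N + ?M') * Y
      + ((Y * ?M - ?M * Y - fgen (lbracket L y a0)) + fgen (lbracket L y a0))
      + ((Y * ?M' + ?M' * Y - fgen (lbracket L y a1)) + fgen (lbracket L y a1)) \<in> D"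
    by (intro D.add_ideal D.diff_ideal D.lmult_ideal[OF Y_mem s(1)] D.rmult_ideal[OF s(2) Y_mem]
        D.rmult_ideal[OF s(3) Y_mem] r0 r1 b)
  then have g: "Y * fgen a - fgen (parity a) * Y \<in> D" unfolding par unfolding a(3) by (simp add: algebra_simps)
  have pa: "fgen (parity a) \<in> words_on g" using parity_mem[OF g_graded ag(3)] fgen_mem by blast
  have "(Y * fgen a - fgen (parity a) * Y) * p + fgen (parity a) * (Y * p - map_letters parity p * Y) \<in> D"
    using gen orth_words by (intro D.add_ideal D.lmult_ideal[OF pa] D.rmult_ideal[OF g]) auto
  then show ?case by (simp add: algebra_simps map_letters_mult map_letters_fgen)
qed

text \<open>For odd \<open>y\<close> the ideal is stable under the twist because \<open>D\<close> is graded.\<close>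

lemma powers_independent:
  assumes c: "\<And>i. c i \<in> words_on (orth g y)" "\<And>i. i \<notin> exponents \<Longrightarrow> c i = 0"
    and s: "(\<Sum>i<n. X ^ i * c i) \<in> D" and i: "i < n"
  shows "c i \<in> D"
  using bit_exhaust[of d]
proof
  assume d: "d = 0"
  have "(X * Y - Y * X - fgen (lbracket L x y)) + (fgen (lbracket L x y) - 1) \<in> D"
    using gen_comm_even[of x y 0] x y d bracket_xy_D by (intro D.add_ideal) auto
  then have weyl: "X * Y - Y * X - 1 \<in> D" by simp
  show ?thesis
  proof (rule D.even_independent[OF X_mem Y_mem orth_words weyl words_on_inverse_nat _ _ c(1) s i])
    fix n and c :: "'g fword \<Rightarrow>\<^sub>0 'k" assume c: "c \<in> words_on (orth g y)"
    interpret A': unital_subring "words_on (orth g y) :: ('g fword \<Rightarrow>\<^sub>0 'k) set"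
      by (rule words_on_unital_subring)
    show "of_nat n * c \<in> words_on (orth g y)" using A'.mult_mem[OF A'.of_nat_mem c] .
    show "commutator Y c \<in> D" using even_central[OF d c] .
  qed
next
  assume d: "d = 1"
  have "(X * Y + Y * X - fgen (lbracket L x y)) + (fgen (lbracket L x y) - 1) \<in> D"
    using gen_comm_odd[of x y] x y d bracket_xy_D by (intro D.add_ideal) auto
  then have clifford: "X * Y + Y * X - 1 \<in> D" by simp
  have "fgen (lbracket L y y) \<in> D" using core_D[OF y_core[OF y(1)]] yy by simp
  then have "(Y * Y + Y * Y - fgen (lbracket L y y)) + fgen (lbracket L y y) \<in> D"
    using gen_comm_odd[of y y] y d by (intro D.add_ideal) auto
  then have square: "Y * Y \<in> D" using half_mem[OF D.left_ideal_of_axioms, of "Y * Y"] by simp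
  \<comment> \<open>pads or cuts the sum to the two terms that can be nonzero\<close>
  define b where "b j = (if j < n then c j else 0)" for j
  interpret A': unital_subring "words_on (orth g y) :: ('g fword \<Rightarrow>\<^sub>0 'k) set"
    by (rule words_on_unital_subring)
  have b: "b j \<in> words_on (orth g y)" for j
    using c(1) A'.zero_mem by (simp add: b_def)
  have "(\<Sum>i<n. X ^ i * c i) = (\<Sum>i\<in>{0, 1}. X ^ i * b i)"
  proof -
    have "(\<Sum>i<n. X ^ i * c i) = (\<Sum>i<n + 2. X ^ i * b i)"
      by (rule sum.mono_neutral_cong_left) (auto simp: b_def)
    also have "\<dots> = (\<Sum>i\<in>{0, 1}. X ^ i * b i)"
      using c(2) d by (intro sum.mono_neutral_right) (auto simp: b_def)
    finally show ?thesis .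
  qed
  then have "b 0 + X * b 1 \<in> D" using s by simp
  moreover have "map_letters parity c * Y \<in> D" if "c \<in> words_on (orth g y)" "c * Y \<in> D" for c
  proof -
    have m: "map_letters parity c \<in> words_on g"
      using map_letters_in_words[of c g] that(1) orth_words parity_mem[OF g_graded] by blast
    have "map_letters parity (c * Y) \<in> D" using parity_D that by blast
    then have "map_letters parity c * fgen (- y) \<in> D"
      using y d by (simp add: map_letters_mult map_letters_fgen parity_odd)
    then have "map_letters parity c * (fgen (- y) + Y) - map_letters parity c * fgen (- y) \<in> D"
      using D.lmult_ideal[OF m gen_uminus[OF y(1)]] by (intro D.diff_ideal)
    then show ?thesis by (simp add: algebra_simps)
  qed
  moreover have "map_letters parity c \<in> words_on (orth g y)" if "c \<in> words_on (orth g y)" for c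
    using map_letters_in_words[OF that] parity_mem[OF orth_y_graded] by blast
  ultimately have "b 0 \<in> D" "b 1 \<in> D"
    using D.odd_independent[OF X_mem Y_mem orth_words clifford square _ odd_twist[OF d] _ b b] by blast+
  moreover have "b i = c i" using i by (simp add: b_def)
  moreover have "b j = 0" if "j \<notin> {0, 1}" for j using c(2) d that by (simp add: b_def)
  ultimately show ?thesis using D.zero_ideal by (cases "i \<in> {0, 1}") auto
qed

lemma orth_split:
  assumes "b \<in> g"
  shows "b - lscale L (form b y) x \<in> orth g y"
proof -
  let ?u = "b - lscale L (form b y) x"
  have u: "?u \<in> g" "lscale L (form b y) x \<in> g"
    using assms x vs.subspace_diff[OF g_subspace] vs.subspace_scale[OF g_subspace] by blast+
  have "form (?u + lscale L (form b y) x) y = form ?u y + form b y * form x y"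
    using u x y g_lspace by (subst form_add_left) (auto simp: form_scale_left)
  then show ?thesis using u x(3) by (simp add: orth_def[OF subalgebra])
qed

abbreviation expansions :: "('g fword \<Rightarrow>\<^sub>0 'k) set" where
  "expansions \<equiv> left_ideal_gen {X ^ i | i. i \<in> exponents} D (words_on (orth g y))"

lemma expansions_base: "t \<in> words_on (orth g y) \<Longrightarrow> t \<in> expansions"
proof -
  assume t: "t \<in> words_on (orth g y)"
  have "X ^ 0 \<in> {X ^ i | i. i \<in> exponents}" by (rule CollectI, rule exI[of _ 0]) simp
  from left_ideal_gen.gen[OF this t] show ?thesis by simp
qed

lemma expansions_X:
  assumes "p \<in> expansions"
  shows "X * p \<in> expansions"
  using assms
proof induction
  case (base p)
  then show ?case using D.lmult_ideal[OF X_mem] by (blast intro: left_ideal_gen.base)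
next
  case (gen a t)
  then obtain i where i: "a = X ^ i" "i \<in> exponents" by blast
  show ?case
  proof (cases "Suc i \<in> exponents")
    case True
    have "X ^ Suc i * t \<in> expansions" using True gen(2) by (intro left_ideal_gen.gen) blast+
    then show ?thesis using i by (simp add: mult.assoc)
  next
    case False
    then have d: "d = 1" "i = 1" using i bit_exhaust[of d] by (auto split: if_splits)
    have t: "t \<in> words_on g" using gen(2) orth_words by blast
    have xx: "lbracket L x x \<in> orth g y" using orth_y_bracket x by blast
    define H :: "'g fword \<Rightarrow>\<^sub>0 'k" where "H = fconst (1 / 2) * fgen (lbracket L x x)"
    have H: "H \<in> words_on (orth g y)" unfolding H_def
      using unital_subring.mult_mem[OF words_on_unital_subring fconst_in_words fgen_in_words[OF xx]] .
    have "H + H = fconst (1/2 + 1/2) * fgen (lbracket L x x)"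
      unfolding H_def by (simp only: single_add distrib_right)
    then have HH: "H + H = fgen (lbracket L x x)" by simp
    have "X * X + X * X - fgen (lbracket L x x) \<in> D" using gen_comm_odd[of x x] x d by blast
    then have "(X * X - H) + (X * X - H) \<in> D" unfolding HH[symmetric] by (simp add: algebra_simps)
    then have "X * X - H \<in> D" by (rule half_mem[OF D.left_ideal_of_axioms])
    then have "(X * X - H) * t \<in> expansions" using D.rmult_ideal t by (blast intro: left_ideal_gen.base)
    moreover have "H * t \<in> expansions"
      using unital_subring.mult_mem[OF words_on_unital_subring H gen(2)] by (rule expansions_base)
    ultimately have "(X * X - H) * t + H * t \<in> expansions" by (rule left_ideal_gen.add)
    then show ?thesis using i d by (simp add: algebra_simps)
  qed
qed (auto simp: distrib_left intro: left_ideal_gen.add)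

lemma expansions_power: "t \<in> words_on (orth g y) \<Longrightarrow> X ^ i * t \<in> expansions"
proof (induction i)
  case 0
  then show ?case using expansions_base by simp
next
  case (Suc i)
  then show ?case using expansions_X by (simp add: mult.assoc)
qed

lemma expansions_const:
  assumes "p \<in> expansions"
  shows "fconst c * p \<in> expansions"
  using assms
proof induction
  case (base p)
  then show ?case using D.lmult_ideal[OF fconst_in_words] by (blast intro: left_ideal_gen.base)
next
  case (gen a t)
  have "fconst c * t \<in> words_on (orth g y)"
    using unital_subring.mult_mem[OF words_on_unital_subring fconst_in_words gen(2)] .
  then have "a * (fconst c * t) \<in> expansions" using gen(1) by (intro left_ideal_gen.gen)
  moreover have "a * (fconst c * t) = fconst c * (a * t)"
    by (simp only: mult.assoc[symmetric] fconst_central[of c a])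
  ultimately show ?case by simp
qed (auto simp: distrib_left intro: left_ideal_gen.add)

text \<open>Moving a letter of the orthogonal to the right past \<open>x\<close> produces the letter \<open>[b, x]\<close>, which is again in
  the orthogonal.\<close>

lemma expansions_orth_power:
  assumes "t \<in> words_on (orth g y)"
  shows "b \<in> orth g y \<Longrightarrow> b \<in> lpart L e \<Longrightarrow> fgen b * (X ^ i * t) \<in> expansions"
proof (induction i arbitrary: b e)
  case 0
  have "fgen b * t \<in> words_on (orth g y)"
    using unital_subring.mult_mem[OF words_on_unital_subring fgen_in_words[OF 0(1)] assms] .
  then show ?case using expansions_power[of "fgen b * t" 0] by simp
next
  case (Suc i)
  let ?q = "X ^ i * t" and ?K = "fconst (koszul e d) :: 'g fword \<Rightarrow>\<^sub>0 'k"
  have bg: "b \<in> g" using Suc.prems orth_y_subset by blast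
  have q: "?q \<in> words_on g" using assms orth_words D.mult_mem[OF D.power_mem[OF X_mem]] by blast
  have "lbracket L b x \<in> orth g y" "lbracket L b x \<in> lpart L (e + d)"
    using orth_y_bracket[OF bg x(1)] bracket_degree[OF Suc.prems(2) x(2)] by blast+
  then have 1: "fgen (lbracket L b x) * ?q \<in> expansions" by (rule Suc.IH)
  have 2: "?K * (X * (fgen b * ?q)) \<in> expansions"
    using expansions_const expansions_X Suc.IH[OF Suc.prems] by blast
  have "fgen b * X - ?K * (X * fgen b) - fgen (lbracket L b x) \<in> D"
    using gen_comm[of b e x d] bg Suc.prems x by blast
  then have 3: "(fgen b * X - ?K * (X * fgen b) - fgen (lbracket L b x)) * ?q \<in> expansions"
    using D.rmult_ideal q by (blast intro: left_ideal_gen.base)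
  have "((fgen b * X - ?K * (X * fgen b) - fgen (lbracket L b x)) * ?q + ?K * (X * (fgen b * ?q)))
      + fgen (lbracket L b x) * ?q \<in> expansions"
    by (intro left_ideal_gen.add 1 2 3)
  then show ?case by (simp add: algebra_simps)
qed

lemma expansions_orth:
  assumes b: "b \<in> orth g y" "b \<in> lpart L e" and p: "p \<in> expansions"
  shows "fgen b * p \<in> expansions"
  using p
proof induction
  case (base p)
  have "fgen b \<in> words_on g" using b orth_y_subset fgen_mem by blast
  then show ?case using D.lmult_ideal base by (blast intro: left_ideal_gen.base)
next
  case (gen a t)
  then show ?case using expansions_orth_power[OF gen(2) b] by blast
qed (auto simp: distrib_left intro: left_ideal_gen.add)

text \<open>The spanning half of the theorem of Poincare, Birkhoff and Witt for the codimension one ideal \<open>orth g y\<close>.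
  The uniqueness half is \<open>powers_independent\<close>.\<close>

lemma words_on_expansions: "words_on g \<subseteq> expansions"
proof
  fix p :: "'g fword \<Rightarrow>\<^sub>0 'k" assume "p \<in> words_on g"
  then show "p \<in> expansions"
  proof (induction rule: words_on_induct)
    case (const c)
    show ?case using expansions_power[OF fconst_in_words, of 0 c] by simp
  next
    case (add p q)
    then show ?case by (intro left_ideal_gen.add)
  next
    case (gen b p)
    define k where "k = form b y"
    define t where "t = b - lscale L k x"
    have t: "t \<in> orth g y" "b = t + lscale L k x" using orth_split[OF gen(1)] by (auto simp: t_def k_def)
    obtain t0 t1 where t01: "t0 \<in> orth g y \<inter> lpart L 0" "t1 \<in> orth g y \<inter> lpart L 1" "t = t0 + t1"
      using gradedD(3)[OF orth_y_graded t(1)] by blast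
    have m: "t \<in> g" "t0 \<in> g" "t1 \<in> g" "lscale L k x \<in> g"
      using t t01 orth_y_subset vs.subspace_scale[OF g_subspace x(1)] by auto
    let ?r = "(fgen (t + lscale L k x) - (fgen t + fgen (lscale L k x)))
      + (fgen (lscale L k x) - fconst k * X) + (fgen (t0 + t1) - (fgen t0 + fgen t1))"
    have "?r \<in> D" by (intro D.add_ideal gen_add gen_scale m x(1))
    then have "?r * p \<in> expansions" using D.rmult_ideal gen(2) by (blast intro: left_ideal_gen.base)
    moreover have "fconst k * (X * p) \<in> expansions" using expansions_const expansions_X gen(3) by blast
    moreover have "fgen t0 * p \<in> expansions" "fgen t1 * p \<in> expansions"
      using expansions_orth t01 gen(3) by blast+
    ultimately have "((?r * p + fconst k * (X * p)) + fgen t0 * p) + fgen t1 * p \<in> expansions"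
      by (intro left_ideal_gen.add)
    then show ?case unfolding t(2) t01(3) by (simp add: algebra_simps)
  qed
qed

lemma char_ideal_expansions:
  "char_ideal g D h \<subseteq> left_ideal_gen {X ^ i | i. i \<in> exponents} D (char_ideal (orth g y) restricted h)"
    (is "_ \<subseteq> ?E") if h: "h \<subseteq> g"
proof
  fix p assume "p \<in> char_ideal g D h"
  then show "p \<in> ?E"
    unfolding char_ideal_def[of g D h]
  proof induction
    case (gen a q)
    have q: "q \<in> words_on g" using gen(2) char_gens_words[OF h] by blast
    have "a \<in> expansions" using gen(1) words_on_expansions by blast
    then show ?case
    proof induction
      case (base e)
      then show ?case using D.rmult_ideal q by (blast intro: left_ideal_gen.base)
    next
      case (gen b t)
      have "t * q \<in> char_ideal (orth g y) restricted h"
        unfolding char_ideal_def using gen(2) \<open>q \<in> char_gens h\<close> by (rule left_ideal_gen.gen)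
      then show ?case unfolding mult.assoc using gen(1) by (intro left_ideal_gen.gen)
    qed (auto simp: distrib_right intro: left_ideal_gen.add)
  qed (auto intro: left_ideal_gen.intros)
qed

lemma restricted_env: "env_ideal_on (orth g y) restricted"
proof -
  interpret A': unital_subring "words_on (orth g y) :: ('g fword \<Rightarrow>\<^sub>0 'k) set"
    by (rule words_on_unital_subring)
  have "two_sided_ideal_of (words_on (orth g y)) restricted"
    by unfold_locales
      (use orth_words in \<open>auto intro: D.zero_ideal A'.zero_mem D.add_ideal A'.add_mem D.lmult_ideal
          D.rmult_ideal A'.mult_mem\<close>)
  moreover have "env_relations (restrict_lie L (orth g y)) \<subseteq> D"
    using env_relations_mono[OF orth_y_graded g_graded orth_y_subset] relations by blast
  moreover have "env_relations (restrict_lie L (orth g y)) \<subseteq> words_on (orth g y)"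
    by (rule env_relations_words[OF orth_y_subalgebra])
  moreover have "map_letters parity p \<in> restricted" if "p \<in> restricted" for p
    using that parity_D map_letters_in_words[of p "orth g y"] parity_mem[OF orth_y_graded] by blast
  ultimately show ?thesis unfolding env_ideal_on_def by blast
qed

sublocale restr: env_on L lam "orth g y" restricted
  by unfold_locales (use orth_y_subalgebra restricted_env in auto)

lemma char_ideal_restricted_subset:
  assumes "h \<subseteq> g"
  shows "char_ideal (orth g y) restricted h \<subseteq> char_ideal g D h"
proof
  fix p assume "p \<in> char_ideal (orth g y) restricted h"
  then show "p \<in> char_ideal g D h"
    unfolding char_ideal_def[of "orth g y"]
    by induction (use orth_words in \<open>auto simp: char_ideal_def intro: left_ideal_gen.intros\<close>)
qed

lemma char_ann_from_orth:
  assumes h: "h \<subseteq> orth g y" "h' \<subseteq> orth g y"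
    and ann: "char_ann (orth g y) restricted h \<subseteq> char_ann (orth g y) restricted h'"
  shows "char_ann g D h \<subseteq> char_ann g D h'"
proof (rule char_ann_leI, rule subsetI)
  fix u assume u: "u \<in> char_ann g D h"
  have hg: "h \<subseteq> g" "h' \<subseteq> g" using h orth_y_subset by auto
  show "u \<in> char_ideal g D h'"
  proof (rule D.annihilator_reduction[where A' = "words_on (orth g y)" and x = X and I = exponents
        and K' = "char_ideal (orth g y) restricted h" and K = "char_ideal g D h"])
    show "c i \<in> D" if "\<And>i. c i \<in> words_on (orth g y)" "\<And>i. i \<notin> exponents \<Longrightarrow> c i = 0"
      "(\<Sum>i<n. X ^ i * c i) \<in> D" "i < n" for n i and c :: "nat \<Rightarrow> 'g fword \<Rightarrow>\<^sub>0 'k"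
      by (rule powers_independent[of c n i, OF that])
    show "D \<inter> words_on (orth g y) \<subseteq> char_ideal (orth g y) restricted h"
      by (rule restr.D_char_ideal)
    show "a \<in> char_ideal g D h'" if "a \<in> words_on (orth g y)"
      "\<And>b. b \<in> words_on (orth g y) \<Longrightarrow> a * b \<in> char_ideal (orth g y) restricted h" for a
    proof -
      have "a \<in> char_ann (orth g y) restricted h" using that unfolding char_ann_def by blast
      then show ?thesis using ann restr.char_ann_subset char_ideal_restricted_subset[OF hg(2)] by blast
    qed
    show "u \<in> words_on g" "\<And>b. b \<in> words_on g \<Longrightarrow> u * b \<in> char_ideal g D h"
      using u unfolding char_ann_def by auto
  qed (rule words_on_unital_subring orth_words X_mem words_on_expansions D_char_ideal
      restr.char_ideal_left_ideal[OF h(1)] char_ideal_expansions[OF hg(1)] char_ideal_left_ideal[OF hg(2)])+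
qed

end

section \<open>Independence of the polarization\<close>

context nilpotent_functional
begin

text \<open>If \<open>h\<close> contains a vector \<open>x\<close> dual to \<open>y\<close>, then \<open>h\<close> and the moved polarization arise from \<open>h \<inter> orth g y\<close>
  by adjoining \<open>x\<close> or \<open>y\<close>. By \<open>char_ann_adjoin\<close>, each annihilator lies in the left ideal of
  \<open>h \<inter> orth g y\<close>, hence in the left ideal of the other polarization.\<close>

lemma move_polarization:
  assumes g: "lie_subalgebra L g" and D: "env_ideal_on g D" and h: "polarization_on g h"
    and y: "y \<in> g" "y \<in> lpart L d" and y_core: "\<And>b. b \<in> g \<Longrightarrow> lbracket L b y \<in> core g"
    and yy: "form y y = 0"
  shows "\<exists>h\<^sub>1. polarization_on g h\<^sub>1 \<and> h\<^sub>1 \<subseteq> orth g y \<and> char_ann g D h\<^sub>1 = char_ann g D h"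
proof (cases "h \<subseteq> orth g y")
  case True
  then show ?thesis using h by blast
next
  case False
  interpret env_on L lam g D by unfold_locales (use g D in auto)
  note hD = polarization_onD[OF h] and h_sub = gradedD(1)[OF subalgebraD(1)[OF polarization_onD(1)[OF h]]]
  obtain s where s: "s \<in> h" "form s y \<noteq> 0" using False hD(2) by (auto simp: orth_def[OF g])
  obtain a b where ab: "a \<in> h \<inter> lpart L 0" "b \<in> h \<inter> lpart L 1" "s = a + b"
    using gradedD(3)[OF subalgebraD(1)[OF hD(1)] s(1)] by blast
  have "form s y = form a y + form b y" unfolding ab(3) using ab y hD(2) g_lspace by (intro form_add_left) auto
  then have "form a y \<noteq> 0 \<or> form b y \<noteq> 0" using s(2) by auto
  then obtain v where v: "v \<in> h" "v \<in> lpart L d" "form v y \<noteq> 0"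
    using ab form_degree[OF _ y(2)] by blast
  define x where "x = lscale L (1 / form v y) v"
  have x: "x \<in> h" "x \<in> lpart L d" "form x y = 1"
    using v y hD(2) g_lspace vs.subspace_scale[OF h_sub] vs.subspace_scale[OF part_subspace]
    by (auto simp: x_def form_scale_left subsetD)
  have xg: "x \<in> g" using x hD(2) by blast
  note move = g y y_core yy h x
  let ?h0 = "h \<inter> orth g y" and ?h1 = "{v. \<exists>c. v - lscale L c y \<in> h \<inter> orth g y}"
  note h0g = inter_orth_graded[OF move]
  have h0: "?h0 \<subseteq> g" using hD(2) by blast
  have h1: "polarization_on g ?h1" "?h1 \<subseteq> orth g y" using moved_polarization[OF move] by auto
  have h_eq: "h = {v. \<exists>c. v - lscale L c x \<in> ?h0}" by (rule polarization_decompose[OF move])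
  have h1g: "?h1 \<subseteq> g" using polarization_onD(2)[OF h1(1)] .
  \<comment> \<open>the multiple of \<open>x\<close> that is dual to \<open>y\<close> with the arguments of the form in the other order\<close>
  define z where "z = lscale L (1 / form y x) x"
  have yx: "form y x \<noteq> 0" using form_antisym[OF y(2) x(2)] x(3) by (simp add: koszul_def)
  have z: "z \<in> g" "z \<in> lpart L d" "form y z = 1"
    using xg x y yx g_lspace vs.subspace_scale[OF g_subspace] vs.subspace_scale[OF part_subspace]
    by (auto simp: z_def form_scale_right)
  note s0 = gradedD(1)[OF h0g]
  have nx: "lbracket L t x \<in> ?h0" "form t x = 0" if "t \<in> h" for t
    using that subalgebraD(2)[OF hD(1) that x(1)] bracket_in_orth[OF g y y_core, of t x] hD(2) xg hD(3) x(1)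
    by blast+
  have ny: "lbracket L t y \<in> ?h0" "form t y = 0" if "t \<in> ?h0" for t
    using that core_inter_orth[OF move] y_core h0 by (auto simp: orth_def[OF g])
  have xy: "lbracket L x y \<in> ?h0" using y_core[OF xg] core_inter_orth[OF move] by blast
  have bz: "lbracket L t z = lscale L (1 / form y x) (lbracket L t x)" "form t z = form t x / form y x"
    if "t \<in> g" for t
    unfolding z_def using that xg g_lspace bracket_scale_right form_scale_right by auto
  have "char_ann g D h \<subseteq> char_ideal g D ?h0"
    using xg x y xy nx[OF x(1)] nx ny
    by (intro char_ann_adjoin[OF nilpotent h0g h0 _ _ x(3) xy _ _ _ _ _ _ h_eq hD(2)]) auto
  moreover have "char_ann g D ?h1 \<subseteq> char_ideal g D ?h0"
  proof (rule char_ann_adjoin[OF nilpotent h0g h0 _ _ z(3) _ _ yy _ _ _ _ refl h1g])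
    show "lbracket L y z \<in> ?h0"
      using core_bracket_left[OF g y y_core z(1)] core_inter_orth[OF move] by blast
    show "lbracket L y y \<in> ?h0" using y_core[OF y(1)] core_inter_orth[OF move] by blast
    show "lbracket L t z \<in> ?h0" "form t z = 0" if "t \<in> ?h0" for t
      using that nx[of t] bz[of t] h0 vs.subspace_scale[OF s0] by auto
  qed (use y z ny in auto)
  moreover have "char_ideal g D ?h0 \<subseteq> char_ideal g D h" by (rule char_ideal_mono) (use hD(2) in auto)
  moreover have "char_ideal g D ?h0 \<subseteq> char_ideal g D ?h1"
    by (rule char_ideal_mono[OF _ h1g]) (auto intro!: exI[of _ 0])
  ultimately have "char_ann g D h \<subseteq> char_ann g D ?h1" "char_ann g D ?h1 \<subseteq> char_ann g D h"
    by (auto intro!: char_ann_leI)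
  then show ?thesis using h1 by blast
qed

text \<open>Both polarizations are moved into the orthogonal of \<open>y\<close>, the ideal is enlarged to \<open>E\<close> so that the core
  acts by \<open>lam\<close>, which changes neither left ideal as the core lies in every polarization, and the
  induction hypothesis is applied to \<open>orth g y\<close> with the restriction of \<open>E\<close>.\<close>

theorem char_ann_independent:
  "rank_le g n \<Longrightarrow> lie_subalgebra L g \<Longrightarrow> env_ideal_on g D \<Longrightarrow>
    polarization_on g h \<Longrightarrow> polarization_on g h' \<Longrightarrow> char_ann g D h \<subseteq> char_ann g D h'"
proof (induction n arbitrary: g D h h' rule: less_induct)
  case (less n)
  note g = less.prems(2) and D = less.prems(3) and h = less.prems(4) and h' = less.prems(5)
  show ?case
  proof (cases "h = h'")
    case False
    obtain d y where y: "y \<in> g" "y \<in> lpart L d" "\<And>b. b \<in> g \<Longrightarrow> lbracket L b y \<in> core g"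
      "\<exists>b\<in>g. form b y \<noteq> 0" "form y y = 0"
      using exists_isotropic_near_center[OF g h h' False] by auto
    interpret env_on L lam g D by unfold_locales (use g D in auto)
    obtain h1 where h1: "polarization_on g h1" "h1 \<subseteq> orth g y" "char_ann g D h1 = char_ann g D h"
      using move_polarization[OF g D h y(1,2,3,5)] by blast
    obtain h2 where h2: "polarization_on g h2" "h2 \<subseteq> orth g y" "char_ann g D h2 = char_ann g D h'"
      using move_polarization[OF g D h' y(1,2,3,5)] by blast
    obtain b where b: "b \<in> g" "form b y \<noteq> 0" using y(4) by blast
    obtain b0 b1 where b01: "b0 \<in> g \<inter> lpart L 0" "b1 \<in> g \<inter> lpart L 1" "b = b0 + b1"
      using gradedD(3)[OF g_graded b(1)] by blast
    have "form b y = form b0 y + form b1 y" unfolding b01(3) using b01 y g_lspace by (intro form_add_left) auto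
    then have "form b0 y \<noteq> 0 \<or> form b1 y \<noteq> 0" using b(2) by auto
    then obtain v where v: "v \<in> g" "v \<in> lpart L d" "form v y \<noteq> 0"
      using b01 form_degree[OF _ y(2)] by blast
    define x where "x = lscale L (1 / form v y) v"
    have x: "x \<in> g" "x \<in> lpart L d" "form x y = 1"
      using v y g_lspace vs.subspace_scale[OF g_subspace] vs.subspace_scale[OF part_subspace]
      by (auto simp: x_def form_scale_left)
    define E where "E = char_ideal g D (core g)"
    have E: "env_ideal_on g E" unfolding E_def
      by (rule char_ideal_env[OF core_graded[OF g] core_subset[OF g]]) (use core_bracket[OF g] in auto)
    have core_E: "fgen t - fconst (lam t) \<in> E" if "t \<in> core g" for t
      unfolding E_def using char_gen_mem'[OF core_graded[OF g] core_subset[OF g] that] .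
    interpret nc: near_center L lam g E y x d
      by unfold_locales (use g E y x core_E in auto)
    have ann_E: "char_ann g E k = char_ann g D k" if "polarization_on g k" for k
      unfolding char_ann_def E_def using char_ideal_absorb[OF core_polarization[OF g that]] by simp
    have "b \<notin> orth g y" using b by (simp add: orth_def[OF g])
    then obtain m where m: "m < n" "rank_le (orth g y) m"
      using rank_le_psubset[OF less.prems(1) gradedD(1)[OF nc.orth_y_graded] nc.orth_y_subset b(1)] by blast
    have pol: "polarization_on (orth g y) k" if "polarization_on g k" "k \<subseteq> orth g y" for k
      using that nc.orth_y_subset unfolding polarization_on_def by blast
    have "char_ann (orth g y) nc.restricted h1 \<subseteq> char_ann (orth g y) nc.restricted h2"
      using less.IH[OF m nc.orth_y_subalgebra nc.restricted_env pol[OF h1(1,2)] pol[OF h2(1,2)]] .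
    from nc.char_ann_from_orth[OF h1(2) h2(2) this]
    show ?thesis unfolding ann_E[OF h1(1)] ann_E[OF h2(1)] h1(3) h2(3) .
  qed simp
qed

end

section \<open>The enveloping algebra as a quotient of the free algebra\<close>

lemma free_algebra_simps:
  "carrier (free_algebra S) = words_on S" "x \<otimes>\<^bsub>free_algebra S\<^esub> y = x * y"
  "x \<oplus>\<^bsub>free_algebra S\<^esub> y = x + y" "\<zero>\<^bsub>free_algebra S\<^esub> = 0" "\<one>\<^bsub>free_algebra S\<^esub> = 1"
  by (simp_all add: free_algebra_def words_on_def)

lemma free_algebra_ring: "ring (free_algebra S :: ('a fword \<Rightarrow>\<^sub>0 'k::ring_1) ring)"
proof -
  interpret A: unital_subring "words_on S :: ('a fword \<Rightarrow>\<^sub>0 'k) set" by (rule words_on_unital_subring)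
  show ?thesis
  proof (rule ringI)
    show "abelian_group (free_algebra S :: ('a fword \<Rightarrow>\<^sub>0 'k) ring)"
      by (rule abelian_groupI)
        (auto simp: free_algebra_simps algebra_simps intro: A.add_mem A.zero_mem
          intro!: bexI[of _ "- _"] A.uminus_mem)
    show "monoid (free_algebra S :: ('a fword \<Rightarrow>\<^sub>0 'k) ring)"
      by (rule monoidI) (auto simp: free_algebra_simps algebra_simps intro: A.mult_mem A.one_mem)
  qed (auto simp: free_algebra_simps algebra_simps)
qed

lemma ideal_imp_two_sided:
  assumes "ideal I (free_algebra S :: ('a fword \<Rightarrow>\<^sub>0 'k::ring_1) ring)"
  shows "two_sided_ideal_of (words_on S) I"
proof -
  interpret A: unital_subring "words_on S :: ('a fword \<Rightarrow>\<^sub>0 'k) set" by (rule words_on_unital_subring)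
  interpret I: ideal I "free_algebra S" by (rule assms)
  show ?thesis
    by unfold_locales
      (use I.a_subset additive_subgroup.zero_closed[OF I.is_additive_subgroup]
        additive_subgroup.a_closed[OF I.is_additive_subgroup] I.I_l_closed I.I_r_closed
        in \<open>auto simp: free_algebra_simps\<close>)
qed

lemma two_sided_imp_ideal:
  assumes "two_sided_ideal_of (words_on S) I"
  shows "ideal I (free_algebra S :: ('a fword \<Rightarrow>\<^sub>0 'k::ring_1) ring)"
proof -
  interpret I: two_sided_ideal_of "words_on S" I by (rule assms)
  interpret F: ring "free_algebra S :: ('a fword \<Rightarrow>\<^sub>0 'k) ring" by (rule free_algebra_ring)
  have "subgroup I (add_monoid (free_algebra S :: ('a fword \<Rightarrow>\<^sub>0 'k) ring))"
  proof (rule F.add.subgroupI)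
    show "I \<subseteq> carrier (free_algebra S)" using I.subset by (simp add: free_algebra_simps)
    show "I \<noteq> {}" using I.zero_ideal by blast
    show "\<ominus>\<^bsub>free_algebra S\<^esub> a \<in> I" if "a \<in> I" for a
    proof -
      have "\<ominus>\<^bsub>free_algebra S\<^esub> a = - a"
        using that I.subset I.uminus_mem by (intro F.minus_equality) (auto simp: free_algebra_simps)
      then show ?thesis using I.uminus_ideal[OF that] by simp
    qed
    show "a \<oplus>\<^bsub>free_algebra S\<^esub> b \<in> I" if "a \<in> I" "b \<in> I" for a b
      using I.add_ideal[OF that] by (simp add: free_algebra_simps)
  qed
  then show ?thesis
    by (intro idealI free_algebra_ring) (auto simp: free_algebra_simps I.lmult_ideal I.rmult_ideal)
qed

lemma genideal_two_sided:
  assumes "R \<subseteq> (words_on S :: ('a fword \<Rightarrow>\<^sub>0 'k::ring_1) set)"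
  shows "two_sided_ideal_of (words_on S) (genideal (free_algebra S) R)" "R \<subseteq> genideal (free_algebra S) R"
proof -
  have R: "R \<subseteq> carrier (free_algebra S)" using assms by (simp add: free_algebra_simps)
  show "two_sided_ideal_of (words_on S) (genideal (free_algebra S) R)"
    by (rule ideal_imp_two_sided[OF ring.genideal_ideal[OF free_algebra_ring R]])
  show "R \<subseteq> genideal (free_algebra S) R"
    by (rule ring.genideal_self[OF free_algebra_ring R])
qed

lemma genideal_least:
  assumes "two_sided_ideal_of (words_on S) I" "R \<subseteq> I"
  shows "genideal (free_algebra S) R \<subseteq> (I :: ('a fword \<Rightarrow>\<^sub>0 'k::ring_1) set)"
  using ring.genideal_minimal[OF free_algebra_ring two_sided_imp_ideal[OF assms(1)] assms(2)] .

lemma env_coset_eq: "env_coset L p = {q. q - p \<in> env_ideal L}"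
proof -
  have "env_coset L p = {i + p | i. i \<in> env_ideal L}"
    unfolding env_coset_def a_r_coset_def' by (auto simp: free_algebra_simps)
  then show ?thesis by (force intro: exI[of _ "_ - p"])
qed

section \<open>The induced module as a quotient by a left ideal\<close>

interpretation pm: vector_space "pm_scale :: 'k::field \<Rightarrow> ('x \<Rightarrow>\<^sub>0 'k) \<Rightarrow> ('x \<Rightarrow>\<^sub>0 'k)"
proof
  have l: "Poly_Mapping.lookup (pm_scale c p) k = c * Poly_Mapping.lookup p k"
    for c :: 'k and p :: "'x \<Rightarrow>\<^sub>0 'k" and k
    by (simp add: pm_scale_def Poly_Mapping.map.rep_eq when_def)
  fix a b :: 'k and x y :: "'x \<Rightarrow>\<^sub>0 'k"
  show "pm_scale a (x + y) = pm_scale a x + pm_scale a y"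
    "pm_scale (a + b) x = pm_scale a x + pm_scale b x"
    "pm_scale a (pm_scale b x) = pm_scale (a * b) x" "pm_scale 1 x = x"
    by (rule poly_mapping_eqI; simp add: l lookup_add algebra_simps)+
qed

lemma pm_scale_single: "pm_scale c (Poly_Mapping.single k a) = Poly_Mapping.single k (c * a)"
  by (simp add: pm_scale_def)

lemma keys_pm_scale: "Poly_Mapping.keys (pm_scale c p) \<subseteq> Poly_Mapping.keys p"
  by (auto simp: in_keys_iff pm_scale_def Poly_Mapping.map.rep_eq)

locale char_induced = lie_functional L lam
  for L :: "('k::field_char_0, 'g::ab_group_add) super_lie" and lam +
  fixes h :: "'g set" and i :: bit
  assumes h_pol: "polarization_on (lspace L) h"
begin

abbreviation A :: "('g fword \<Rightarrow>\<^sub>0 'k) set" where "A \<equiv> words_on (lspace L)"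
abbreviation I :: "('g fword \<Rightarrow>\<^sub>0 'k) set" where "I \<equiv> env_ideal L"
abbreviation U where "U \<equiv> env_algebra L"
abbreviation J where "J \<equiv> char_ideal (lspace L) I h"
abbreviation W :: "('k, 'g, 'k) super_rep" where "W \<equiv> char_rep lam i"

lemma lspace_subalgebra: "lie_subalgebra L (lspace L)"
  unfolding lie_subalgebra_def using lspace_graded bracket_mem by blast

lemma env_relations_A: "env_relations L \<subseteq> A"
  using env_relations_words[OF lspace_subalgebra] unfolding restrict_lie_lspace .

lemma I_two_sided: "two_sided_ideal_of A I"
  unfolding env_ideal_def by (rule genideal_two_sided[OF env_relations_A])

sublocale I: two_sided_ideal_of A I by (rule I_two_sided)

lemma env_relations_I: "env_relations L \<subseteq> I"
  unfolding env_ideal_def by (rule genideal_two_sided[OF env_relations_A])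

lemma parity_add: "x \<in> lspace L \<Longrightarrow> y \<in> lspace L \<Longrightarrow> parity (x + y) = parity x + parity y"
proof -
  assume xy: "x \<in> lspace L" "y \<in> lspace L"
  obtain a b where a: "a \<in> lpart L 0" "b \<in> lpart L 1" "x = a + b" by (rule lspaceE[OF xy(1)])
  obtain a' b' where b: "a' \<in> lpart L 0" "b' \<in> lpart L 1" "y = a' + b'" by (rule lspaceE[OF xy(2)])
  have "parity ((a + a') + (b + b')) = (a + a') - (b + b')"
    using a b vs.subspace_add[OF part_subspace] by (intro parity_eq) auto
  then show ?thesis using a b by (simp add: parity_eq algebra_simps)
qed

lemma parity_scale: "x \<in> lspace L \<Longrightarrow> parity (lscale L c x) = lscale L c (parity x)"
proof -
  assume x: "x \<in> lspace L"
  obtain a b where a: "a \<in> lpart L 0" "b \<in> lpart L 1" "x = a + b" by (rule lspaceE[OF x])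
  have "parity (lscale L c a + lscale L c b) = lscale L c a - lscale L c b"
    using a vs.subspace_scale[OF part_subspace] by (intro parity_eq) auto
  then show ?thesis using a by (simp add: parity_eq vs.scale_right_distrib vs.scale_right_diff_distrib)
qed

lemma parity_part: "x \<in> lpart L d \<Longrightarrow> parity x = (if d = 0 then x else - x)"
  using bit_exhaust[of d] parity_even parity_odd by auto

lemma parity_bracket:
  assumes "x \<in> lpart L d" "y \<in> lpart L e"
  shows "parity (lbracket L x y) = lbracket L (parity x) (parity y)"
proof -
  have l: "x \<in> lspace L" "y \<in> lspace L" "- y \<in> lspace L"
    using assms part_in_lspace vs.subspace_neg[OF lspace_subspace] by blast+
  have m: "lbracket L (- v) w = - lbracket L v w" "lbracket L v (- w) = - lbracket L v w"
    if "v \<in> lspace L" "w \<in> lspace L" for v w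
    using bracket_scale_left[OF that, of "- 1"] bracket_scale_right[OF that, of "- 1"] by simp_all
  have "parity (lbracket L x y) = (if d + e = 0 then lbracket L x y else - lbracket L x y)"
    by (rule parity_part[OF bracket_degree[OF assms]])
  then show ?thesis
    using parity_part[OF assms(1)] parity_part[OF assms(2)] m l bit_exhaust[of d] bit_exhaust[of e] by auto
qed

text \<open>The parity automorphism maps each defining relation to another one, so the ideal is graded.\<close>

lemma env_ideal_on_lspace: "env_ideal_on (lspace L) I"
proof -
  let ?P = "{p \<in> A. map_letters parity p \<in> I}"
  have mA: "map_letters parity p \<in> A" if "p \<in> A" for p
    using map_letters_in_words[OF that] parity_mem[OF lspace_graded] by blast
  have "two_sided_ideal_of A ?P"
    by unfold_locales
      (auto simp: map_letters_add map_letters_mult map_letters_fconst[of _ 0, simplified]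
        intro: I.zero_mem I.zero_ideal I.add_mem I.add_ideal I.mult_mem I.lmult_ideal I.rmult_ideal mA)
  moreover have "map_letters parity r \<in> env_relations L" if r: "r \<in> env_relations L" for r
  proof -
    have rel_add: "fgen (x + y) - fgen x - fgen y \<in> env_relations L" if "x \<in> lspace L" "y \<in> lspace L" for x y
      unfolding env_relations_def using that by blast
    have rel_scale: "fgen (lscale L c x) - fconst c * fgen x \<in> env_relations L" if "x \<in> lspace L" for c x
      unfolding env_relations_def using that by blast
    have rel_comm: "fgen x * fgen y - fconst (koszul d e) * (fgen y * fgen x) - fgen (lbracket L x y)
        \<in> env_relations L" if "x \<in> lpart L d" "y \<in> lpart L e" for x y d e
      unfolding env_relations_def using that by blast
    note simps = map_letters_diff map_letters_fgen map_letters_mult map_letters_fconst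
    have part: "parity x \<in> lpart L d" if "x \<in> lpart L d" for x d
      using that parity_part vs.subspace_neg[OF part_subspace] by auto
    from r consider (add) x y where "r = fgen (x + y) - fgen x - fgen y" "x \<in> lspace L" "y \<in> lspace L"
      | (scale) c x where "r = fgen (lscale L c x) - fconst c * fgen x" "x \<in> lspace L"
      | (comm) x y d e where "x \<in> lpart L d" "y \<in> lpart L e"
        "r = fgen x * fgen y - fconst (koszul d e) * (fgen y * fgen x) - fgen (lbracket L x y)"
      unfolding env_relations_def by blast
    then show ?thesis
    proof cases
      case (add x y)
      then show ?thesis
        using rel_add[of "parity x" "parity y"]
        by (simp add: simps parity_add parity_mem[OF lspace_graded])
    next
      case (scale c x)
      then show ?thesis
        using rel_scale[of "parity x" c]
        by (simp add: simps parity_scale parity_mem[OF lspace_graded])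
    next
      case (comm x y d e)
      then show ?thesis
        using rel_comm[OF part[OF comm(1)] part[OF comm(2)]]
        by (simp add: simps parity_bracket)
    qed
  qed
  then have "env_relations L \<subseteq> ?P" using env_relations_A env_relations_I by blast
  ultimately have "I \<subseteq> ?P" unfolding env_ideal_def[of L] by (rule genideal_least)
  then show ?thesis
    unfolding env_ideal_on_def restrict_lie_lspace using I_two_sided env_relations_I by blast
qed

sublocale E: env_on L lam "lspace L" I
  by unfold_locales (use lspace_subalgebra env_ideal_on_lspace in auto)

lemmas hD = polarization_onD[OF h_pol]
lemmas h_graded = subalgebraD(1)[OF hD(1)]

sublocale J: left_ideal_of A J by (rule E.char_ideal_left_ideal[OF hD(2)])

lemma I_J: "I \<subseteq> J" by (rule E.D_char_ideal)

abbreviation coset :: "('g fword \<Rightarrow>\<^sub>0 'k) \<Rightarrow> ('g fword \<Rightarrow>\<^sub>0 'k) set" where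
  "coset \<equiv> env_coset L"

lemma coset_cong: "coset p = coset q \<longleftrightarrow> p - q \<in> I"
proof
  assume "coset p = coset q"
  moreover have "p \<in> coset p" using I.zero_ideal by (simp add: env_coset_eq)
  ultimately have "p \<in> coset q" by simp
  then show "p - q \<in> I" by (simp add: env_coset_eq)
next
  assume "p - q \<in> I"
  then show "coset p = coset q"
    unfolding env_coset_eq using I.diff_trans I.diff_sym by blast
qed

lemma U_ideal: "ideal I (free_algebra (lspace L))"
  by (rule two_sided_imp_ideal[OF I_two_sided])

lemma U_simps:
  "carrier U = coset ` A"
  "p \<in> A \<Longrightarrow> q \<in> A \<Longrightarrow> coset p \<otimes>\<^bsub>U\<^esub> coset q = coset (p * q)"
  "p \<in> A \<Longrightarrow> q \<in> A \<Longrightarrow> coset p \<oplus>\<^bsub>U\<^esub> coset q = coset (p + q)"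
  "p \<in> A \<Longrightarrow> c \<odot>\<^bsub>U\<^esub> coset p = coset (fconst c * p)"
proof -
  interpret id: ideal I "free_algebra (lspace L)" by (rule U_ideal)
  show "carrier U = coset ` A"
    by (auto simp: env_algebra_def Let_def FactRing_def A_RCOSETS_def' free_algebra_simps env_coset_def)
  show m: "coset p \<otimes>\<^bsub>U\<^esub> coset q = coset (p * q)" if "p \<in> A" "q \<in> A" for p q
    using id.rcoset_mult_add[of p q] that
    by (simp add: env_algebra_def Let_def FactRing_def free_algebra_simps env_coset_def)
  show "coset p \<oplus>\<^bsub>U\<^esub> coset q = coset (p + q)" if "p \<in> A" "q \<in> A" for p q
    using id.a_rcos_sum[of p q] that
    by (simp add: env_algebra_def Let_def FactRing_def free_algebra_simps env_coset_def)
  show "c \<odot>\<^bsub>U\<^esub> coset p = coset (fconst c * p)" if "p \<in> A" for p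
    using m[OF fconst_in_words that, of c] by (simp add: env_algebra_def Let_def)
qed

definition char_value :: "('g fword \<Rightarrow>\<^sub>0 'k) \<Rightarrow> 'k" where
  "char_value = linear_extension (\<lambda>v c. c * prod_list (map lam (letters v)))"

lemma char_value_add: "char_value (p + q) = char_value p + char_value q"
  unfolding char_value_def by (rule linear_extension_add) (auto simp: distrib_right)

lemma char_value_single: "char_value (Poly_Mapping.single w c) = c * prod_list (map lam (letters w))"
  unfolding char_value_def by (rule linear_extension_single) simp

lemma char_value_mult: "char_value (p * q) = char_value p * char_value q"
proof (induction p rule: poly_mapping_single_induct)
  case (single v a)
  show ?case
    by (induction q rule: poly_mapping_single_induct)
      (simp_all add: mult_single char_value_single char_value_add plus_fword_def distrib_left)
qed (simp add: distrib_right char_value_add)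

lemma char_value_simps:
  "char_value (fconst c) = c" "char_value (fgen x) = lam x"
  "char_value (p - q) = char_value p - char_value q"
  using char_value_add[of "p - q" q] by (simp_all add: char_value_single zero_fword_def)

abbreviation H where "H \<equiv> env_algebra (restrict_lie L h)"
abbreviation I\<^sub>h :: "('g fword \<Rightarrow>\<^sub>0 'k) set" where "I\<^sub>h \<equiv> env_ideal (restrict_lie L h)"

lemma h_words: "words_on h \<subseteq> A" by (rule words_on_mono[OF hD(2)])

lemma env_ideal_h_least:
  "two_sided_ideal_of (words_on h) K \<Longrightarrow> env_relations (restrict_lie L h) \<subseteq> K \<Longrightarrow> I\<^sub>h \<subseteq> K"
  unfolding env_ideal_def restrict_lspace[OF h_graded] by (rule genideal_least)

lemma I\<^sub>h_subset: "I\<^sub>h \<subseteq> I" "I\<^sub>h \<subseteq> words_on h"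
proof -
  interpret B: unital_subring "words_on h :: ('g fword \<Rightarrow>\<^sub>0 'k) set" by (rule words_on_unital_subring)
  have "two_sided_ideal_of (words_on h) (I \<inter> words_on h)"
    by unfold_locales
      (use h_words in \<open>auto intro: I.zero_ideal B.zero_mem I.add_ideal B.add_mem I.lmult_ideal
          I.rmult_ideal B.mult_mem\<close>)
  moreover have "env_relations (restrict_lie L h) \<subseteq> I"
    using env_relations_mono[OF h_graded lspace_graded hD(2)] env_relations_I
    unfolding restrict_lie_lspace by blast
  moreover have "env_relations (restrict_lie L h) \<subseteq> words_on h" by (rule env_relations_words[OF hD(1)])
  ultimately have "I\<^sub>h \<subseteq> I \<inter> words_on h" by (intro env_ideal_h_least) auto
  then show "I\<^sub>h \<subseteq> I" "I\<^sub>h \<subseteq> words_on h" by auto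
qed

text \<open>The character \<open>lam\<close> of \<open>h\<close> respects the relations of the enveloping algebra of \<open>h\<close>: it vanishes on
  brackets because \<open>h\<close> is isotropic, and the signs do not matter as it vanishes on odd vectors.\<close>

lemma char_value_I\<^sub>h: "p \<in> I\<^sub>h \<Longrightarrow> char_value p = 0"
proof -
  interpret B: unital_subring "words_on h :: ('g fword \<Rightarrow>\<^sub>0 'k) set" by (rule words_on_unital_subring)
  let ?K = "{p \<in> words_on h. char_value p = 0}"
  have "two_sided_ideal_of (words_on h) ?K"
    by unfold_locales
      (auto simp: char_value_add char_value_mult char_value_simps(1)[of 0, simplified]
        intro: B.zero_mem B.add_mem B.mult_mem)
  moreover have "char_value r = 0" if r: "r \<in> env_relations (restrict_lie L h)" for r
    using r unfolding env_relations_def restrict_lspace[OF h_graded] restrict_simps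
  proof (elim UnE)
    assume "r \<in> {fgen (x + y) - fgen x - fgen y |x y. x \<in> h \<and> y \<in> h}"
    then obtain x y where "r = fgen (x + y) - fgen x - fgen y" "x \<in> lspace L" "y \<in> lspace L"
      using hD(2) by blast
    then show ?thesis by (simp add: char_value_simps lam_add)
  next
    assume "r \<in> {fgen (lscale L c x) - fconst c * fgen x |c x. x \<in> h}"
    then obtain c x where "r = fgen (lscale L c x) - fconst c * fgen x" "x \<in> lspace L"
      using hD(2) by blast
    then show ?thesis by (simp add: char_value_simps char_value_mult lam_scale)
  next
    assume "r \<in> {fgen x * fgen y - fconst (koszul d e) * (fgen y * fgen x) - fgen (lbracket L x y)
      |x y d e. x \<in> h \<inter> lpart L d \<and> y \<in> h \<inter> lpart L e}"
    then obtain x y d e where r: "r = fgen x * fgen y - fconst (koszul d e) * (fgen y * fgen x) - fgen (lbracket L x y)"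
      and xy: "x \<in> h" "x \<in> lpart L d" "y \<in> h" "y \<in> lpart L e" by blast
    have "char_value r = lam x * lam y - koszul d e * (lam y * lam x)"
      unfolding r using hD(3)[OF xy(1,3)] by (simp add: char_value_simps char_value_mult)
    also have "\<dots> = 0"
      using lam_odd xy by (cases "d = 1") (auto simp: koszul_def)
    finally show ?thesis .
  qed
  then have "env_relations (restrict_lie L h) \<subseteq> ?K" using env_relations_words[OF hD(1)] by blast
  ultimately have "I\<^sub>h \<subseteq> ?K" by (rule env_ideal_h_least)
  then show "p \<in> I\<^sub>h \<Longrightarrow> char_value p = 0" by blast
qed

lemma H_carrier: "carrier H = env_coset (restrict_lie L h) ` words_on h"
  by (auto simp: env_algebra_def Let_def FactRing_def A_RCOSETS_def' free_algebra_simps env_coset_def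
      restrict_lspace[OF h_graded])

lemma I\<^sub>h_zero: "0 \<in> I\<^sub>h"
proof -
  have "two_sided_ideal_of (words_on h) I\<^sub>h"
    unfolding env_ideal_def restrict_lspace[OF h_graded]
    by (rule genideal_two_sided[OF env_relations_words[OF hD(1)]])
  then show ?thesis using left_ideal_of.zero_ideal two_sided_ideal_of.axioms(1) by blast
qed

lemma env_incl_coset: "env_incl L (env_coset (restrict_lie L h) q) = coset q"
proof -
  have "coset p = coset q" if "p \<in> env_coset (restrict_lie L h) q" for p
    using that I\<^sub>h_subset(1) by (auto simp: env_coset_eq[of "restrict_lie L h"] coset_cong)
  moreover have "q \<in> env_coset (restrict_lie L h) q" using I\<^sub>h_zero by (simp add: env_coset_eq)
  ultimately show ?thesis unfolding env_incl_def by blast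
qed

text \<open>The character is constant on the class, so the image in the definition of the action is a singleton.\<close>

lemma env_act_coset: "env_act W (env_coset (restrict_lie L h) q) w = char_value q * w"
proof -
  have f: "foldr (ract W) l w = prod_list (map lam l) * w" for l
    by (induction l) (simp_all add: char_rep_def mult.assoc)
  define F where "F p = (\<Sum>v\<in>Poly_Mapping.keys p.
    rscale W (Poly_Mapping.lookup p v) (foldr (ract W) (letters v) w))" for p
  have F_value: "F p = char_value p * w" for p
    unfolding F_def f char_value_def linear_extension_def by (simp add: char_rep_def sum_distrib_right mult.assoc)
  have const: "F p = char_value q * w" if "p \<in> env_coset (restrict_lie L h) q" for p
    unfolding F_value using char_value_I\<^sub>h[of "p - q"] that by (simp add: env_coset_eq char_value_simps)
  have "q \<in> env_coset (restrict_lie L h) q" using I\<^sub>h_zero by (simp add: env_coset_eq)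
  from imageI[OF this, of F] have "F ` env_coset (restrict_lie L h) q = {char_value q * w}"
    using const by (intro subset_antisym subsetI) (blast, simp add: F_value)
  then show ?thesis unfolding env_act_def F_def by simp
qed

lemma char_value_J: "q \<in> words_on h \<Longrightarrow> q - fconst (char_value q) \<in> J"
proof (induction rule: words_on_induct)
  case (const c)
  then show ?case using J.zero_ideal by (simp add: char_value_simps)
next
  case (add p q)
  have "(p - fconst (char_value p)) + (q - fconst (char_value q)) \<in> J"
    using add by (intro J.add_ideal)
  then show ?case by (simp add: char_value_add single_add algebra_simps)
next
  case (gen x p)
  have "x \<in> lspace L" using gen(1) hD(2) by blast
  then have "fgen x \<in> A" by (rule fgen_in_words)
  then have "fgen x * (p - fconst (char_value p)) + fconst (char_value p) * (fgen x - fconst (lam x)) \<in> J"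
    using gen(3) E.char_gen_mem'[OF h_graded hD(2) gen(1)] fconst_in_words
    by (intro J.add_ideal J.lmult_ideal)
  moreover have "fgen x * p - fconst (char_value (fgen x * p))
      = fgen x * (p - fconst (char_value p)) + fconst (char_value p) * (fgen x - fconst (lam x))"
    by (simp add: char_value_mult char_value_simps(2) right_diff_distrib
        fconst_central[of "char_value p" "fgen x"] fconst_mult[symmetric] mult.commute[of "lam x"])
  ultimately show ?case by simp
qed

lemma underlying_W: "underlying (rpart W) = UNIV"
proof -
  have "\<exists>a b. x = a + b \<and> a \<in> rpart W 0 \<and> b \<in> rpart W 1" for x :: 'k
    using bit_exhaust[of i]
    by (auto simp: char_rep_def intro: exI[of _ x] exI[of _ 0])
  then show ?thesis unfolding underlying_def by blast
qed

abbreviation N where "N \<equiv> tensor_null L h W"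

text \<open>Cosets are multiplied out through chosen representatives; another choice changes the result by an
  element of \<open>I\<close> only (\<open>multiply_out_coset\<close>).\<close>

definition representative :: "('g fword \<Rightarrow>\<^sub>0 'k) set \<Rightarrow> ('g fword \<Rightarrow>\<^sub>0 'k)" where
  "representative u = (SOME p. p \<in> A \<and> u = coset p)"

lemma representative: "u \<in> carrier U \<Longrightarrow> representative u \<in> A \<and> u = coset (representative u)"
  unfolding representative_def U_simps(1) by (rule someI_ex) blast

lemma representative_coset: "p \<in> A \<Longrightarrow> representative (coset p) - p \<in> I"
  using representative[of "coset p"] coset_cong U_simps(1) by (metis imageI)

definition multiply_out :: "(('g fword \<Rightarrow>\<^sub>0 'k) set \<times> 'k \<Rightarrow>\<^sub>0 'k) \<Rightarrow> ('g fword \<Rightarrow>\<^sub>0 'k)" where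
  "multiply_out = linear_extension (\<lambda>(u, w) c. fconst (c * w) * representative u)"

lemma multiply_out_add: "multiply_out (f + g) = multiply_out f + multiply_out g"
  unfolding multiply_out_def
  by (rule linear_extension_add) (auto simp: distrib_right single_add)

lemma multiply_out_single: "multiply_out (Poly_Mapping.single (u, w) c) = fconst (c * w) * representative u"
  unfolding multiply_out_def by (subst linear_extension_single) auto

lemma multiply_out_diff: "multiply_out (f - g) = multiply_out f - multiply_out g"
  using multiply_out_add[of "f - g" g] by (simp add: algebra_simps)

lemma multiply_out_scale: "multiply_out (pm_scale c f) = fconst c * multiply_out f"
proof (induction f rule: poly_mapping_single_induct)
  case (single k a)
  then show ?case
    by (cases k) (simp add: pm_scale_single multiply_out_single fconst_mult mult.assoc)
qed (simp add: pm.scale_right_distrib multiply_out_add distrib_left)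

lemma multiply_out_coset:
  "p \<in> A \<Longrightarrow> multiply_out (Poly_Mapping.single (coset p, w) c) - fconst (c * w) * p \<in> I"
  using I.lmult_ideal[OF fconst_in_words representative_coset, of p "c * w"]
  by (simp add: multiply_out_single right_diff_distrib)

abbreviation T :: "(('g fword \<Rightarrow>\<^sub>0 'k) set \<times> 'k \<Rightarrow>\<^sub>0 'k) set" where "T \<equiv> {f. Poly_Mapping.keys f \<subseteq> carrier U \<times> (UNIV :: 'k set)}"

lemma T_subspace: "pm.subspace T"
proof (rule pm.subspaceI)
  show "f + g \<in> T" if "f \<in> T" "g \<in> T" for f g using that keys_add[of f g] by blast
  show "pm_scale c f \<in> T" if "f \<in> T" for c f using that keys_pm_scale[of c f] by blast
qed simp

lemma T_single: "u \<in> carrier U \<Longrightarrow> Poly_Mapping.single (u, w) c \<in> T" by simp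

lemma tensor_null_subset: "N \<subseteq> {f \<in> T. multiply_out f \<in> J}"
proof -
  let ?K = "{f \<in> T. multiply_out f \<in> J}"
  have sub: "pm.subspace ?K"
  proof (rule pm.subspaceI)
    have "multiply_out 0 = 0" by (simp add: multiply_out_def linear_extension_def)
    then show "0 \<in> ?K" using J.zero_ideal by simp
    show "f + g \<in> ?K" if "f \<in> ?K" "g \<in> ?K" for f g
      using that pm.subspace_add[OF T_subspace] J.add_ideal by (auto simp: multiply_out_add)
    show "pm_scale c f \<in> ?K" if "f \<in> ?K" for c f
      using that pm.subspace_scale[OF T_subspace] J.lmult_ideal[OF fconst_in_words]
      by (auto simp: multiply_out_scale)
  qed
  note tT = pm.subspace_diff[OF T_subspace] pm.subspace_scale[OF T_subspace]
  have mult: "coset p \<in> carrier U" if "p \<in> A" for p using that U_simps(1) by blast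
  have cong: "f \<in> ?K" if "f \<in> T" "multiply_out f - q \<in> I" "q \<in> J" for f q
    using that J.mem_cong I_J by blast
  have m: "multiply_out (tgen (coset p) w) - fconst w * p \<in> I" if "p \<in> A" for p w
    using multiply_out_coset[OF that, of w 1] by simp
  have "tensor_relations L h W \<subseteq> ?K"
    unfolding tensor_relations_def Let_def underlying_W
  proof (intro Un_least subsetI)
    fix f :: "('g fword \<Rightarrow>\<^sub>0 'k) set \<times> 'k \<Rightarrow>\<^sub>0 'k"
    assume "f \<in> {tgen (u \<oplus>\<^bsub>U\<^esub> u') w - tgen u w - tgen u' w |u u' w.
        u \<in> carrier U \<and> u' \<in> carrier U \<and> w \<in> UNIV}"
    then obtain p q w where pq: "p \<in> A" "q \<in> A"
      and f: "f = tgen (coset (p + q)) w - tgen (coset p) w - tgen (coset q) w"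
      using U_simps(1,3) by auto
    have s: "p + q \<in> A" using pq I.add_mem by blast
    show "f \<in> ?K"
    proof (rule cong[OF _ _ J.zero_ideal])
      show "f \<in> T" unfolding f using pq s mult by (intro tT T_single)
      have "(multiply_out (tgen (coset (p + q)) w) - fconst w * (p + q))
          - (multiply_out (tgen (coset p) w) - fconst w * p)
          - (multiply_out (tgen (coset q) w) - fconst w * q) \<in> I"
        by (intro I.diff_ideal m pq s)
      then show "multiply_out f - 0 \<in> I" unfolding f multiply_out_diff by (simp add: algebra_simps)
    qed
  next
    fix f :: "('g fword \<Rightarrow>\<^sub>0 'k) set \<times> 'k \<Rightarrow>\<^sub>0 'k"
    assume "f \<in> {tgen u (w + w') - tgen u w - tgen u w' |u w w'.
        u \<in> carrier U \<and> w \<in> UNIV \<and> w' \<in> UNIV}"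
    then obtain u w w' where u: "u \<in> carrier U" and f: "f = tgen u (w + w') - tgen u w - tgen u w'" by blast
    have "multiply_out f = 0"
      unfolding f multiply_out_diff multiply_out_single by (simp add: single_add algebra_simps)
    moreover have "f \<in> T" unfolding f using u by (intro tT T_single)
    ultimately show "f \<in> ?K" using J.zero_ideal by simp
  next
    fix f :: "('g fword \<Rightarrow>\<^sub>0 'k) set \<times> 'k \<Rightarrow>\<^sub>0 'k"
    assume "f \<in> {tgen (c \<odot>\<^bsub>U\<^esub> u) w - pm_scale c (tgen u w) |c u w. u \<in> carrier U \<and> w \<in> UNIV}"
    then obtain c p w where p: "p \<in> A"
      and f: "f = tgen (coset (fconst c * p)) w - pm_scale c (tgen (coset p) w)"
      using U_simps(1,4) by auto
    have s: "fconst c * p \<in> A" using p I.mult_mem[OF fconst_in_words] by blast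
    show "f \<in> ?K"
    proof (rule cong[OF _ _ J.zero_ideal])
      show "f \<in> T" unfolding f using p s mult by (intro tT T_single)
      have "(multiply_out (tgen (coset (fconst c * p)) w) - fconst w * (fconst c * p))
          - fconst c * (multiply_out (tgen (coset p) w) - fconst w * p) \<in> I"
        by (intro I.diff_ideal m p s I.lmult_ideal[OF fconst_in_words])
      moreover have "fconst w * (fconst c * p) = fconst c * (fconst w * p)"
        by (simp only: mult.assoc[symmetric] fconst_mult[symmetric] mult.commute)
      ultimately show "multiply_out f - 0 \<in> I"
        unfolding f multiply_out_diff multiply_out_scale by (simp add: algebra_simps)
    qed
  next
    fix f :: "('g fword \<Rightarrow>\<^sub>0 'k) set \<times> 'k \<Rightarrow>\<^sub>0 'k"
    assume "f \<in> {tgen u (rscale W c w) - pm_scale c (tgen u w) |c u w. u \<in> carrier U \<and> w \<in> UNIV}"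
    then obtain c u w where u: "u \<in> carrier U" and f: "f = tgen u (c * w) - pm_scale c (tgen u w)"
      by (auto simp: char_rep_def)
    have "multiply_out f = 0"
      unfolding f multiply_out_diff multiply_out_scale multiply_out_single
      by (simp add: fconst_mult mult.assoc)
    moreover have "f \<in> T" unfolding f using u by (intro tT T_single)
    ultimately show "f \<in> ?K" using J.zero_ideal by simp
  next
    fix f :: "('g fword \<Rightarrow>\<^sub>0 'k) set \<times> 'k \<Rightarrow>\<^sub>0 'k"
    assume "f \<in> {tgen (u \<otimes>\<^bsub>U\<^esub> env_incl L a) w - tgen u (env_act W a w) |u a w.
        u \<in> carrier U \<and> a \<in> carrier H \<and> w \<in> UNIV}"
    then obtain u a w where u: "u \<in> carrier U" and a: "a \<in> carrier H"
      and f': "f = tgen (u \<otimes>\<^bsub>U\<^esub> env_incl L a) w - tgen u (env_act W a w)" by blast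
    obtain p where p: "p \<in> A" "u = coset p" using u U_simps(1) by blast
    obtain q where q: "q \<in> words_on h" "a = env_coset (restrict_lie L h) q" using a H_carrier by blast
    have qA: "q \<in> A" using q h_words by blast
    have f: "f = tgen (coset (p * q)) w - tgen (coset p) (char_value q * w)"
      unfolding f' p(2) q(2) env_incl_coset env_act_coset U_simps(2)[OF p(1) qA] ..
    have s: "p * q \<in> A" using p qA I.mult_mem by blast
    have "fconst w * p * (q - fconst (char_value q)) \<in> J"
      using char_value_J[OF q(1)] p I.mult_mem[OF fconst_in_words] by (intro J.lmult_ideal)
    then show "f \<in> ?K"
    proof (rule cong[rotated 2])
      show "f \<in> T" unfolding f using p s mult by (intro tT T_single)
      have "(multiply_out (tgen (coset (p * q)) w) - fconst w * (p * q))
          - (multiply_out (tgen (coset p) (char_value q * w)) - fconst (char_value q * w) * p) \<in> I"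
        by (intro I.diff_ideal m p s)
      moreover have "fconst (char_value q * w) * p = fconst w * p * fconst (char_value q)"
        using fconst_central[of "char_value q" "fconst w * p"] by (simp only: fconst_mult mult.assoc)
      ultimately show "multiply_out f - fconst w * p * (q - fconst (char_value q)) \<in> I"
        unfolding f multiply_out_diff by (simp add: algebra_simps)
    qed
  qed
  then show ?thesis unfolding tensor_null_def by (rule pm.span_minimal[OF _ sub])
qed

lemma N_subspace: "pm.subspace N" unfolding tensor_null_def by (rule pm.subspace_span)

lemma N_relations: "tensor_relations L h W \<subseteq> N" unfolding tensor_null_def by (rule pm.span_superset)

lemmas N_add = pm.subspace_add[OF N_subspace]
lemmas N_diff = pm.subspace_diff[OF N_subspace]
lemmas N_scale = pm.subspace_scale[OF N_subspace]

lemma N_coset_add: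
  assumes "p \<in> A" "q \<in> A"
  shows "tgen (coset (p + q)) w - tgen (coset p) w - tgen (coset q) w \<in> N"
proof -
  have "coset p \<in> carrier U" "coset q \<in> carrier U" using assms U_simps(1) by auto
  then have "tgen (coset p \<oplus>\<^bsub>U\<^esub> coset q) w - tgen (coset p) w - tgen (coset q) w \<in> tensor_relations L h W"
    unfolding tensor_relations_def Let_def underlying_W by blast
  then show ?thesis using N_relations U_simps(3)[OF assms] by auto
qed

lemma N_coset_scale:
  assumes "p \<in> A"
  shows "tgen (coset (fconst c * p)) w - pm_scale c (tgen (coset p) w) \<in> N"
proof -
  have "coset p \<in> carrier U" using assms U_simps(1) by auto
  then have "tgen (c \<odot>\<^bsub>U\<^esub> coset p) w - pm_scale c (tgen (coset p) w) \<in> tensor_relations L h W"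
    unfolding tensor_relations_def Let_def underlying_W by blast
  then show ?thesis using N_relations U_simps(4)[OF assms] by auto
qed

lemma N_scale_right:
  assumes "u \<in> carrier U"
  shows "tgen u (c * w) - pm_scale c (tgen u w) \<in> N"
proof -
  have "tgen u (rscale W c w) - pm_scale c (tgen u w) \<in> tensor_relations L h W"
    unfolding tensor_relations_def Let_def underlying_W using assms by blast
  then show ?thesis using N_relations by (auto simp: char_rep_def)
qed

lemma N_act:
  assumes "p \<in> A" "q \<in> words_on h"
  shows "tgen (coset (p * q)) w - tgen (coset p) (char_value q * w) \<in> N"
proof -
  let ?a = "env_coset (restrict_lie L h) q"
  have "coset p \<in> carrier U" "?a \<in> carrier H" using assms U_simps(1) H_carrier by auto
  then have "tgen (coset p \<otimes>\<^bsub>U\<^esub> env_incl L ?a) w - tgen (coset p) (env_act W ?a w) \<in> tensor_relations L h W"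
    unfolding tensor_relations_def Let_def underlying_W by blast
  moreover have "q \<in> A" using assms(2) h_words by blast
  ultimately show ?thesis
    using N_relations U_simps(2)[OF assms(1), of q] unfolding env_incl_coset env_act_coset by auto
qed

lemma N_zero_coset: "tgen (coset 0) w \<in> N"
  using N_coset_add[OF I.zero_mem I.zero_mem, of w] pm.subspace_neg[OF N_subspace] by fastforce

lemma T_modulo_N:
  assumes "f \<in> T"
  shows "f - tgen (coset (multiply_out f)) 1 \<in> N" "multiply_out f \<in> A"
proof -
  have *: "g - tgen (coset (multiply_out g)) 1 \<in> N \<and> multiply_out g \<in> A"
    if "K \<subseteq> Poly_Mapping.keys f"
      "g = (\<Sum>k\<in>K. Poly_Mapping.single k (Poly_Mapping.lookup f k))" for K g
    using finite_subset[OF that(1) finite_keys] that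
  proof (induction K arbitrary: g rule: finite_induct)
    case empty
    have "multiply_out 0 = 0" by (simp add: multiply_out_def linear_extension_def)
    then show ?case using empty N_zero_coset[of 1] pm.subspace_neg[OF N_subspace] I.zero_mem by simp
  next
    case (insert k K)
    define g' where "g' = (\<Sum>k\<in>K. Poly_Mapping.single k (Poly_Mapping.lookup f k))"
    have IH: "g' - tgen (coset (multiply_out g')) 1 \<in> N" "multiply_out g' \<in> A"
      using insert.IH[OF _ g'_def] insert.prems(1) by auto
    obtain u w where k: "k = (u, w)" by (cases k)
    define c where "c = Poly_Mapping.lookup f k"
    have u: "u \<in> carrier U" using insert.prems(1) assms k by auto
    define p where "p = representative u"
    have p: "p \<in> A" "u = coset p" using representative[OF u] p_def by auto
    define s where "s = Poly_Mapping.single k c"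
    have ms: "multiply_out s = fconst (c * w) * p" unfolding s_def k multiply_out_single p_def ..
    have msA: "fconst (c * w) * p \<in> A" using p I.mult_mem[OF fconst_in_words] by blast
    have 1: "pm_scale c (tgen u (w * 1) - pm_scale w (tgen u 1)) \<in> N"
      using N_scale N_scale_right[OF u] by blast
    have 2: "tgen (coset (fconst (c * w) * p)) 1 - pm_scale (c * w) (tgen u 1) \<in> N"
      using N_coset_scale[OF p(1)] p(2) by simp
    have "s - tgen (coset (multiply_out s)) 1 =
      pm_scale c (tgen u (w * 1) - pm_scale w (tgen u 1))
        - (tgen (coset (fconst (c * w) * p)) 1 - pm_scale (c * w) (tgen u 1))"
      unfolding ms unfolding s_def k by (simp add: pm.scale_right_diff_distrib pm_scale_single)
    then have 3: "s - tgen (coset (multiply_out s)) 1 \<in> N" using N_diff[OF 1 2] by simp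
    have g: "g = s + g'" unfolding insert.prems(2) s_def c_def g'_def using insert.hyps by simp
    have A: "multiply_out s \<in> A" using ms msA by simp
    have "(s - tgen (coset (multiply_out s)) 1) + (g' - tgen (coset (multiply_out g')) 1)
      - (tgen (coset (multiply_out s + multiply_out g')) 1 - tgen (coset (multiply_out s)) 1
          - tgen (coset (multiply_out g')) 1) \<in> N"
      by (intro N_diff N_add 3 IH N_coset_add A)
    then show ?case unfolding g multiply_out_add using I.add_mem[OF A IH(2)] by (simp add: algebra_simps)
  qed
  show "f - tgen (coset (multiply_out f)) 1 \<in> N" "multiply_out f \<in> A"
    using *[OF subset_refl poly_mapping_sum_single] by auto
qed

lemma J_tensor_null: "s \<in> J \<Longrightarrow> tgen (coset s) 1 \<in> N \<and> s \<in> A"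
  unfolding char_ideal_def
proof (induction rule: left_ideal_gen.induct)
  case (base s)
  then have "coset s = coset 0" by (simp add: coset_cong)
  then show ?case using N_zero_coset[of 1] base I.subset by auto
next
  case (gen a x)
  then obtain t where t: "x = fgen t - fconst (lam t)" "t \<in> h" unfolding char_gens_def by blast
  have w: "fgen t \<in> words_on h" by (rule fgen_in_words[OF t(2)])
  have m: "a * fgen t \<in> A" "fconst (- lam t) * a \<in> A"
    by (rule I.mult_mem[OF gen(1) subsetD[OF h_words w]], rule I.mult_mem[OF fconst_in_words gen(1)])
  have u: "coset a \<in> carrier U" using gen(1) U_simps(1) by blast
  have s: "a * x = a * fgen t + fconst (- lam t) * a"
    unfolding t(1) by (simp add: right_diff_distrib fconst_central[of _ a] single_uminus)
  have 1: "tgen (coset (a * fgen t + fconst (- lam t) * a)) 1 - tgen (coset (a * fgen t)) 1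
      - tgen (coset (fconst (- lam t) * a)) 1 \<in> N" by (rule N_coset_add[OF m])
  have 2: "tgen (coset (a * fgen t)) 1 - tgen (coset a) (lam t * 1) \<in> N"
    using N_act[OF gen(1) w, of 1] by (simp add: char_value_simps)
  have 3: "tgen (coset a) (lam t * 1) - pm_scale (lam t) (tgen (coset a) 1) \<in> N"
    by (rule N_scale_right[OF u])
  have 4: "tgen (coset (fconst (- lam t) * a)) 1 - pm_scale (- lam t) (tgen (coset a) 1) \<in> N"
    by (rule N_coset_scale[OF gen(1)])
  have "(tgen (coset (a * fgen t + fconst (- lam t) * a)) 1 - tgen (coset (a * fgen t)) 1
      - tgen (coset (fconst (- lam t) * a)) 1) + (tgen (coset (a * fgen t)) 1 - tgen (coset a) (lam t * 1))
      + (tgen (coset a) (lam t * 1) - pm_scale (lam t) (tgen (coset a) 1))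
      + (tgen (coset (fconst (- lam t) * a)) 1 - pm_scale (- lam t) (tgen (coset a) 1)) \<in> N"
    by (intro N_add 1 2 3 4)
  then show ?case unfolding s using I.add_mem[OF m] by (simp add: algebra_simps)
next
  case (add p q)
  then have "(tgen (coset (p + q)) 1 - tgen (coset p) 1 - tgen (coset q) 1) + tgen (coset p) 1 + tgen (coset q) 1 \<in> N"
    by (intro N_add N_coset_add) auto
  then show ?case using add I.add_mem by simp
qed

text \<open>The relations of the tensor product hold after multiplying out, and conversely a tensor is congruent to
  the class of its multiplied out form, which is null if it lies in \<open>J\<close>. So the induced module is the
  quotient of the enveloping algebra by \<open>J\<close>.\<close>

lemma tensor_null_eq: "N = {f \<in> T. multiply_out f \<in> J}"
proof
  show "{f \<in> T. multiply_out f \<in> J} \<subseteq> N"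
  proof
    fix f assume f: "f \<in> {f \<in> T. multiply_out f \<in> J}"
    then have "(f - tgen (coset (multiply_out f)) 1) + tgen (coset (multiply_out f)) 1 \<in> N"
      using T_modulo_N(1)[of f] J_tensor_null by (intro N_add) auto
    then show "f \<in> N" by simp
  qed
qed (rule tensor_null_subset)

section \<open>The kernel of the structure morphism\<close>

lemma left_mult_extension:
  "left_mult U u = linear_extension (\<lambda>(v, w) c. Poly_Mapping.single (u \<otimes>\<^bsub>U\<^esub> v, w) c)"
  by (auto simp: left_mult_def linear_extension_def fun_eq_iff case_prod_unfold)

lemma left_mult_single:
  "left_mult U u (Poly_Mapping.single (v, w) c) = Poly_Mapping.single (u \<otimes>\<^bsub>U\<^esub> v, w) c"
  unfolding left_mult_extension by (subst linear_extension_single) auto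

lemma left_mult_null:
  assumes p: "p \<in> char_ann (lspace L) I h" and f: "f \<in> T"
  shows "left_mult U (coset p) f \<in> N"
proof -
  have pA: "p \<in> A" and pJ: "\<And>q. q \<in> A \<Longrightarrow> p * q \<in> J" using p unfolding char_ann_def by auto
  have "Poly_Mapping.single (coset p \<otimes>\<^bsub>U\<^esub> v, w) c \<in> N" if v: "v \<in> carrier U" for v w c
  proof -
    obtain q where q: "q \<in> A" "v = coset q" using v U_simps(1) by blast
    have pq: "p * q \<in> A" using pA q I.mult_mem by blast
    have "fconst (c * w) * (p * q) \<in> J" by (rule J.lmult_ideal[OF fconst_in_words pJ[OF q(1)]])
    then have "multiply_out (Poly_Mapping.single (coset (p * q), w) c) \<in> J"
      using multiply_out_coset[OF pq, of w c] I_J J.mem_cong by blast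
    then show ?thesis
      unfolding q(2) U_simps(2)[OF pA q(1)] tensor_null_eq using pq U_simps(1) by auto
  qed
  then have "(\<Sum>k\<in>Poly_Mapping.keys f. case k of (v, w) \<Rightarrow>
      Poly_Mapping.single (coset p \<otimes>\<^bsub>U\<^esub> v, w) (Poly_Mapping.lookup f (v, w))) \<in> N"
    using f by (intro pm.subspace_sum[OF N_subspace]) auto
  then show ?thesis unfolding left_mult_def .
qed

lemma coset_N: "x \<in> N \<Longrightarrow> x +o N = N"
proof -
  assume x: "x \<in> N"
  have "y \<in> x +o N" if "y \<in> N" for y
    unfolding elt_set_plus_def using N_diff[OF that x] by (intro CollectI bexI[of _ "y - x"]) auto
  then show ?thesis unfolding elt_set_plus_def using N_add[OF x] by auto
qed

lemma restrict_eq_iff: "restrict f S = restrict g S \<longleftrightarrow> (\<forall>x\<in>S. f x = g x)"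
proof
  assume eq: "restrict f S = restrict g S"
  show "\<forall>x\<in>S. f x = g x"
  proof
    fix x assume "x \<in> S"
    then show "f x = g x" using fun_cong[OF eq, of x] by simp
  qed
qed (auto intro: restrict_ext)

text \<open>An element kills the induced module \<open>U/J\<close> iff it maps every class \<open>q\<close>, that is the tensor
  \<open>q \<otimes> 1\<close>, into \<open>J\<close>.\<close>

lemma morphism_kernel_eq: "morphism_kernel L (ind L h W) = coset ` char_ann (lspace L) I h"
proof -
  let ?M = "ind L h W"
  have M: "carrier ?M = (\<lambda>p. p +o N) ` T" "mzero ?M = N"
    "mact ?M = (\<lambda>u C. \<Union>p\<in>C. left_mult U u p +o N)"
    by (simp_all add: ind_def Let_def underlying_W)
  have zero: "\<zero>\<^bsub>end_algebra ?M\<^esub> = (\<lambda>x\<in>carrier ?M. mzero ?M)" by (simp add: end_algebra_def)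
  have "structure_morphism ?M u = \<zero>\<^bsub>end_algebra ?M\<^esub> \<longleftrightarrow> (\<forall>C\<in>carrier ?M. mact ?M u C = N)" for u
    unfolding zero structure_morphism_def M(2) by (rule restrict_eq_iff)
  then have ker: "morphism_kernel L ?M = {u \<in> carrier U. \<forall>f\<in>T. mact ?M u (f +o N) = N}"
    unfolding morphism_kernel_def a_kernel_def' M(1) by auto
  have N0: "0 \<in> N" using pm.subspace_0[OF N_subspace] .
  have mem: "f \<in> f +o N" for f using N0 unfolding elt_set_plus_def by force
  have "coset p \<in> morphism_kernel L ?M" if p: "p \<in> char_ann (lspace L) I h" for p
  proof -
    have "p \<in> A" using p unfolding char_ann_def by blast
    moreover have "mact ?M (coset p) (f +o N) = N" if f: "f \<in> T" for f
    proof -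
      have "left_mult U (coset p) g +o N = N" if g: "g \<in> f +o N" for g
      proof -
        obtain n where "n \<in> N" "g = f + n" using g unfolding elt_set_plus_def by blast
        then have "g \<in> T" using f tensor_null_subset pm.subspace_add[OF T_subspace] by blast
        then show ?thesis using left_mult_null[OF p] coset_N by blast
      qed
      then show ?thesis unfolding M(3) using mem[of f] by auto
    qed
    ultimately show ?thesis unfolding ker using U_simps(1) by blast
  qed
  moreover have "u \<in> coset ` char_ann (lspace L) I h" if u: "u \<in> morphism_kernel L ?M" for u
  proof -
    have u_ker: "u \<in> carrier U \<and> (\<forall>f\<in>T. mact ?M u (f +o N) = N)"
      using u unfolding ker by (rule CollectD)
    then have "u \<in> coset ` A" unfolding U_simps(1) by (rule conjunct1)
    then obtain p where p: "p \<in> A" "u = coset p" by blast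
    have "p * q \<in> J" if q: "q \<in> A" for q
    proof -
      have pq: "p * q \<in> A" using p q I.mult_mem by blast
      let ?f = "tgen (coset q) 1 :: ('g fword \<Rightarrow>\<^sub>0 'k) set \<times> 'k \<Rightarrow>\<^sub>0 'k"
      have "?f \<in> T" using q U_simps(1) by (intro T_single) blast
      then have "mact ?M u (?f +o N) = N" by (rule bspec[OF conjunct2[OF u_ker]])
      then have "left_mult U u ?f +o N \<subseteq> N" unfolding M(3) using mem[of ?f] by blast
      then have "left_mult U u ?f \<in> N" using mem by blast
      then have "tgen (coset (p * q)) 1 \<in> N"
        unfolding left_mult_single p(2) U_simps(2)[OF p(1) q] .
      then have "multiply_out (tgen (coset (p * q)) 1) \<in> J" using tensor_null_subset by blast
      moreover have "multiply_out (tgen (coset (p * q)) 1) - p * q \<in> J"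
        using multiply_out_coset[OF pq, of 1 1] I_J by auto
      ultimately show ?thesis using J.diff_sym J.mem_cong by blast
    qed
    then show ?thesis using p unfolding char_ann_def by blast
  qed
  ultimately show ?thesis by blast
qed

end

theorem theorem4p7:
  fixes L :: "('k::{alg_closed_field, field_char_0}, 'g::ab_group_add) super_lie"
    and lam :: "'g \<Rightarrow> 'k" and h h' :: "'g set" and i j :: bit
  assumes "super_lie_algebra L"
    and "nilpotent_super_lie L"
    and "even_functional L lam"
    and "polarization L lam h"
    and "polarization L lam h'"
  shows "morphism_kernel L (ind L h (char_rep lam i)) = morphism_kernel L (ind L h' (char_rep lam j))"
proof -
  interpret nilpotent_functional L lam
    using assms(1-3)
    by (intro nilpotent_functional.intro lie_functional.intro lie_functional_axioms.intro
        nilpotent_functional_axioms.intro)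
  note h = polarization_imp_polarization_on[OF assms(4)]
  note h' = polarization_imp_polarization_on[OF assms(5)]
  interpret h: char_induced L lam h i by unfold_locales (rule h)
  interpret h': char_induced L lam h' j by unfold_locales (rule h')
  obtain n where n: "rank_le (lspace L) n" using rank_le_exists by blast
  note independent = char_ann_independent[OF n h.lspace_subalgebra h.env_ideal_on_lspace]
  have "char_ann (lspace L) (env_ideal L) h = char_ann (lspace L) (env_ideal L) h'"
    using independent[OF h h'] independent[OF h' h] by blast
  then show ?thesis unfolding h.morphism_kernel_eq h'.morphism_kernel_eq by simp
qed

end
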